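(* Let $X$ be a set of $n$ points in Euclidean space $\mathbb{R}^d$ with distance $\ell_2$, and let $\alpha>1$. There is a data structure for $\alpha$-approximate farthest neighbor over a dynamic partition of $X$ into clusters, supporting the following operations: (1) Initialize$(X,\alpha)$: create the data structure containing a cluster $S_x=\{x\}$ for each $x\in X$, in time $\tilde{O}(n^{1+1/\alpha^2})$; (2) Query$(\mathcal{D},S,q)$: given a cluster $S$ of $\mathcal{D}$ and a query point $q\in X$, return an $\alpha$-approximate farthest neighbor of $q$ in $S$, in time $\tilde{O}(n^{1/\alpha^2})$; (3) Merge$(\mathcal{D},S,S')$: given two clusters $S,S'$ of $\mathcal{D}$, add the cluster $S\sqcup S'$ to $\mathcal{D}$ in time $\tilde{O}(n^{1/\alpha^2}\cdot\min(|S|,|S'|,n^{1/\alpha^2}))$; this consumes $S$ and $S'$, which can no longer be used afterwards. The data structure uses $\tilde{O}(n^{1+1/\alpha^2})$ space. The construction is randomized (in Initialize), and for every $q$ and $S$ the Query operation fails with probability at most $1/n^3$.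
   Context: Given a set $S\subseteq X$ and $q\in X$, a point $r\in S$ is an $\alpha$-approximate farthest neighbor of $q$ in $S$ if $\ell_2(q,r)\ge\frac{1}{\alpha}\max_{p\in S}\ell_2(q,p)$. $\tilde{O}(\cdot)$ hides polylogarithmic factors in $n$. Convention: $d=O(\log n)$ and dependence on $d$ is suppressed in running times. *)

theory Defs
  imports "HOL-Probability.Probability"
begin

section \<open>Points and approximate farthest neighbors\<close>

text \<open>The dimension varies with the input, so a point of \<open>\<real>\<^sup>d\<close> is a list of \<open>d\<close> coordinates.\<close>

type_synonym point = "real list"

definition l2 :: "point \<Rightarrow> point \<Rightarrow> real" where
  "l2 p q = L2_set (\<lambda>j. p ! j - q ! j) {..<length p}"

definition approx_farthest :: "real \<Rightarrow> point set \<Rightarrow> point \<Rightarrow> point \<Rightarrow> bool" where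
  "approx_farthest \<alpha> S q r \<longleftrightarrow> r \<in> S \<and> l2 q r \<ge> (1 / \<alpha>) * Max (l2 q ` S)"


section \<open>The randomized real RAM\<close>

text \<open>
  Running times and space refer to a unit-cost RAM with \<open>m\<close> cells of integer memory and \<open>m\<close> cells
  of real memory. Integer words range over \<open>{0..<m}\<close>, so a word has just enough bits to address the
  memory: a computation whose integer intermediate results leave this range, or which accesses a
  cell outside the memory, is stuck. Exact real numbers can be added, subtracted, multiplied,
  divided and compared, but not rounded, and programs contain no real constants. A program text
  has boundedly many registers.
\<close>

type_synonym reg = nat

datatype iexp =
    IConst nat
  | IReg reg
  | ILoad iexp
  | IAdd iexp iexp
  | ISub iexp iexp
  | IMul iexp iexp
  | IDiv iexp iexp
  | IMod iexp iexp

datatype rexp =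
    RReg reg
  | RLoad iexp
  | ROfInt iexp
  | RAdd rexp rexp
  | RSub rexp rexp
  | RMul rexp rexp
  | RDiv rexp rexp

datatype bexp =
    ILess iexp iexp
  | IEq iexp iexp
  | RLess rexp rexp
  | BNot bexp
  | BAnd bexp bexp

datatype com =
    Skip
  | ISet reg iexp
  | IStore iexp iexp
  | RSet reg rexp
  | RStore iexp rexp
  | Sample reg
  | Seq com com
  | Cond bexp com com
  | While bexp com

text \<open>
  \<open>coins\<close> is the sequence of all random numbers the machine will ever draw, and \<open>used\<close> counts those
  drawn so far.
\<close>

record state =
  ireg :: "reg \<Rightarrow> nat"
  rreg :: "reg \<Rightarrow> real"
  imem :: "nat \<Rightarrow> nat"
  rmem :: "nat \<Rightarrow> real"
  coins :: "nat \<Rightarrow> real"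
  used :: nat

text \<open>Subtraction of words is truncated at zero; division by zero yields zero.\<close>

primrec ival :: "state \<Rightarrow> iexp \<Rightarrow> nat" where
  "ival s (IConst c) = c"
| "ival s (IReg x) = ireg s x"
| "ival s (ILoad e) = imem s (ival s e)"
| "ival s (IAdd e f) = ival s e + ival s f"
| "ival s (ISub e f) = ival s e - ival s f"
| "ival s (IMul e f) = ival s e * ival s f"
| "ival s (IDiv e f) = ival s e div ival s f"
| "ival s (IMod e f) = ival s e mod ival s f"

primrec iok :: "nat \<Rightarrow> state \<Rightarrow> iexp \<Rightarrow> bool" where
  "iok m s (IConst c) \<longleftrightarrow> c < m"
| "iok m s (IReg x) \<longleftrightarrow> ireg s x < m"
| "iok m s (ILoad e) \<longleftrightarrow> iok m s e \<and> imem s (ival s e) < m"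
| "iok m s (IAdd e f) \<longleftrightarrow> iok m s e \<and> iok m s f \<and> ival s e + ival s f < m"
| "iok m s (ISub e f) \<longleftrightarrow> iok m s e \<and> iok m s f"
| "iok m s (IMul e f) \<longleftrightarrow> iok m s e \<and> iok m s f \<and> ival s e * ival s f < m"
| "iok m s (IDiv e f) \<longleftrightarrow> iok m s e \<and> iok m s f"
| "iok m s (IMod e f) \<longleftrightarrow> iok m s e \<and> iok m s f"

primrec rval :: "state \<Rightarrow> rexp \<Rightarrow> real" where
  "rval s (RReg x) = rreg s x"
| "rval s (RLoad e) = rmem s (ival s e)"
| "rval s (ROfInt e) = real (ival s e)"
| "rval s (RAdd e f) = rval s e + rval s f"
| "rval s (RSub e f) = rval s e - rval s f"
| "rval s (RMul e f) = rval s e * rval s f"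
| "rval s (RDiv e f) = rval s e / rval s f"

primrec rok :: "nat \<Rightarrow> state \<Rightarrow> rexp \<Rightarrow> bool" where
  "rok m s (RReg x) \<longleftrightarrow> True"
| "rok m s (RLoad e) \<longleftrightarrow> iok m s e"
| "rok m s (ROfInt e) \<longleftrightarrow> iok m s e"
| "rok m s (RAdd e f) \<longleftrightarrow> rok m s e \<and> rok m s f"
| "rok m s (RSub e f) \<longleftrightarrow> rok m s e \<and> rok m s f"
| "rok m s (RMul e f) \<longleftrightarrow> rok m s e \<and> rok m s f"
| "rok m s (RDiv e f) \<longleftrightarrow> rok m s e \<and> rok m s f"

primrec bval :: "state \<Rightarrow> bexp \<Rightarrow> bool" where
  "bval s (ILess e f) \<longleftrightarrow> ival s e < ival s f"
| "bval s (IEq e f) \<longleftrightarrow> ival s e = ival s f"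
| "bval s (RLess e f) \<longleftrightarrow> rval s e < rval s f"
| "bval s (BNot b) \<longleftrightarrow> \<not> bval s b"
| "bval s (BAnd b c) \<longleftrightarrow> bval s b \<and> bval s c"

primrec bok :: "nat \<Rightarrow> state \<Rightarrow> bexp \<Rightarrow> bool" where
  "bok m s (ILess e f) \<longleftrightarrow> iok m s e \<and> iok m s f"
| "bok m s (IEq e f) \<longleftrightarrow> iok m s e \<and> iok m s f"
| "bok m s (RLess e f) \<longleftrightarrow> rok m s e \<and> rok m s f"
| "bok m s (BNot b) \<longleftrightarrow> bok m s b"
| "bok m s (BAnd b c) \<longleftrightarrow> bok m s b \<and> bok m s c"

text \<open>
  \<open>big_step m c s t s'\<close>: on a machine of size \<open>m\<close>, the program \<open>c\<close> started in \<open>s\<close> halts in \<open>s'\<close> after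
  \<open>t\<close> steps. Evaluating the expressions of a command is included in its unit cost; their size is
  bounded by the program text, so this changes running times by a constant factor only.
\<close>

inductive big_step :: "nat \<Rightarrow> com \<Rightarrow> state \<Rightarrow> nat \<Rightarrow> state \<Rightarrow> bool" for m :: nat where
  Skip: "big_step m Skip s 1 s"
| ISet: "iok m s e \<Longrightarrow> big_step m (ISet x e) s 1 (s\<lparr>ireg := (ireg s)(x := ival s e)\<rparr>)"
| IStore: "iok m s a \<Longrightarrow> iok m s e \<Longrightarrow>
    big_step m (IStore a e) s 1 (s\<lparr>imem := (imem s)(ival s a := ival s e)\<rparr>)"
| RSet: "rok m s e \<Longrightarrow> big_step m (RSet x e) s 1 (s\<lparr>rreg := (rreg s)(x := rval s e)\<rparr>)"
| RStore: "iok m s a \<Longrightarrow> rok m s e \<Longrightarrow>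
    big_step m (RStore a e) s 1 (s\<lparr>rmem := (rmem s)(ival s a := rval s e)\<rparr>)"
| Sample: "big_step m (Sample x) s 1
    (s\<lparr>rreg := (rreg s)(x := coins s (used s)), used := Suc (used s)\<rparr>)"
| Seq: "big_step m c s t s' \<Longrightarrow> big_step m c' s' t' s'' \<Longrightarrow> big_step m (Seq c c') s (t + t') s''"
| CondTrue: "bok m s b \<Longrightarrow> bval s b \<Longrightarrow> big_step m c s t s' \<Longrightarrow>
    big_step m (Cond b c c') s (Suc t) s'"
| CondFalse: "bok m s b \<Longrightarrow> \<not> bval s b \<Longrightarrow> big_step m c' s t s' \<Longrightarrow>
    big_step m (Cond b c c') s (Suc t) s'"
| WhileFalse: "bok m s b \<Longrightarrow> \<not> bval s b \<Longrightarrow> big_step m (While b c) s 1 s"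
| WhileTrue: "bok m s b \<Longrightarrow> bval s b \<Longrightarrow> big_step m c s t s' \<Longrightarrow>
    big_step m (While b c) s' t' s'' \<Longrightarrow> big_step m (While b c) s (Suc (t + t')) s''"

inductive_cases SkipE: "big_step m Skip s t s'"
inductive_cases ISetE: "big_step m (ISet x e) s t s'"
inductive_cases IStoreE: "big_step m (IStore a e) s t s'"
inductive_cases RSetE: "big_step m (RSet x e) s t s'"
inductive_cases RStoreE: "big_step m (RStore a e) s t s'"
inductive_cases SampleE: "big_step m (Sample x) s t s'"
inductive_cases SeqE: "big_step m (Seq c c') s t s'"
inductive_cases CondE: "big_step m (Cond b c c') s t s'"
inductive_cases WhileE: "big_step m (While b c) s t s'"

lemma big_step_deterministic:
  assumes "big_step m c s t1 s1" and "big_step m c s t2 s2"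
  shows "t1 = t2 \<and> s1 = s2"
  using assms
proof (induction arbitrary: t2 s2 rule: big_step.induct)
  case (Seq c s t s' c' t' s'')
  from Seq.prems show ?case by (rule SeqE) (use Seq.IH in blast)
next
  case (CondTrue s b c t s' c')
  from CondTrue.prems show ?case by (rule CondE) (use CondTrue in blast)+
next
  case (CondFalse s b c' t s' c)
  from CondFalse.prems show ?case by (rule CondE) (use CondFalse in blast)+
next
  case (WhileFalse s b c)
  from WhileFalse.prems show ?case by (rule WhileE) (use WhileFalse in auto)
next
  case (WhileTrue s b c t s' t' s'')
  from WhileTrue.prems show ?case by (rule WhileE) (use WhileTrue in blast)+
qed (auto elim: SkipE ISetE IStoreE RSetE RStoreE SampleE)

primrec sample_free :: "com \<Rightarrow> bool" where
  "sample_free Skip \<longleftrightarrow> True"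
| "sample_free (ISet x e) \<longleftrightarrow> True"
| "sample_free (IStore a e) \<longleftrightarrow> True"
| "sample_free (RSet x e) \<longleftrightarrow> True"
| "sample_free (RStore a e) \<longleftrightarrow> True"
| "sample_free (Sample x) \<longleftrightarrow> False"
| "sample_free (Seq c c') \<longleftrightarrow> sample_free c \<and> sample_free c'"
| "sample_free (Cond b c c') \<longleftrightarrow> sample_free c \<and> sample_free c'"
| "sample_free (While b c) \<longleftrightarrow> sample_free c"

definition coin_space :: "(nat \<Rightarrow> real) measure" where
  "coin_space = (\<Pi>\<^sub>M i\<in>UNIV. std_normal_distribution)"


section \<open>Data structures over a dynamic partition\<close>

record data_structure =
  initialize :: com
  query :: com
  merge :: com

text \<open>
  The machine state after initialization is the data structure; the later operations work on it in
  place. A set \<open>X\<close> of points is presented as a list \<open>xs\<close> without repetitions. Initially the real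
  memory holds the coordinates row by row, integer registers 0 and 1 hold \<open>n\<close> and \<open>d\<close>, and real
  register 0 holds \<open>\<alpha>\<close>.
\<close>

definition start :: "point list \<Rightarrow> nat \<Rightarrow> real \<Rightarrow> (nat \<Rightarrow> real) \<Rightarrow> state" where
  "start xs d \<alpha> \<omega> = \<lparr>
     ireg = (\<lambda>_. 0)(0 := length xs, 1 := d),
     rreg = (\<lambda>_. 0)(0 := \<alpha>),
     imem = (\<lambda>_. 0),
     rmem = (\<lambda>a. if a < length xs * d then xs ! (a div d) ! (a mod d) else 0),
     coins = \<omega>,
     used = 0\<rparr>"

text \<open>
  Points are passed to and returned by the operations as positions in \<open>xs\<close>, and clusters as integer
  handles. The handle of an initial cluster \<open>{x}\<close> is the position of \<open>x\<close>; the handle of a merged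
  cluster is chosen by the data structure. Arguments are passed in integer registers 0 and 1, the
  result is returned in integer register 0, and all other registers and the memory persist.
\<close>

definition position :: "point list \<Rightarrow> point \<Rightarrow> nat" where
  "position xs p = (THE i. i < length xs \<and> xs ! i = p)"

definition with_args :: "nat \<Rightarrow> nat \<Rightarrow> state \<Rightarrow> state" where
  "with_args a b s = s\<lparr>ireg := (ireg s)(0 := a, 1 := b)\<rparr>"

datatype operation = Query "point set" point | Merge "point set" "point set"

type_synonym handles = "point set \<Rightarrow> nat"

text \<open>
  \<open>admissible X P ops\<close>: starting from the partition \<open>P\<close>, every operation of \<open>ops\<close> refers to current
  clusters only. Merging consumes its two arguments.
\<close>

fun admissible :: "point set \<Rightarrow> point set set \<Rightarrow> operation list \<Rightarrow> bool" where
  "admissible X P [] \<longleftrightarrow> True"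
| "admissible X P (Query S q # ops) \<longleftrightarrow> S \<in> P \<and> q \<in> X \<and> admissible X P ops"
| "admissible X P (Merge S S' # ops) \<longleftrightarrow> S \<in> P \<and> S' \<in> P \<and> S \<noteq> S' \<and>
     admissible X (insert (S \<union> S') (P - {S, S'})) ops"

definition singletons :: "point set \<Rightarrow> point set set" where
  "singletons X = (\<lambda>x. {x}) ` X"

inductive op_step ::
  "nat \<Rightarrow> data_structure \<Rightarrow> point list \<Rightarrow> state \<times> handles \<Rightarrow> operation \<Rightarrow> nat \<Rightarrow> state \<times> handles \<Rightarrow> bool"
  for m D xs where
  Query: "big_step m (query D) (with_args (h S) (position xs q) s) t s' \<Longrightarrow>
    op_step m D xs (s, h) (Query S q) t (s', h)"
| Merge: "big_step m (merge D) (with_args (h S) (h S') s) t s' \<Longrightarrow>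
    op_step m D xs (s, h) (Merge S S') t (s', h(S \<union> S' := ireg s' 0))"

inductive run ::
  "nat \<Rightarrow> data_structure \<Rightarrow> point list \<Rightarrow> nat \<Rightarrow> real \<Rightarrow> (nat \<Rightarrow> real) \<Rightarrow>
    operation list \<Rightarrow> state \<times> handles \<Rightarrow> bool"
  for m D xs d \<alpha> \<omega> where
  Init: "big_step m (initialize D) (start xs d \<alpha> \<omega>) t s \<Longrightarrow>
    run m D xs d \<alpha> \<omega> [] (s, \<lambda>S. position xs (the_elem S))"
| Step: "run m D xs d \<alpha> \<omega> ops c \<Longrightarrow> op_step m D xs c opn t c' \<Longrightarrow>
    run m D xs d \<alpha> \<omega> (ops @ [opn]) c'"

definition query_succeeds ::
  "nat \<Rightarrow> data_structure \<Rightarrow> point list \<Rightarrow> nat \<Rightarrow> real \<Rightarrow> (nat \<Rightarrow> real) \<Rightarrow>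
    operation list \<Rightarrow> point set \<Rightarrow> point \<Rightarrow> bool" where
  "query_succeeds m D xs d \<alpha> \<omega> ops S q \<longleftrightarrow>
     (\<exists>c t s' h'. run m D xs d \<alpha> \<omega> ops c \<and> op_step m D xs c (Query S q) t (s', h') \<and>
        ireg s' 0 < length xs \<and> approx_farthest \<alpha> S q (xs ! ireg s' 0))"

text \<open>
  The factor hidden by soft-O notation. The logarithm of \<open>n + 1\<close> is at least 1 for every \<open>n \<ge> 1\<close>, and it is
  within a factor 2 of \<open>log 2 n\<close> for \<open>n \<ge> 2\<close>.
\<close>

definition polylog :: "real \<Rightarrow> nat \<Rightarrow> nat \<Rightarrow> real" where
  "polylog K k n = K * log 2 (real n + 1) ^ k"

end

theory Submission
  imports Defs "HOL-Library.Log_Nat"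
begin

text \<open>
  Points are projected on Gaussian directions. Write \<open>r\<close> for the distance of the query \<open>q\<close> to its farthest
  point and put a threshold at \<open>r / \<alpha>\<close> times \<open>sqrt (2 ln n)\<close>. In one direction, a point at distance
  below \<open>r / \<alpha>\<close> exceeds the threshold with probability at most \<open>1 / n\<close>, while the farthest point does so
  with probability \<open>n powr (- 1 / \<alpha>\<^sup>2)\<close> up to a logarithmic factor. Among \<open>L\<close> directions, \<open>L\<close> being
  \<open>n powr (1 / \<alpha>\<^sup>2)\<close> up to logarithms, the farthest point therefore exceeds the threshold at least
  once with constant probability, and by Markov's inequality only \<open>O(L)\<close> pairs of a direction and a near
  point do. Hence the \<open>O(L)\<close> largest projections contain an approximate farthest neighbor. A logarithmic
  number of independent groups of \<open>L\<close> directions reduces the failure probability to \<open>1 / n ^ 3\<close>.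

  To list the largest projections of a cluster, a cluster is kept as a forest of perfect tournament
  trees of distinct ranks, one for each binary digit of its size. The shape of a tree is the same for
  all directions; only the winners at its nodes differ. Two clusters are merged like binary numbers are
  added, with at most one link per rank, so a merge takes \<open>O(L)\<close> time up to logarithms whatever the sizes.
  A query runs a priority queue over all trees and directions of a group and replaces a popped node by its
  two children. A point is popped at most once per rank, so \<open>O(L log n)\<close> pops suffice.
\<close>


section \<open>Weakest preconditions with running times\<close>

definition wp :: "nat \<Rightarrow> com \<Rightarrow> (nat \<Rightarrow> state \<Rightarrow> bool) \<Rightarrow> state \<Rightarrow> bool" where
  "wp m c Q s \<longleftrightarrow> (\<exists>t s'. big_step m c s t s' \<and> Q t s')"

lemma wp_Skip: "wp m Skip Q s \<longleftrightarrow> Q 1 s"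
  unfolding wp_def by (auto elim!: SkipE) (metis big_step.Skip One_nat_def)

lemma wp_ISet: "wp m (ISet x e) Q s \<longleftrightarrow> iok m s e \<and> Q 1 (s\<lparr>ireg := (ireg s)(x := ival s e)\<rparr>)"
  unfolding wp_def by (auto elim!: ISetE) (metis big_step.ISet One_nat_def)

lemma wp_IStore: "wp m (IStore a e) Q s \<longleftrightarrow>
    iok m s a \<and> iok m s e \<and> Q 1 (s\<lparr>imem := (imem s)(ival s a := ival s e)\<rparr>)"
  unfolding wp_def by (auto elim!: IStoreE) (metis big_step.IStore One_nat_def)

lemma wp_RSet: "wp m (RSet x e) Q s \<longleftrightarrow> rok m s e \<and> Q 1 (s\<lparr>rreg := (rreg s)(x := rval s e)\<rparr>)"
  unfolding wp_def by (auto elim!: RSetE) (metis big_step.RSet One_nat_def)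

lemma wp_RStore: "wp m (RStore a e) Q s \<longleftrightarrow>
    iok m s a \<and> rok m s e \<and> Q 1 (s\<lparr>rmem := (rmem s)(ival s a := rval s e)\<rparr>)"
  unfolding wp_def by (auto elim!: RStoreE) (metis big_step.RStore One_nat_def)

lemma wp_Sample: "wp m (Sample x) Q s \<longleftrightarrow>
    Q 1 (s\<lparr>rreg := (rreg s)(x := coins s (used s)), used := Suc (used s)\<rparr>)"
  unfolding wp_def by (auto elim!: SampleE) (metis big_step.Sample One_nat_def)

lemma wp_Seq: "wp m (Seq c c') Q s \<longleftrightarrow> wp m c (\<lambda>t s'. wp m c' (\<lambda>t' s''. Q (t + t') s'') s') s"
  unfolding wp_def by (auto elim!: SeqE) (metis big_step.Seq)+

lemma wp_Cond: "wp m (Cond b c c') Q s \<longleftrightarrow>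
    bok m s b \<and> (if bval s b then wp m c (\<lambda>t. Q (Suc t)) s else wp m c' (\<lambda>t. Q (Suc t)) s)"
  unfolding wp_def by (auto elim!: CondE) (metis big_step.CondTrue big_step.CondFalse)+

lemma wp_While: "wp m (While b c) Q s \<longleftrightarrow> bok m s b \<and>
    (if bval s b then wp m c (\<lambda>t s'. wp m (While b c) (\<lambda>t' s''. Q (Suc (t + t')) s'') s') s else Q 1 s)"
proof
  assume "wp m (While b c) Q s"
  then obtain t s' where bs: "big_step m (While b c) s t s'" and Q: "Q t s'" unfolding wp_def by blast
  from bs show "bok m s b \<and>
    (if bval s b then wp m c (\<lambda>t s'. wp m (While b c) (\<lambda>t' s''. Q (Suc (t + t')) s'') s') s else Q 1 s)"
    by (rule WhileE) (use Q in \<open>auto simp: wp_def\<close>)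
next
  assume "bok m s b \<and>
    (if bval s b then wp m c (\<lambda>t s'. wp m (While b c) (\<lambda>t' s''. Q (Suc (t + t')) s'') s') s else Q 1 s)"
  then show "wp m (While b c) Q s"
    unfolding wp_def One_nat_def[symmetric]
    by (cases "bval s b") (auto intro: big_step.WhileTrue big_step.WhileFalse simp del: One_nat_def)
qed

lemmas wp_simps = wp_Skip wp_ISet wp_IStore wp_RSet wp_RStore wp_Sample wp_Seq wp_Cond

lemma wp_mono: "wp m c Q s \<Longrightarrow> (\<And>t s'. Q t s' \<Longrightarrow> Q' t s') \<Longrightarrow> wp m c Q' s"
  unfolding wp_def by blast

lemma wp_SeqI:
  assumes "wp m c P s" and "\<And>t s'. P t s' \<Longrightarrow> wp m c' (\<lambda>t' s''. Q (t + t') s'') s'"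
  shows "wp m (Seq c c') Q s"
  unfolding wp_Seq using assms by (rule wp_mono)

lemma wp_while_bounded:
  assumes inv: "I k s"
    and step: "\<And>k s. I k s \<Longrightarrow> bok m s b \<and>
      (bval s b \<longrightarrow> 0 < k \<and> wp m c (\<lambda>t s'. t \<le> \<tau> \<and> I (k - 1) s') s)"
  shows "wp m (While b c) (\<lambda>t s'. t \<le> 1 + k * (\<tau> + 1) \<and> \<not> bval s' b \<and> (\<exists>k'. I k' s')) s"
  using inv
proof (induction k arbitrary: s)
  case 0
  then show ?case using step[OF 0] by (subst wp_While) auto
next
  case (Suc k)
  show ?case
  proof (cases "bval s b")
    case True
    with step[OF Suc.prems] have "bok m s b" and body: "wp m c (\<lambda>t s'. t \<le> \<tau> \<and> I k s') s" by auto
    moreover have "wp m (While b c) (\<lambda>t' s''. Suc (t + t') \<le> 1 + Suc k * (\<tau> + 1) \<and>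
        \<not> bval s'' b \<and> (\<exists>k'. I k' s'')) s'" if "t \<le> \<tau> \<and> I k s'" for t s'
      by (rule wp_mono[OF Suc.IH]) (use that in auto)
    ultimately show ?thesis using True by (subst wp_While) (auto elim!: wp_mono)
  next
    case False
    then show ?thesis using step[OF Suc.prems] Suc.prems by (subst wp_While) auto
  qed
qed

lemma wp_while_count:
  assumes inv: "I 0 s"
    and step: "\<And>k s. k < N \<Longrightarrow> I k s \<Longrightarrow>
      bok m s b \<and> bval s b \<and> wp m c (\<lambda>t s'. t \<le> \<tau> \<and> I (Suc k) s') s"
    and stop: "\<And>s. I N s \<Longrightarrow> bok m s b \<and> \<not> bval s b"
  shows "wp m (While b c) (\<lambda>t s'. t \<le> 1 + N * (\<tau> + 1) \<and> I N s') s"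
proof (rule wp_mono[OF wp_while_bounded[where I = "\<lambda>k s. k \<le> N \<and> I (N - k) s" and k = N]])
  show "N \<le> N \<and> I (N - N) s" using inv by simp
  show "bok m s b \<and> (bval s b \<longrightarrow> 0 < k \<and> wp m c (\<lambda>t s'. t \<le> \<tau> \<and> k - 1 \<le> N \<and> I (N - (k - 1)) s') s)"
    if "k \<le> N \<and> I (N - k) s" for k s
  proof (cases "k = 0")
    case False
    then have "N - k < N" and "Suc (N - k) = N - (k - 1)" using that by auto
    then show ?thesis using that step[of "N - k" s] False by (auto elim!: wp_mono)
  qed (use that stop[of s] in simp)
next
  fix t s' assume "t \<le> 1 + N * (\<tau> + 1) \<and> \<not> bval s' b \<and> (\<exists>k. k \<le> N \<and> I (N - k) s')"
  then obtain k where k: "k \<le> N" "I (N - k) s'" "\<not> bval s' b" and t: "t \<le> 1 + N * (\<tau> + 1)" by blast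
  then have "k = 0" using step[of "N - k" s'] by (cases "k = 0") auto
  then show "t \<le> 1 + N * (\<tau> + 1) \<and> I N s'" using k t by simp
qed

abbreviation seq (infixr ";;" 60) where "c ;; c' \<equiv> Seq c c'"
notation IReg ("\<acute>_" [1000] 1000)
notation IAdd (infixl "+\<^sub>I" 65)
notation ISub (infixl "-\<^sub>I" 65)
notation IMul (infixl "*\<^sub>I" 70)
notation IDiv (infixl "div\<^sub>I" 70)
notation IMod (infixl "mod\<^sub>I" 70)
notation ILess (infix "<\<^sub>I" 50)
notation IEq (infix "=\<^sub>I" 50)

definition incr :: "reg \<Rightarrow> com" where
  "incr x = ISet x (\<acute>x +\<^sub>I IConst 1)"

definition for_upto :: "reg \<Rightarrow> reg \<Rightarrow> com \<Rightarrow> com" where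
  "for_upto x y c = ISet x (IConst 0);; While (\<acute>x <\<^sub>I \<acute>y) (c;; incr x)"

lemma wp_incr: "wp m (incr x) Q s \<longleftrightarrow> Suc (ireg s x) < m \<and> Q 1 (s\<lparr>ireg := (ireg s)(x := Suc (ireg s x))\<rparr>)"
  by (auto simp: incr_def wp_ISet)

lemma wp_for_upto:
  assumes start: "I 0 (s\<lparr>ireg := (ireg s)(x := 0)\<rparr>)" and N: "N < m"
    and regs: "\<And>k s. k \<le> N \<Longrightarrow> I k s \<Longrightarrow> ireg s x = k \<and> ireg s y = N"
    and step: "\<And>k s. k < N \<Longrightarrow> I k s \<Longrightarrow>
      wp m c (\<lambda>t s'. t \<le> \<tau> \<and> ireg s' x = k \<and> I (Suc k) (s'\<lparr>ireg := (ireg s')(x := Suc k)\<rparr>)) s"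
  shows "wp m (for_upto x y c) (\<lambda>t s'. t \<le> 2 + N * (\<tau> + 2) \<and> I N s') s"
proof -
  have "wp m (While (\<acute>x <\<^sub>I \<acute>y) (c;; incr x)) (\<lambda>t s'. t \<le> 1 + N * (\<tau> + 1 + 1) \<and> I N s')
    (s\<lparr>ireg := (ireg s)(x := 0)\<rparr>)"
  proof (rule wp_while_count)
    fix k s assume k: "k < N" and I: "I k s"
    have "wp m (c;; incr x) (\<lambda>t s'. t \<le> \<tau> + 1 \<and> I (Suc k) s') s"
      by (rule wp_SeqI[OF step[OF k I]]) (use k N in \<open>auto simp: wp_incr\<close>)
    then show "bok m s (\<acute>x <\<^sub>I \<acute>y) \<and> bval s (\<acute>x <\<^sub>I \<acute>y) \<and>
        wp m (c;; incr x) (\<lambda>t s'. t \<le> \<tau> + 1 \<and> I (Suc k) s') s"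
      using regs[of k s] k N I by simp
  next
    show "bok m s (\<acute>x <\<^sub>I \<acute>y) \<and> \<not> bval s (\<acute>x <\<^sub>I \<acute>y)" if "I N s" for s
      using regs[of N s] that N by simp
  qed (use start in simp)
  then show ?thesis unfolding for_upto_def
    using N by (auto simp: wp_Seq wp_ISet elim!: wp_mono)
qed


section \<open>The programs\<close>

text \<open>
  Registers 2 to 13 hold the parameters of the data structure, with the values fixed in the locale
  \<open>layout\<close> below; all higher registers are scratch and are shared by the operations.
\<close>

abbreviation (input) Handle :: reg where "Handle \<equiv> 0"
abbreviation (input) Query_Point :: reg where "Query_Point \<equiv> 1"
abbreviation (input) Handle2 :: reg where "Handle2 \<equiv> 1"

abbreviation (input) Points :: reg where "Points \<equiv> 2"
abbreviation (input) Dim :: reg where "Dim \<equiv> 3"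
abbreviation (input) Ranks :: reg where "Ranks \<equiv> 4"
abbreviation (input) Scale :: reg where "Scale \<equiv> 5"
abbreviation (input) Group_Dirs :: reg where "Group_Dirs \<equiv> 6"
abbreviation (input) Groups :: reg where "Groups \<equiv> 7"
abbreviation (input) Trees :: reg where "Trees \<equiv> 8"
abbreviation (input) Winners :: reg where "Winners \<equiv> 9"
abbreviation (input) Queue :: reg where "Queue \<equiv> 10"
abbreviation (input) Slots :: reg where "Slots \<equiv> 11"
abbreviation (input) Pops :: reg where "Pops \<equiv> 12"
abbreviation (input) Dirs :: reg where "Dirs \<equiv> 13"

abbreviation (input) Group :: reg where "Group \<equiv> 14"
abbreviation (input) Pos :: reg where "Pos \<equiv> 15"
abbreviation (input) Left :: reg where "Left \<equiv> 16"
abbreviation (input) Right :: reg where "Right \<equiv> 17"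
abbreviation (input) Slot :: reg where "Slot \<equiv> 18"
abbreviation (input) Root :: reg where "Root \<equiv> 19"
abbreviation (input) Popped :: reg where "Popped \<equiv> 20"
abbreviation (input) Top :: reg where "Top \<equiv> 21"
abbreviation (input) Index :: reg where "Index \<equiv> 22"
abbreviation (input) Winner :: reg where "Winner \<equiv> 23"
abbreviation (input) Coord :: reg where "Coord \<equiv> 24"
abbreviation (input) Result :: reg where "Result \<equiv> 25"
abbreviation (input) Child1 :: reg where "Child1 \<equiv> 26"
abbreviation (input) Child2 :: reg where "Child2 \<equiv> 27"

abbreviation (input) Rank :: reg where "Rank \<equiv> 14"
abbreviation (input) Carry :: reg where "Carry \<equiv> 15"
abbreviation (input) Other :: reg where "Other \<equiv> 16"
abbreviation (input) Dir :: reg where "Dir \<equiv> 17"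
abbreviation (input) Addr1 :: reg where "Addr1 \<equiv> 18"
abbreviation (input) Addr2 :: reg where "Addr2 \<equiv> 19"
abbreviation (input) Addr_Max :: reg where "Addr_Max \<equiv> 20"

abbreviation (input) Count :: reg where "Count \<equiv> 14"
abbreviation (input) Row :: reg where "Row \<equiv> 18"
abbreviation (input) Point :: reg where "Point \<equiv> 19"

abbreviation (input) Alpha :: reg where "Alpha \<equiv> 0"
abbreviation (input) Best :: reg where "Best \<equiv> 1"
abbreviation (input) Gauss :: reg where "Gauss \<equiv> 1"
abbreviation (input) Sqdist :: reg where "Sqdist \<equiv> 2"
abbreviation (input) Diff :: reg where "Diff \<equiv> 3"

definition key_exp :: "iexp \<Rightarrow> rexp" where
  "key_exp u = RSub (RLoad (\<acute>Winners +\<^sub>I (u -\<^sub>I IConst 1)))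
     (RLoad (\<acute>Winners +\<^sub>I ((u -\<^sub>I IConst 1) div\<^sub>I \<acute>Trees *\<^sub>I \<acute>Trees +\<^sub>I \<acute>Query_Point)))"

definition pull :: com where
  "pull =
     ISet Left (ILoad (\<acute>Queue +\<^sub>I IConst 2 *\<^sub>I \<acute>Pos));;
     ISet Right (ILoad (\<acute>Queue +\<^sub>I (IConst 2 *\<^sub>I \<acute>Pos +\<^sub>I IConst 1)));;
     Cond (BAnd (BNot (\<acute>Left =\<^sub>I IConst 0))
            (BNot (BAnd (IConst 0 <\<^sub>I \<acute>Right) (RLess (key_exp \<acute>Left) (key_exp \<acute>Right)))))
       (IStore (\<acute>Queue +\<^sub>I \<acute>Pos) \<acute>Left)
       (IStore (\<acute>Queue +\<^sub>I \<acute>Pos) \<acute>Right)"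

definition sift_up :: com where
  "sift_up = While (IConst 1 <\<^sub>I \<acute>Pos) (ISet Pos (\<acute>Pos div\<^sub>I IConst 2);; pull)"

definition build_queue :: com where
  "build_queue = ISet Pos (\<acute>Slots -\<^sub>I IConst 1);;
     While (IConst 0 <\<^sub>I \<acute>Pos) (pull;; ISet Pos (\<acute>Pos -\<^sub>I IConst 1))"

definition set_leaf :: "reg \<Rightarrow> com" where
  "set_leaf x = IStore (\<acute>Queue +\<^sub>I \<acute>Pos) \<acute>x;; sift_up"

definition descend :: com where
  "descend = Cond (ILoad (\<acute>Queue +\<^sub>I IConst 2 *\<^sub>I \<acute>Pos) =\<^sub>I \<acute>Top)
     (ISet Pos (IConst 2 *\<^sub>I \<acute>Pos)) (ISet Pos (IConst 2 *\<^sub>I \<acute>Pos +\<^sub>I IConst 1))"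

definition find_top :: com where
  "find_top = ISet Pos (IConst 1);; While (\<acute>Pos <\<^sub>I \<acute>Slots) descend"

definition fill_leaf :: com where
  "fill_leaf = ISet Root (ILoad (\<acute>Handle *\<^sub>I \<acute>Ranks +\<^sub>I \<acute>Slot mod\<^sub>I \<acute>Ranks));;
     Cond (BAnd (IConst 0 <\<^sub>I \<acute>Root) (\<acute>Slot <\<^sub>I \<acute>Group_Dirs *\<^sub>I \<acute>Ranks))
       (IStore (\<acute>Queue +\<^sub>I (\<acute>Slots +\<^sub>I \<acute>Slot))
          ((\<acute>Group *\<^sub>I (\<acute>Group_Dirs *\<^sub>I \<acute>Ranks) +\<^sub>I \<acute>Slot) *\<^sub>I \<acute>Points +\<^sub>I \<acute>Root))
       (IStore (\<acute>Queue +\<^sub>I (\<acute>Slots +\<^sub>I \<acute>Slot)) (IConst 0))"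

definition load_queue :: com where
  "load_queue = for_upto Slot Slots fill_leaf;; build_queue"

definition distance :: com where
  "distance = RSet Sqdist (ROfInt (IConst 0));;
     for_upto Coord Dim
       (RSet Diff (RSub (RLoad (\<acute>Winner *\<^sub>I \<acute>Dim +\<^sub>I \<acute>Coord)) (RLoad (\<acute>Query_Point *\<^sub>I \<acute>Dim +\<^sub>I \<acute>Coord)));;
        RSet Sqdist (RAdd (RReg Sqdist) (RMul (RReg Diff) (RReg Diff))))"

definition record_winner :: com where
  "record_winner = distance;;
     Cond (RLess (RReg Best) (RReg Sqdist)) (RSet Best (RReg Sqdist);; ISet Result \<acute>Winner) Skip"

definition expand :: com where
  "expand =
     Cond (\<acute>Index div\<^sub>I \<acute>Points mod\<^sub>I \<acute>Ranks =\<^sub>I IConst 0)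
       (ISet Child1 (IConst 0);; ISet Child2 (IConst 0))
       (ISet Child1 (\<acute>Top -\<^sub>I \<acute>Points);;
        ISet Child2 (\<acute>Child1 -\<^sub>I \<acute>Index mod\<^sub>I \<acute>Points
                       +\<^sub>I ILoad (\<acute>Trees +\<^sub>I (\<acute>Index mod\<^sub>I \<acute>Trees -\<^sub>I \<acute>Points))))"

definition set_children :: com where
  "set_children = set_leaf Child1;; ISet Pos (\<acute>Slots +\<^sub>I \<acute>Slot);; set_leaf Child2;; incr Slot"

definition replace_top :: com where
  "replace_top = find_top;; expand;; set_children"

definition pop :: com where
  "pop = ISet Top (ILoad (\<acute>Queue +\<^sub>I IConst 1));;
     Cond (\<acute>Top =\<^sub>I IConst 0) Skip
       (ISet Index (\<acute>Top -\<^sub>I IConst 1);; ISet Winner (ILoad (\<acute>Winners +\<^sub>I \<acute>Index));;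
        record_winner;; replace_top)"

definition query_group :: com where
  "query_group = load_queue;; ISet Slot (\<acute>Group_Dirs *\<^sub>I \<acute>Ranks);; for_upto Popped Pops pop"

definition query_prog :: com where
  "query_prog = ISet Result (IConst 0);; RSet Best (RSub (ROfInt (IConst 0)) (ROfInt (IConst 1)));;
     for_upto Group Groups query_group;; ISet Handle \<acute>Result"

definition link_dir :: com where
  "link_dir = ISet Addr1 (\<acute>Winners +\<^sub>I (\<acute>Dir *\<^sub>I \<acute>Trees +\<^sub>I (\<acute>Rank *\<^sub>I \<acute>Points +\<^sub>I (\<acute>Carry -\<^sub>I IConst 1))));;
     ISet Addr2 (\<acute>Winners +\<^sub>I (\<acute>Dir *\<^sub>I \<acute>Trees +\<^sub>I (\<acute>Rank *\<^sub>I \<acute>Points +\<^sub>I (\<acute>Other -\<^sub>I IConst 1))));;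
     Cond (RLess (RLoad \<acute>Addr1) (RLoad \<acute>Addr2)) (ISet Addr_Max \<acute>Addr2) (ISet Addr_Max \<acute>Addr1);;
     RStore (\<acute>Addr1 +\<^sub>I \<acute>Points) (RLoad \<acute>Addr_Max);;
     IStore (\<acute>Addr1 +\<^sub>I \<acute>Points) (ILoad \<acute>Addr_Max)"

definition link :: com where
  "link = IStore (\<acute>Trees +\<^sub>I (\<acute>Rank *\<^sub>I \<acute>Points +\<^sub>I (\<acute>Carry -\<^sub>I IConst 1))) (\<acute>Other -\<^sub>I IConst 1);;
     for_upto Dir Dirs link_dir"

definition take_root :: "reg \<Rightarrow> com" where
  "take_root h = ISet Other (ILoad (\<acute>h *\<^sub>I \<acute>Ranks +\<^sub>I \<acute>Rank));; IStore (\<acute>h *\<^sub>I \<acute>Ranks +\<^sub>I \<acute>Rank) (IConst 0)"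

definition fill_carry :: com where
  "fill_carry = Cond (\<acute>Carry =\<^sub>I IConst 0) (ISet Carry \<acute>Other;; ISet Other (IConst 0)) Skip"

definition settle_carry :: com where
  "settle_carry = Cond (\<acute>Other =\<^sub>I IConst 0) (take_root Handle) Skip;;
     Cond (\<acute>Other =\<^sub>I IConst 0)
       (IStore (\<acute>Handle *\<^sub>I \<acute>Ranks +\<^sub>I \<acute>Rank) \<acute>Carry;; ISet Carry (IConst 0))
       (link;; ISet Other (IConst 0))"

definition merge_rank :: com where
  "merge_rank = take_root Handle2;; fill_carry;; Cond (\<acute>Carry =\<^sub>I IConst 0) Skip settle_carry"

definition merge_prog :: com where
  "merge_prog = ISet Carry (IConst 0);; ISet Other (IConst 0);; for_upto Rank Ranks merge_rank"

definition init_ranks :: com where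
  "init_ranks = ISet Ranks (IConst 0);; ISet Count (IConst 1);;
     While (BNot (\<acute>Points <\<^sub>I \<acute>Count)) (ISet Count (\<acute>Count *\<^sub>I IConst 2);; incr Ranks)"

definition init_scale :: com where
  "init_scale = ISet Scale (IConst 1);; ISet Count (IConst 0);;
     While (RLess (RMul (ROfInt \<acute>Count) (RMul (RReg Alpha) (RReg Alpha))) (ROfInt \<acute>Ranks))
       (ISet Scale (\<acute>Scale *\<^sub>I IConst 2);; incr Count)"

definition init_layout :: com where
  "init_layout =
     ISet Group_Dirs (IConst 64 *\<^sub>I (\<acute>Ranks *\<^sub>I \<acute>Scale));;
     ISet Groups (IConst 3 *\<^sub>I \<acute>Ranks);;
     ISet Trees (\<acute>Ranks *\<^sub>I \<acute>Points);;
     ISet Winners (IConst 2 *\<^sub>I \<acute>Trees +\<^sub>I \<acute>Points *\<^sub>I \<acute>Dim);;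
     ISet Dirs (\<acute>Groups *\<^sub>I \<acute>Group_Dirs);;
     ISet Queue (\<acute>Winners +\<^sub>I \<acute>Dirs *\<^sub>I \<acute>Trees);;
     ISet Slots (IConst 5 *\<^sub>I (\<acute>Group_Dirs *\<^sub>I \<acute>Ranks));;
     ISet Pops (IConst 4 *\<^sub>I (\<acute>Group_Dirs *\<^sub>I \<acute>Ranks))"

definition init_sizes :: com where
  "init_sizes = ISet Points \<acute>Handle;; ISet Dim \<acute>Query_Point;; init_ranks;; init_scale;; init_layout"

definition init_roots :: com where
  "init_roots = for_upto Point Points (IStore (\<acute>Point *\<^sub>I \<acute>Ranks) (\<acute>Point +\<^sub>I IConst 1))"

definition init_winners :: com where
  "init_winners = for_upto Point Points (IStore (\<acute>Row +\<^sub>I \<acute>Point) \<acute>Point)"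

definition add_coordinate :: com where
  "add_coordinate = Sample Gauss;;
     for_upto Point Points
       (RStore (\<acute>Row +\<^sub>I \<acute>Point)
          (RAdd (RLoad (\<acute>Row +\<^sub>I \<acute>Point)) (RMul (RReg Gauss) (RLoad (\<acute>Point *\<^sub>I \<acute>Dim +\<^sub>I \<acute>Coord)))))"

definition project_row :: com where
  "project_row = ISet Row (\<acute>Winners +\<^sub>I \<acute>Dir *\<^sub>I \<acute>Trees);; init_winners;; for_upto Coord Dim add_coordinate"

definition init_projections :: com where
  "init_projections = for_upto Dir Dirs project_row"

definition init_prog :: com where
  "init_prog = init_sizes;; init_roots;; init_projections"

definition afn_structure :: data_structure where
  "afn_structure = \<lparr>initialize = init_prog, query = query_prog, merge = merge_prog\<rparr>"

lemma sample_free_afn_structure: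
  "sample_free (query afn_structure)" "sample_free (merge afn_structure)"
  by (simp_all add: afn_structure_def for_upto_def incr_def query_prog_def query_group_def load_queue_def fill_leaf_def
      build_queue_def pop_def record_winner_def distance_def replace_top_def find_top_def descend_def expand_def
      set_children_def set_leaf_def sift_up_def pull_def merge_prog_def merge_rank_def take_root_def fill_carry_def
      settle_carry_def link_def link_dir_def)


section \<open>Memory layout\<close>

text \<open>
  A cluster is a forest of trees of ranks below \<open>b\<close>, the bit length of \<open>n\<close>; a tree is named by its rank
  \<open>r\<close> and a representative \<open>x\<close>. The scale \<open>W\<close> is \<open>n powr (1 / \<alpha>\<^sup>2)\<close> up to a constant factor. Integer memory
  consists of the roots of the clusters, the right children and the winners of the trees, and the
  priority queue of a query. A root is stored as its successor, so that 0 means absent. Real memory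
  holds the coordinates of the points and, at the address of each winner, its projection. A tree
  \<open>(r, x)\<close> in direction \<open>i\<close> enters the queue as \<open>code i r x\<close>; the code 0 marks an empty slot.
\<close>

locale layout =
  fixes n d b W :: nat
  assumes b_pos: "0 < b" and n_lower: "2 ^ (b - 1) \<le> n" and n_upper: "n < 2 ^ b"
    and W_pos: "0 < W" and W_upper: "W \<le> 2 ^ b"
begin

definition group_dirs :: nat where "group_dirs = 64 * b * W"
definition dirs :: nat where "dirs = 3 * b * group_dirs"
definition trees :: nat where "trees = b * n"
definition winners :: nat where "winners = 2 * trees + n * d"
definition queue :: nat where "queue = winners + dirs * trees"
definition slots :: nat where "slots = 5 * group_dirs * b"
definition pops :: nat where "pops = 4 * group_dirs * b"

definition root_addr :: "nat \<Rightarrow> nat \<Rightarrow> nat" where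
  "root_addr a j = a * b + j"

definition child_addr :: "nat \<Rightarrow> nat \<Rightarrow> nat" where
  "child_addr r x = trees + (r * n + x)"

definition winner_addr :: "nat \<Rightarrow> nat \<Rightarrow> nat \<Rightarrow> nat" where
  "winner_addr i r x = winners + (i * trees + (r * n + x))"

definition code :: "nat \<Rightarrow> nat \<Rightarrow> nat \<Rightarrow> nat" where
  "code i r x = Suc (i * trees + (r * n + x))"

definition params :: "(reg \<Rightarrow> nat) \<Rightarrow> bool" where
  "params r \<longleftrightarrow> r Points = n \<and> r Dim = d \<and> r Ranks = b \<and> r Group_Dirs = group_dirs \<and> r Groups = 3 * b \<and>
     r Trees = trees \<and> r Winners = winners \<and> r Queue = queue \<and> r Slots = slots \<and> r Pops = pops \<and> r Dirs = dirs"

lemma params_upd [simp]: "x \<notin> {2..13} \<Longrightarrow> params (r(x := v)) = params r"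
  by (auto simp: params_def)

lemma params_ireg [simp]:
  assumes "params (ireg s)"
  shows "ireg s Points = n" "ireg s Dim = d" "ireg s Ranks = b" "ireg s Group_Dirs = group_dirs"
    "ireg s Groups = 3 * b" "ireg s Trees = trees" "ireg s Winners = winners" "ireg s Queue = queue"
    "ireg s Slots = slots" "ireg s Pops = pops" "ireg s Dirs = dirs"
  using assms by (simp_all only: params_def)

lemma n_pos: "0 < n" using n_lower by (meson less_le_trans zero_less_numeral zero_less_power)
lemma group_dirs_pos: "0 < group_dirs" using b_pos W_pos by (simp add: group_dirs_def)
lemma trees_pos: "0 < trees" using b_pos n_pos by (simp add: trees_def)
lemma dirs_pos: "0 < dirs" using b_pos group_dirs_pos by (simp add: dirs_def)
lemma slots_pos: "0 < slots" using b_pos group_dirs_pos by (simp add: slots_def)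

lemma n_le_trees: "n \<le> trees" using b_pos by (simp add: trees_def)

lemma slots_eq: "slots = group_dirs * b + pops" by (simp add: slots_def pops_def)

lemma tree_index_less: "r < b \<Longrightarrow> x < n \<Longrightarrow> r * n + x < trees"
  using mult_le_mono1[of "Suc r" b n] by (simp add: trees_def)

lemma dir_index_less: "i < dirs \<Longrightarrow> y < trees \<Longrightarrow> i * trees + y < dirs * trees"
  using mult_le_mono1[of "Suc i" dirs trees] by simp

lemma coord_index_less: "w < n \<Longrightarrow> j < d \<Longrightarrow> w * d + j < n * d"
  using mult_le_mono1[of "Suc w" n d] by simp

lemma root_addr_less: "a < n \<Longrightarrow> j < b \<Longrightarrow> root_addr a j < trees"
  using mult_le_mono1[of "Suc a" n b] by (simp add: root_addr_def trees_def mult.commute)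

lemma root_addr_eq:
  assumes "j < b" "j' < b" shows "root_addr a j = root_addr a' j' \<longleftrightarrow> a = a' \<and> j = j'"
proof
  assume eq: "root_addr a j = root_addr a' j'"
  have "(a * b + j) div b = a" "(a' * b + j') div b = a'" "(a * b + j) mod b = j" "(a' * b + j') mod b = j'"
    using assms by auto
  then show "a = a' \<and> j = j'" using eq by (metis root_addr_def)
qed simp

lemma code_decode:
  assumes "r < b" "x < n"
  shows "(code i r x - 1) div trees = i" "(code i r x - 1) mod trees = r * n + x"
    "(code i r x - 1) mod n = x" "(code i r x - 1) div n mod b = r"
proof -
  show "(code i r x - 1) div trees = i" "(code i r x - 1) mod trees = r * n + x"
    using tree_index_less[OF assms] by (auto simp: code_def)
  have index: "code i r x - 1 = x + (i * b + r) * n" by (simp add: code_def trees_def algebra_simps)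
  show "(code i r x - 1) mod n = x" unfolding index using assms by (simp only: mod_mult_self1 mod_less)
  have "(x + (i * b + r) * n) div n = i * b + r" using assms n_pos by (simp only: div_mult_self1 div_less)
  then show "(code i r x - 1) div n mod b = r" unfolding index using assms by simp
qed

lemma code_neq_0 [simp]: "code i r x \<noteq> 0"
  by (simp add: code_def)

lemma code_Suc_rank: "code i (Suc r) x = code i r x + n"
  by (simp add: code_def)

lemma winner_addr_code: "winner_addr i r x = winners + (code i r x - 1)"
  by (simp add: winner_addr_def code_def)

lemma winner_addr_eq:
  assumes "r < b" "x < n" "r' < b" "x' < n"
  shows "winner_addr i r x = winner_addr i' r' x' \<longleftrightarrow> i = i' \<and> r = r' \<and> x = x'"
  using code_decode[OF assms(1,2), of i] code_decode[OF assms(3,4), of i'] unfolding winner_addr_code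
  by (metis add_left_cancel)

lemma child_addr_eq:
  assumes "r < b" "x < n" "r' < b" "x' < n"
  shows "child_addr r x = child_addr r' x' \<longleftrightarrow> r = r' \<and> x = x'"
  using winner_addr_eq[OF assms, of 0 0] by (simp add: child_addr_def winner_addr_def)

lemma code_le: "i < dirs \<Longrightarrow> r < b \<Longrightarrow> x < n \<Longrightarrow> code i r x \<le> dirs * trees"
  using dir_index_less[OF _ tree_index_less] by (simp add: code_def Suc_le_eq)

lemma winner_addr_less: "i < dirs \<Longrightarrow> r < b \<Longrightarrow> x < n \<Longrightarrow> winner_addr i r x < queue"
  using code_le[of i r x] by (simp add: winner_addr_code queue_def code_def)

lemma winners_le_winner_addr: "winners \<le> winner_addr i r x"
  by (simp add: winner_addr_def)

lemma child_addr_less: "r < b \<Longrightarrow> x < n \<Longrightarrow> child_addr r x < 2 * trees"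
  using tree_index_less[of r x] by (simp add: child_addr_def)

lemma trees_le_child_addr: "trees \<le> child_addr r x"
  by (simp add: child_addr_def)

lemma region_order: "trees \<le> 2 * trees" "2 * trees \<le> winners" "n * d \<le> winners" "winners \<le> queue"
  by (simp_all add: winners_def queue_def)

end

definition regs_same_off :: "reg set \<Rightarrow> state \<Rightarrow> state \<Rightarrow> bool" where
  "regs_same_off R s s' \<longleftrightarrow> (\<forall>x. x \<notin> R \<longrightarrow> ireg s' x = ireg s x)"

lemma (in layout) params_regs_same_off:
  assumes "regs_same_off R s s'" "R \<inter> {2..13} = {}" "params (ireg s)"
  shows "params (ireg s')"
proof -
  have "ireg s' x = ireg s x" if "x \<in> {2..13}" for x
    using assms(1,2) that by (auto simp: regs_same_off_def disjoint_iff)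
  then show ?thesis using assms(3) unfolding params_def by simp
qed

locale machine = layout +
  fixes m :: nat
  assumes memory: "queue + 2 * slots + 2 ^ b < m"
begin

lemma params_less: "n < m" "d < m" "b < m" "3 * b < m" "group_dirs < m" "trees < m" "winners < m"
  "queue < m"
    "slots < m" "pops < m" "dirs < m" "dirs * trees < m" "group_dirs * b < m" "320 < m"
proof -
  have "d \<le> n * d" using n_pos by simp
  moreover have "group_dirs \<le> group_dirs * b" "group_dirs * b \<le> slots" "pops \<le> slots"
    using b_pos by (simp_all add: slots_def pops_def)
  moreover have "3 * b \<le> group_dirs" unfolding group_dirs_def using W_pos by (simp add: mult.commute)
  moreover have "b \<le> trees" "dirs \<le> dirs * trees" using n_pos trees_pos by (simp_all add: trees_def)
  moreover have "320 \<le> slots"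
  proof -
    have "1 * 1 * 1 * 1 \<le> b * W * b * 1" using b_pos W_pos by (intro mult_le_mono) auto
    then show ?thesis by (simp add: slots_def group_dirs_def)
  qed
  ultimately show "n < m" "d < m" "b < m" "3 * b < m" "group_dirs < m" "trees < m" "winners < m" "queue < m"
      "slots < m" "pops < m" "dirs < m" "dirs * trees < m" "group_dirs * b < m" "320 < m"
    using memory n_le_trees unfolding queue_def winners_def by linarith+
qed

lemma queue_less: "k < 2 * slots \<Longrightarrow> queue + k < m"
  using memory by linarith

end


section \<open>The priority queue of a query\<close>

context layout
begin

definition frame :: "reg set \<Rightarrow> reg set \<Rightarrow> state \<Rightarrow> state \<Rightarrow> bool" where
  "frame R F s s' \<longleftrightarrow> regs_same_off R s s' \<and> (\<forall>x. x \<notin> F \<longrightarrow> rreg s' x = rreg s x) \<and>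
     rmem s' = rmem s \<and> coins s' = coins s \<and> used s' = used s \<and> (\<forall>a<queue. imem s' a = imem s a)"

lemma frame_refl: "frame R F s s" by (simp add: frame_def regs_same_off_def)

lemma frame_trans:
  "frame R F s s' \<Longrightarrow> frame R' F' s' s'' \<Longrightarrow> R \<union> R' \<subseteq> R'' \<Longrightarrow> F \<union> F' \<subseteq> F'' \<Longrightarrow> frame R'' F'' s s''"
  unfolding frame_def regs_same_off_def by (metis UnCI subsetD)

lemma frame_mono: "frame R F s s' \<Longrightarrow> R \<subseteq> R' \<Longrightarrow> F \<subseteq> F' \<Longrightarrow> frame R' F' s s'"
  using frame_trans[OF frame_refl] by (metis sup_bot_left)

lemma frame_params: "frame R F s s' \<Longrightarrow> R \<inter> {2..13} = {} \<Longrightarrow> params (ireg s) \<Longrightarrow> params (ireg s')"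
  by (auto simp: frame_def intro: params_regs_same_off)

lemma frame_ireg: "frame R F s s' \<Longrightarrow> x \<notin> R \<Longrightarrow> ireg s' x = ireg s x"
  by (simp add: frame_def regs_same_off_def)

lemma frame_rreg: "frame R F s s' \<Longrightarrow> x \<notin> F \<Longrightarrow> rreg s' x = rreg s x"
  by (simp add: frame_def)

lemma frame_rmem: "frame R F s s' \<Longrightarrow> rmem s' = rmem s"
  by (simp add: frame_def)

lemma frame_imem: "frame R F s s' \<Longrightarrow> a < queue \<Longrightarrow> imem s' a = imem s a"
  by (simp add: frame_def)

lemma frame_ireg_upd: "frame R F s s' \<Longrightarrow> x \<in> R \<Longrightarrow> frame R F s (s'\<lparr>ireg := (ireg s')(x := v)\<rparr>)"
  by (auto simp: frame_def regs_same_off_def)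

definition key :: "(nat \<Rightarrow> real) \<Rightarrow> nat \<Rightarrow> nat \<Rightarrow> real" where
  "key rm q u = rm (winners + (u - 1)) - rm (winners + ((u - 1) div trees * trees + q))"

definition better :: "(nat \<Rightarrow> real) \<Rightarrow> nat \<Rightarrow> nat \<Rightarrow> nat \<Rightarrow> nat" where
  "better rm q u v = (if u \<noteq> 0 \<and> \<not> (0 < v \<and> key rm q u < key rm q v) then u else v)"

definition slot :: "state \<Rightarrow> nat \<Rightarrow> nat" where
  "slot s k = imem s (queue + (slots + k))"

text \<open>
  The queue is a tournament tree in heap order: its leaves are the slots, and every inner node holds the
  better of its children, except for the nodes in \<open>U\<close>, about which nothing is said.
\<close>

definition queue_ok :: "nat \<Rightarrow> nat set \<Rightarrow> state \<Rightarrow> bool" where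
  "queue_ok q U s \<longleftrightarrow> (\<forall>k. 0 < k \<longrightarrow> k < 2 * slots \<longrightarrow> k \<notin> U \<longrightarrow> imem s (queue + k) \<le> dirs * trees) \<and>
     (\<forall>k. 0 < k \<longrightarrow> k < slots \<longrightarrow> k \<notin> U \<longrightarrow> imem s (queue + k) =
        better (rmem s) q (imem s (queue + 2 * k)) (imem s (queue + (2 * k + 1))))"

lemma queue_okD:
  assumes "queue_ok q U s"
  shows queue_ok_code: "0 < k \<Longrightarrow> k < 2 * slots \<Longrightarrow> k \<notin> U \<Longrightarrow> imem s (queue + k) \<le> dirs * trees"
    and queue_ok_better: "0 < k \<Longrightarrow> k < slots \<Longrightarrow> k \<notin> U \<Longrightarrow>
      imem s (queue + k) = better (rmem s) q (imem s (queue + 2 * k)) (imem s (queue + (2 * k + 1)))"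
  using assms unfolding queue_ok_def by blast+

lemma queue_ok_ireg [simp]: "queue_ok q U (s\<lparr>ireg := r\<rparr>) = queue_ok q U s"
  by (simp add: queue_ok_def)

lemma slot_ireg [simp]: "slot (s\<lparr>ireg := r\<rparr>) = slot s"
  by (simp add: slot_def fun_eq_iff)

lemma queue_ok_zero: "queue_ok q {0} s \<Longrightarrow> queue_ok q {} s"
  by (simp add: queue_ok_def)

lemma better_le: "u \<le> c \<Longrightarrow> v \<le> c \<Longrightarrow> better rm q u v \<le> c"
  by (simp add: better_def)

lemma better_cases: "better rm q u v = u \<or> better rm q u v = v"
  by (simp add: better_def)

lemma key_index_less:
  assumes "u \<le> dirs * trees" "q < n"
  shows "u - 1 < dirs * trees" "(u - 1) div trees * trees + q < dirs * trees"
    "(u - 1) div trees * trees < dirs * trees" "(u - 1) div trees < dirs * trees"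
proof -
  have "0 < dirs * trees" using dirs_pos trees_pos by simp
  then show u: "u - 1 < dirs * trees" using assms by linarith
  then have "(u - 1) div trees < dirs" using trees_pos by (simp add: less_mult_imp_div_less)
  then show q: "(u - 1) div trees * trees + q < dirs * trees"
    using assms n_le_trees by (intro dir_index_less) auto
  then show *: "(u - 1) div trees * trees < dirs * trees" by linarith
  have "(u - 1) div trees \<le> (u - 1) div trees * trees" using trees_pos by simp
  then show "(u - 1) div trees < dirs * trees" using * by linarith
qed

lemma queue_top_max:
  assumes ok: "queue_ok q {} s" and k: "0 < k" "k < 2 * slots" "imem s (queue + k) \<noteq> 0"
  shows "imem s (queue + 1) \<noteq> 0 \<and> key (rmem s) q (imem s (queue + k)) \<le> key (rmem s) q (imem s (queue + 1))"
  using k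
proof (induction k rule: less_induct)
  case (less k)
  show ?case
  proof (cases "k = 1")
    case False
    let ?j = "k div 2"
    have j: "0 < ?j" "?j < slots" "?j < k" using less.prems False by auto
    have parent: "imem s (queue + ?j) =
        better (rmem s) q (imem s (queue + 2 * ?j)) (imem s (queue + (2 * ?j + 1)))"
      using queue_ok_better[OF ok j(1,2)] by simp
    have "k = 2 * ?j \<or> k = 2 * ?j + 1" by auto
    then have "imem s (queue + k) = imem s (queue + 2 * ?j) \<or>
        imem s (queue + k) = imem s (queue + (2 * ?j + 1))"
      by metis
    then have "imem s (queue + ?j) \<noteq> 0 \<and>
        key (rmem s) q (imem s (queue + k)) \<le> key (rmem s) q (imem s (queue + ?j))"
      using less.prems(3) unfolding parent better_def by (auto split: if_splits)
    then show ?thesis using less.IH[of ?j] j by auto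
  qed (use less.prems in auto)
qed

lemma queue_top_max_slot:
  assumes "queue_ok q {} s" "k < slots" "slot s k \<noteq> 0"
  shows "imem s (queue + 1) \<noteq> 0" "key (rmem s) q (slot s k) \<le> key (rmem s) q (imem s (queue + 1))"
  using queue_top_max[OF assms(1), of "slots + k"] assms(2,3) slots_pos by (auto simp: slot_def)

definition depth :: nat where "depth = 10 + 3 * b"

lemma two_slots_le: "2 * slots \<le> 2 ^ depth"
proof -
  have b: "b \<le> 2 ^ b" by (simp add: less_imp_le)
  have "2 * slots = 640 * (b * b * W)" by (simp add: slots_def group_dirs_def)
  also have "\<dots> \<le> 1024 * (2 ^ b * 2 ^ b * 2 ^ b)"
    using b W_upper by (intro mult_le_mono) auto
  also have "\<dots> = 2 ^ (10 + (b + b + b))" by (simp only: power_add) simp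
  also have "10 + (b + b + b) = depth" by (simp add: depth_def)
  finally show ?thesis .
qed

end

context machine
begin

lemma key_exp_eval:
  assumes "params (ireg s)" "ireg s Query_Point = q" "q < n" "ireg s x \<le> dirs * trees"
  shows "rok m s (key_exp \<acute>x)" "rval s (key_exp \<acute>x) = key (rmem s) q (ireg s x)"
proof -
  have "queue = winners + dirs * trees" "1 < m" using params_less(14) by (simp_all add: queue_def)
  then show "rok m s (key_exp \<acute>x)"
    using assms params_less key_index_less[OF assms(4,3)]
    by (simp add: key_exp_def mult.commute)
  show "rval s (key_exp \<acute>x) = key (rmem s) q (ireg s x)"
    using assms by (simp add: key_exp_def key_def)
qed

lemma wp_pull:
  assumes par: "params (ireg s)" and regs: "ireg s Pos = k" "ireg s Query_Point = q" and q: "q < n"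
    and k: "0 < k" "k < slots" and ok: "queue_ok q U s" "2 * k \<notin> U" "2 * k + 1 \<notin> U"
  shows "wp m pull (\<lambda>t s'. t \<le> 4 \<and> frame {Left, Right} {} s s' \<and> slot s' = slot s \<and>
    queue_ok q (insert (k div 2) (U - {k})) s') s"
proof -
  let ?u = "imem s (queue + 2 * k)" and ?v = "imem s (queue + (2 * k + 1))"
  let ?w = "better (rmem s) q ?u ?v"
  let ?s = "s\<lparr>ireg := (ireg s)(Left := ?u, Right := ?v)\<rparr>"
  let ?f = "?s\<lparr>imem := (imem s)(queue + k := ?w)\<rparr>"
  have uv: "?u \<le> dirs * trees" "?v \<le> dirs * trees"
    using queue_ok_code[OF ok(1), of "2 * k"] queue_ok_code[OF ok(1), of "2 * k + 1"] ok(2,3) k by auto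
  have "queue_ok q (insert (k div 2) (U - {k})) ?f"
    unfolding queue_ok_def
  proof (intro conjI allI impI)
    fix i assume i: "0 < i" "i < 2 * slots" "i \<notin> insert (k div 2) (U - {k})"
    show "imem ?f (queue + i) \<le> dirs * trees"
      using queue_ok_code[OF ok(1)] i better_le[OF uv] by (cases "i = k") auto
  next
    fix i assume i: "0 < i" "i < slots" "i \<notin> insert (k div 2) (U - {k})"
    then have "2 * i \<noteq> k" "2 * i + 1 \<noteq> k" by auto
    then show "imem ?f (queue + i) =
        better (rmem ?f) q (imem ?f (queue + 2 * i)) (imem ?f (queue + (2 * i + 1)))"
      using queue_ok_better[OF ok(1)] i by (cases "i = k") auto
  qed
  moreover have "frame {Left, Right} {} s ?f" by (simp add: frame_def regs_same_off_def)
  moreover have "slot ?f = slot s" using k by (simp add: slot_def fun_eq_iff)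
  moreover have "params (ireg ?s)" "ireg ?s Query_Point = q" using par regs by simp_all
  note key_exp_eval[OF this q, of Left] key_exp_eval[OF this q, of Right]
  moreover have "queue + 2 * k < m" "queue + (2 * k + 1) < m" "queue + k < m" "2 * k + 1 < m"
    "k < m" "2 < m"
    using queue_less[of "2 * k + 1"] queue_less[of k] k params_less(14) by auto
  ultimately show ?thesis
    using par regs uv params_less
    by (auto simp: pull_def wp_simps better_def split: if_splits)
qed

lemma wp_sift_up:
  assumes par: "params (ireg s)" and regs: "ireg s Pos = k" "ireg s Query_Point = q" and q: "q < n"
    and k: "0 < k" "k < 2 * slots" and ok: "queue_ok q {k div 2} s"
  shows "wp m sift_up (\<lambda>t s'. t \<le> 1 + depth * 6 \<and> frame {Pos, Left, Right} {} s s' \<and> slot s' = slot s \<and>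
    queue_ok q {} s') s"
proof -
  define I where "I = (\<lambda>j s'. frame {Pos, Left, Right} {} s s' \<and> slot s' = slot s \<and> 0 < ireg s' Pos \<and>
    ireg s' Pos < 2 * slots \<and> ireg s' Pos < 2 ^ j \<and> queue_ok q {ireg s' Pos div 2} s')"
  have "wp m sift_up (\<lambda>t s'. t \<le> 1 + depth * (5 + 1) \<and> \<not> bval s' (IConst 1 <\<^sub>I \<acute>Pos) \<and> (\<exists>j. I j s')) s"
    unfolding sift_up_def
  proof (rule wp_while_bounded)
    show "I depth s" using regs k ok two_slots_le by (simp add: I_def frame_refl)
    fix j s1 assume I: "I j s1"
    let ?j = "ireg s1 Pos div 2"
    let ?s1 = "s1\<lparr>ireg := (ireg s1)(Pos := ?j)\<rparr>"
    have less: "ireg s1 Pos < m" "2 < m" using I memory params_less(14) by (auto simp: I_def)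
    have "0 < j \<and> wp m (ISet Pos (\<acute>Pos div\<^sub>I IConst 2);; pull) (\<lambda>t s'. t \<le> 5 \<and> I (j - 1) s') s1"
      if gt: "1 < ireg s1 Pos"
    proof
      show j: "0 < j" using I gt by (cases j) (auto simp: I_def)
      have half: "?j < 2 ^ (j - 1)" using I j by (cases j) (auto simp: I_def)
      have framed: "frame {Pos, Left, Right} {} s ?s1" using I by (auto simp: I_def intro: frame_ireg_upd)
      have par1: "params (ireg ?s1)" by (rule frame_params[OF framed _ par]) auto
      have "ireg ?s1 Query_Point = q" using frame_ireg[OF framed, of Query_Point] regs by simp
      then have "wp m pull (\<lambda>t s'. t \<le> 4 \<and> frame {Left, Right} {} ?s1 s' \<and> slot s' = slot ?s1 \<and>
        queue_ok q (insert (?j div 2) ({?j} - {?j})) s') ?s1"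
        using par1 q I gt by (intro wp_pull) (auto simp: I_def)
      then have "wp m pull (\<lambda>t s'. Suc t \<le> 5 \<and> I (j - 1) s') ?s1"
      proof (rule wp_mono, elim conjE, intro conjI)
        fix t s2 assume t: "t \<le> 4" and framed2: "frame {Left, Right} {} ?s1 s2" and sl: "slot s2 = slot ?s1"
          and ok2: "queue_ok q (insert (?j div 2) ({?j} - {?j})) s2"
        have "ireg s2 Pos = ?j" using frame_ireg[OF framed2, of Pos] by simp
        moreover have "frame {Pos, Left, Right} {} s s2" by (rule frame_trans[OF framed framed2]) auto
        ultimately show "I (j - 1) s2" using I ok2 gt half sl by (auto simp: I_def)
      qed simp
      then show "wp m (ISet Pos (\<acute>Pos div\<^sub>I IConst 2);; pull) (\<lambda>t s'. t \<le> 5 \<and> I (j - 1) s') s1"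
        using less by (simp add: wp_simps)
    qed
    then show "bok m s1 (IConst 1 <\<^sub>I \<acute>Pos) \<and> (bval s1 (IConst 1 <\<^sub>I \<acute>Pos) \<longrightarrow> 0 < j \<and>
        wp m (ISet Pos (\<acute>Pos div\<^sub>I IConst 2);; pull) (\<lambda>t s'. t \<le> 5 \<and> I (j - 1) s') s1)"
      using less by simp
  qed
  then show ?thesis
    by (rule wp_mono) (auto simp: I_def less_Suc_eq intro!: queue_ok_zero)
qed

lemma wp_set_leaf:
  assumes par: "params (ireg s)" and regs: "ireg s Pos = slots + k" "ireg s Query_Point = q" and q: "q < n"
    and k: "k < slots" and code: "ireg s x \<le> dirs * trees" and ok: "queue_ok q {} s"
  shows "wp m (set_leaf x) (\<lambda>t s'. t \<le> 2 + depth * 6 \<and> frame {Pos, Left, Right} {} s s' \<and>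
    slot s' = (slot s)(k := ireg s x) \<and> queue_ok q {} s') s"
proof -
  let ?p = "slots + k"
  let ?s = "s\<lparr>imem := (imem s)(queue + ?p := ireg s x)\<rparr>"
  have "queue_ok q {?p div 2} ?s"
    unfolding queue_ok_def
  proof (intro conjI allI impI)
    fix i assume i: "0 < i" "i < slots" "i \<notin> {?p div 2}"
    then have "2 * i \<noteq> ?p" "2 * i + 1 \<noteq> ?p" "i \<noteq> ?p" by auto
    then show "imem ?s (queue + i) =
        better (rmem ?s) q (imem ?s (queue + 2 * i)) (imem ?s (queue + (2 * i + 1)))"
      using queue_ok_better[OF ok] i by simp
  qed (use queue_ok_code[OF ok] code in auto)
  then have "wp m sift_up (\<lambda>t s'. t \<le> 1 + depth * 6 \<and> frame {Pos, Left, Right} {} ?s s' \<and>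
      slot s' = slot ?s \<and> queue_ok q {} s') ?s"
    using par regs q k slots_pos by (intro wp_sift_up) auto
  moreover have "frame {Pos, Left, Right} {} s ?s" by (auto simp: frame_def regs_same_off_def)
  moreover have "slot ?s = (slot s)(k := ireg s x)" by (auto simp: slot_def)
  moreover have "queue + ?p < m" "?p < m" using queue_less[of ?p] k by auto
  ultimately show ?thesis
    using par regs code params_less
    by (auto simp: set_leaf_def wp_simps elim!: wp_mono intro: frame_trans)
qed

lemma wp_build_queue:
  assumes par: "params (ireg s)" and q: "ireg s Query_Point = q" "q < n" and ok: "queue_ok q {..<slots} s"
  shows "wp m build_queue (\<lambda>t s'. t \<le> 2 + slots * 6 \<and> frame {Pos, Left, Right} {} s s' \<and> slot s' = slot s \<and>
    queue_ok q {} s') s"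
proof -
  define I where "I = (\<lambda>k s'. frame {Pos, Left, Right} {} s s' \<and> slot s' = slot s \<and> ireg s' Pos = k \<and>
      k < slots \<and> queue_ok q {..k} s')"
  let ?s = "s\<lparr>ireg := (ireg s)(Pos := slots - 1)\<rparr>"
  have "wp m (While (IConst 0 <\<^sub>I \<acute>Pos) (pull;; ISet Pos (\<acute>Pos -\<^sub>I IConst 1)))
    (\<lambda>t s'. t \<le> 1 + (slots - 1) * (5 + 1) \<and> \<not> bval s' (IConst 0 <\<^sub>I \<acute>Pos) \<and> (\<exists>k. I k s')) ?s"
  proof (rule wp_while_bounded)
    have "{..slots - 1} = {..<slots}" using slots_pos by auto
    then have "queue_ok q {..slots - 1} s" using ok by (simp only:)
    then show "I (slots - 1) ?s"
      using slots_pos by (simp add: I_def frame_ireg_upd frame_refl)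
    fix k s1 assume I: "I k s1"
    have less: "k < m" "1 < m" using I params_less by (auto simp: I_def)
    have framed: "frame {Pos, Left, Right} {} s s1" using I by (simp add: I_def)
    have par1: "params (ireg s1)" by (rule frame_params[OF framed _ par]) auto
    have "wp m (pull;; ISet Pos (\<acute>Pos -\<^sub>I IConst 1)) (\<lambda>t s'. t \<le> 5 \<and> I (k - 1) s') s1" if "0 < k"
    proof (rule wp_SeqI, rule wp_pull[where U = "{..k}"])
      show "ireg s1 Query_Point = q" using frame_ireg[OF framed, of Query_Point] q by simp
      fix t :: nat and s2 :: state
      assume "t \<le> 4 \<and> frame {Left, Right} {} s1 s2 \<and> slot s2 = slot s1 \<and>
        queue_ok q (insert (k div 2) ({..k} - {k})) s2"
      moreover have "insert (k div 2) ({..k} - {k}) = {..k - 1}" using that by auto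
      ultimately have post: "t \<le> 4" "frame {Left, Right} {} s1 s2" "slot s2 = slot s1"
        "queue_ok q {..k - 1} s2"
        by auto
      have "frame {Pos, Left, Right} {} s s2" by (rule frame_trans[OF framed post(2)]) auto
      moreover have "ireg s2 Pos = k" using frame_ireg[OF post(2), of Pos] I by (simp add: I_def)
      ultimately show "wp m (ISet Pos (\<acute>Pos -\<^sub>I IConst 1)) (\<lambda>t' s'. t + t' \<le> 5 \<and> I (k - 1) s') s2"
        using post I that less by (auto simp: wp_ISet I_def frame_ireg_upd)
    qed (use par1 q I that in \<open>auto simp: I_def\<close>)
    then show "bok m s1 (IConst 0 <\<^sub>I \<acute>Pos) \<and> (bval s1 (IConst 0 <\<^sub>I \<acute>Pos) \<longrightarrow> 0 < k \<and>
        wp m (pull;; ISet Pos (\<acute>Pos -\<^sub>I IConst 1)) (\<lambda>t s'. t \<le> 5 \<and> I (k - 1) s') s1)"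
      using I less by (simp add: I_def)
  qed
  then show ?thesis
    using par params_less
    by (auto simp: build_queue_def wp_simps I_def elim!: wp_mono intro!: queue_ok_zero)
qed

lemma wp_descend:
  assumes par: "params (ireg s)" and regs: "ireg s Pos = k" "ireg s Top = u" and ok: "queue_ok q {} s"
    and k: "0 < k" "k < slots" "imem s (queue + k) = u"
  shows "wp m descend (\<lambda>t s'. t \<le> 2 \<and> imem s' = imem s \<and> frame {Pos} {} s s' \<and> 2 * k \<le> ireg s' Pos \<and>
    ireg s' Pos < 2 * slots \<and> imem s (queue + ireg s' Pos) = u) s"
proof -
  have "imem s (queue + 2 * k) = u \<or> imem s (queue + (2 * k + 1)) = u"
    using queue_ok_better[OF ok k(1,2)] k(3) by (auto simp: better_def split: if_splits)
  moreover have "imem s (queue + 2 * k) \<le> dirs * trees" "u \<le> dirs * trees"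
    using queue_ok_code[OF ok, of "2 * k"] queue_ok_code[OF ok, of k] k by auto
  moreover have "2 * k < m" "2 * k + 1 < m" "queue + 2 * k < m" "k < m" "2 < m"
    using queue_less[of "2 * k + 1"] k params_less(14) by auto
  ultimately show ?thesis
    using par regs k params_less by (auto simp: descend_def wp_simps frame_ireg_upd frame_refl)
qed

lemma wp_find_top:
  assumes par: "params (ireg s)" and u: "ireg s Top = u" "imem s (queue + 1) = u" and ok: "queue_ok q {} s"
  shows "wp m find_top (\<lambda>t s'. t \<le> 2 + depth * 3 \<and> imem s' = imem s \<and> frame {Pos} {} s s' \<and>
    (\<exists>k<slots. ireg s' Pos = slots + k \<and> slot s k = u)) s"
proof -
  let ?s = "s\<lparr>ireg := (ireg s)(Pos := 1)\<rparr>"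
  define I where "I = (\<lambda>k s'. imem s' = imem s \<and> frame {Pos} {} s s' \<and> params (ireg s') \<and>
      2 * slots \<le> ireg s' Pos * 2 ^ k \<and> ireg s' Pos < 2 * slots \<and> imem s (queue + ireg s' Pos) = u)"
  have "wp m (While (\<acute>Pos <\<^sub>I \<acute>Slots) descend)
    (\<lambda>t s'. t \<le> 1 + depth * (2 + 1) \<and> \<not> bval s' (\<acute>Pos <\<^sub>I \<acute>Slots) \<and> (\<exists>k. I k s')) ?s"
  proof (rule wp_while_bounded)
    show "I depth ?s" using par u slots_pos two_slots_le by (simp add: I_def frame_ireg_upd frame_refl)
    fix k s1 assume I: "I k s1"
    then have par1: "params (ireg s1)" and framed: "frame {Pos} {} s s1" by (simp_all add: I_def)
    have top: "ireg s1 Top = u" using frame_ireg[OF framed, of Top] u by simp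
    have "0 < k \<and> wp m descend (\<lambda>t s'. t \<le> 2 \<and> I (k - 1) s') s1" if lt: "ireg s1 Pos < slots"
    proof
      show pos: "0 < k" using I lt by (cases k) (auto simp: I_def)
      have pos1: "0 < ireg s1 Pos" using I slots_pos by (cases "ireg s1 Pos") (auto simp: I_def)
      have ok1: "queue_ok q {} s1" and u1: "imem s1 (queue + ireg s1 Pos) = u"
        using I ok frame_rmem[OF framed] by (simp_all add: I_def queue_ok_def)
      show "wp m descend (\<lambda>t s'. t \<le> 2 \<and> I (k - 1) s') s1"
      proof (rule wp_mono[OF wp_descend[OF par1 refl top ok1 pos1 lt u1]], elim conjE, intro conjI)
        fix t s2 assume frame2: "frame {Pos} {} s1 s2" and im2: "imem s2 = imem s1"
          and low: "2 * ireg s1 Pos \<le> ireg s2 Pos"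
          and high: "ireg s2 Pos < 2 * slots" and u2: "imem s1 (queue + ireg s2 Pos) = u"
        have "frame {Pos} {} s s2" by (rule frame_trans[OF framed frame2]) auto
        moreover have "params (ireg s2)" by (rule frame_params[OF frame2 _ par1]) auto
        moreover have "ireg s1 Pos * 2 ^ k \<le> ireg s2 Pos * 2 ^ (k - 1)"
          using mult_le_mono1[OF low, of "2 ^ (k - 1)"] pos by (cases k) (simp_all add: mult.commute)
        ultimately show "I (k - 1) s2" using I im2 high u2 by (simp add: I_def)
      qed
    qed
    then show "bok m s1 (\<acute>Pos <\<^sub>I \<acute>Slots) \<and>
        (bval s1 (\<acute>Pos <\<^sub>I \<acute>Slots) \<longrightarrow> 0 < k \<and> wp m descend (\<lambda>t s'. t \<le> 2 \<and> I (k - 1) s') s1)"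
      using I par1 memory params_less by (simp add: I_def)
  qed
  then have "wp m (While (\<acute>Pos <\<^sub>I \<acute>Slots) descend) (\<lambda>t s'. Suc t \<le> 2 + depth * 3 \<and> imem s' = imem s \<and>
      frame {Pos} {} s s' \<and> (\<exists>k<slots. ireg s' Pos = slots + k \<and> slot s k = u)) ?s"
  proof (rule wp_mono, elim conjE exE)
    fix t s' k assume "t \<le> 1 + depth * (2 + 1)" "\<not> bval s' (\<acute>Pos <\<^sub>I \<acute>Slots)" "I k s'"
    then show "Suc t \<le> 2 + depth * 3 \<and> imem s' = imem s \<and> frame {Pos} {} s s' \<and>
        (\<exists>k<slots. ireg s' Pos = slots + k \<and> slot s k = u)"
      by (auto simp: I_def slot_def intro!: exI[of _ "ireg s' Pos - slots"])
  qed
  then show ?thesis using params_less unfolding find_top_def by (simp add: wp_simps)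
qed

end


section \<open>Tournament trees and tables of trees\<close>

locale projected = machine +
  fixes proj :: "nat \<Rightarrow> nat \<Rightarrow> real"
begin

definition right_child :: "(nat \<Rightarrow> nat) \<Rightarrow> nat \<Rightarrow> nat \<Rightarrow> nat" where
  "right_child im r x = im (child_addr r x)"

text \<open>
  The left child of the tree \<open>(r + 1, x)\<close> is \<open>(r, x)\<close>, so that only the representative of the right child is
  stored. Creating a tree never overwrites one that is still in use: its address contains a rank above
  that of the tree which \<open>x\<close> represented before.
\<close>

primrec points :: "(nat \<Rightarrow> nat) \<Rightarrow> nat \<Rightarrow> nat \<Rightarrow> nat set" where
  "points im 0 x = {x}"
| "points im (Suc r) x = points im r x \<union> points im r (right_child im r x)"

definition winners_ok :: "(nat \<Rightarrow> nat) \<Rightarrow> (nat \<Rightarrow> real) \<Rightarrow> nat \<Rightarrow> nat \<Rightarrow> bool" where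
  "winners_ok im rm r x \<longleftrightarrow> (\<forall>i<dirs. im (winner_addr i r x) \<in> points im r x \<and>
     rm (winner_addr i r x) = proj i (im (winner_addr i r x)) \<and>
     (\<forall>w\<in>points im r x. proj i w \<le> rm (winner_addr i r x)))"

primrec tree :: "(nat \<Rightarrow> nat) \<Rightarrow> (nat \<Rightarrow> real) \<Rightarrow> nat \<Rightarrow> nat \<Rightarrow> bool" where
  "tree im rm 0 x \<longleftrightarrow> x < n \<and> winners_ok im rm 0 x"
| "tree im rm (Suc r) x \<longleftrightarrow> tree im rm r x \<and> tree im rm r (right_child im r x) \<and>
     points im r x \<inter> points im r (right_child im r x) = {} \<and> winners_ok im rm (Suc r) x"

definition leaf_projs :: "(nat \<Rightarrow> real) \<Rightarrow> bool" where
  "leaf_projs rm \<longleftrightarrow> (\<forall>i<dirs. \<forall>x<n. rm (winner_addr i 0 x) = proj i x)"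

lemma tree_winners_ok: "tree im rm r x \<Longrightarrow> winners_ok im rm r x"
  by (cases r) auto

lemma rep_in_points: "x \<in> points im r x"
  by (induction r) auto

lemma finite_points: "finite (points im r x)"
  by (induction r arbitrary: x) auto

lemma points_subset: "tree im rm r x \<Longrightarrow> points im r x \<subseteq> {..<n}"
  by (induction r arbitrary: x) auto

lemma tree_rep_less: "tree im rm r x \<Longrightarrow> x < n"
  using points_subset rep_in_points by blast

lemma card_points: "tree im rm r x \<Longrightarrow> card (points im r x) = 2 ^ r"
  by (induction r arbitrary: x) (auto simp: card_Un_disjoint finite_points)

lemma two_power_le_n_imp_less: "2 ^ r \<le> n \<Longrightarrow> r < b"
  using le_less_trans[OF _ n_upper, of "2 ^ r"] by simp

lemma tree_rank_less: "tree im rm r x \<Longrightarrow> r < b"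
  using card_mono[OF _ points_subset] card_points two_power_le_n_imp_less by fastforce

lemma disjoint_trees_rank_less:
  assumes x: "tree im rm r x" and y: "tree im rm r y" and disj: "points im r x \<inter> points im r y = {}"
  shows "Suc r < b"
proof -
  have "card (points im r x \<union> points im r y) = 2 ^ r + 2 ^ r"
    using card_points[OF x] card_points[OF y] disj finite_points by (simp add: card_Un_disjoint)
  moreover have "card (points im r x \<union> points im r y) \<le> card {..<n}"
    using points_subset[OF x] points_subset[OF y] by (intro card_mono) auto
  ultimately show ?thesis using two_power_le_n_imp_less[of "Suc r"] by simp
qed

lemma winner_less:
  assumes "tree im rm r x" "i < dirs" shows "im (winner_addr i r x) < n"
  using tree_winners_ok[OF assms(1)] points_subset[OF assms(1)] assms(2) unfolding winners_ok_def by blast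

lemma tree_cong:
  assumes "tree im rm r x"
    and "\<And>r' x'. r' < r \<Longrightarrow> x' \<in> points im r x \<Longrightarrow> im' (child_addr r' x') = im (child_addr r' x')"
    and "\<And>i r' x'. i < dirs \<Longrightarrow> r' \<le> r \<Longrightarrow> x' \<in> points im r x \<Longrightarrow>
      im' (winner_addr i r' x') = im (winner_addr i r' x') \<and> rm' (winner_addr i r' x') = rm (winner_addr i r' x')"
  shows "tree im' rm' r x \<and> points im' r x = points im r x"
  using assms
proof (induction r arbitrary: x)
  case 0
  then show ?case by (auto simp: winners_ok_def)
next
  case (Suc r)
  have child: "right_child im' r x = right_child im r x"
    using Suc.prems(2)[of r x] rep_in_points[of x im r] by (auto simp: right_child_def)
  have left: "tree im' rm' r x \<and> points im' r x = points im r x"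
    using Suc.prems by (intro Suc.IH) auto
  have right: "tree im' rm' r (right_child im r x) \<and>
      points im' r (right_child im r x) = points im r (right_child im r x)"
    using Suc.prems by (intro Suc.IH) auto
  have pts: "points im' (Suc r) x = points im (Suc r) x" using left right child by simp
  have "im' (winner_addr i (Suc r) x) = im (winner_addr i (Suc r) x) \<and>
      rm' (winner_addr i (Suc r) x) = rm (winner_addr i (Suc r) x)" if "i < dirs" for i
    using Suc.prems(3)[OF that, of "Suc r" x] rep_in_points[of x im "Suc r"] by simp
  then have "winners_ok im' rm' (Suc r) x"
    using tree_winners_ok[OF Suc.prems(1)] unfolding winners_ok_def pts by metis
  then show ?case using left right pts child Suc.prems(1) by auto
qed

lemma tree_region_cong:
  assumes "\<And>k. trees \<le> k \<Longrightarrow> k < queue \<Longrightarrow> im' k = im k" "tree im rm r x"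
  shows "tree im' rm r x" "points im' r x = points im r x"
proof -
  have r: "r < b" using assms(2) tree_rank_less by blast
  have less: "x' < n" if "x' \<in> points im r x" for x' using that points_subset[OF assms(2)] by auto
  have "tree im' rm r x \<and> points im' r x = points im r x"
  proof (rule tree_cong[OF assms(2)])
    fix r' x' assume "r' < r" "x' \<in> points im r x"
    then have "child_addr r' x' < 2 * trees" using r less by (intro child_addr_less) auto
    then show "im' (child_addr r' x') = im (child_addr r' x')"
      using trees_le_child_addr region_order by (intro assms(1)) auto
  next
    fix i r' x' assume "i < dirs" "r' \<le> r" "x' \<in> points im r x"
    then have "winner_addr i r' x' < queue" using r less by (intro winner_addr_less) auto
    then show "im' (winner_addr i r' x') = im (winner_addr i r' x') \<and>
        rm (winner_addr i r' x') = rm (winner_addr i r' x')"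
      using order_trans[OF _ winners_le_winner_addr] region_order by (simp add: assms(1))
  qed
  then show "tree im' rm r x" "points im' r x = points im r x" by auto
qed

end

text \<open>
  A table assigns to a place and a rank the representative of the tree of that rank held there. Besides
  the clusters, which are identified by their handles, a merge holds a carry and a second detached tree.
\<close>

datatype place = Stored nat | Carried | Detached

type_synonym table = "place \<times> nat \<rightharpoonup> nat"

definition decode :: "nat \<Rightarrow> nat option" where
  "decode k = (if k = 0 then None else Some (k - 1))"

lemma decode_simps [simp]: "decode 0 = None" "decode (Suc x) = Some x"
  by (simp_all add: decode_def)

lemma decode_eq_None [simp]: "decode k = None \<longleftrightarrow> k = 0"
  by (simp add: decode_def)

lemma decode_eq_Some [simp]: "decode k = Some x \<longleftrightarrow> k = Suc x"
  by (auto simp: decode_def)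

definition move :: "table \<Rightarrow> place \<Rightarrow> place \<Rightarrow> nat \<Rightarrow> table" where
  "move T p p' j = T((p, j) := None, (p', j) := T (p, j))"

context projected
begin

definition tree_family :: "(nat \<Rightarrow> nat) \<Rightarrow> (nat \<Rightarrow> real) \<Rightarrow> table \<Rightarrow> bool" where
  "tree_family im rm T \<longleftrightarrow> (\<forall>p j x. T (p, j) = Some x \<longrightarrow> tree im rm j x) \<and>
     (\<forall>p j x p' j' x'. T (p, j) = Some x \<longrightarrow> T (p', j') = Some x' \<longrightarrow> (p, j) \<noteq> (p', j') \<longrightarrow>
        points im j x \<inter> points im j' x' = {})"

definition contents :: "(nat \<Rightarrow> nat) \<Rightarrow> table \<Rightarrow> place set \<Rightarrow> nat set" where
  "contents im T U = {y. \<exists>p\<in>U. \<exists>j x. T (p, j) = Some x \<and> y \<in> points im j x}"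

definition root_table :: "(nat \<Rightarrow> nat) \<Rightarrow> table" where
  "root_table im = (\<lambda>(p, j). case p of
     Stored a \<Rightarrow> if a < n \<and> j < b then decode (im (root_addr a j)) else None | _ \<Rightarrow> None)"

lemma tree_family_tree: "tree_family im rm T \<Longrightarrow> T (p, j) = Some x \<Longrightarrow> tree im rm j x"
  by (simp add: tree_family_def)

lemma tree_family_disjoint:
  "tree_family im rm T \<Longrightarrow> T (p, j) = Some x \<Longrightarrow> T (p', j') = Some x' \<Longrightarrow> (p, j) \<noteq> (p', j') \<Longrightarrow>
    points im j x \<inter> points im j' x' = {}"
  unfolding tree_family_def by blast

lemma contentsI: "p \<in> U \<Longrightarrow> T (p, j) = Some x \<Longrightarrow> y \<in> points im j x \<Longrightarrow> y \<in> contents im T U"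
  by (auto simp: contents_def)

lemma points_subset_contents: "p \<in> U \<Longrightarrow> T (p, j) = Some x \<Longrightarrow> points im j x \<subseteq> contents im T U"
  by (auto simp: contents_def)

lemma contents_subset: "tree_family im rm T \<Longrightarrow> contents im T U \<subseteq> {..<n}"
  using points_subset tree_family_tree by (fastforce simp: contents_def)

lemma tree_family_cong:
  assumes "\<And>k. trees \<le> k \<Longrightarrow> k < queue \<Longrightarrow> im' k = im k" "tree_family im rm T"
  shows "tree_family im' rm T" "contents im' T U = contents im T U"
proof -
  have same: "tree im' rm j x" "points im' j x = points im j x" if "T (p, j) = Some x" for p j x
    using tree_region_cong[OF assms(1) tree_family_tree[OF assms(2) that]] by auto
  show "tree_family im' rm T"
    using same tree_family_disjoint[OF assms(2)] unfolding tree_family_def by simp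
  have "T (p, j) = Some x \<and> y \<in> points im' j x \<longleftrightarrow> T (p, j) = Some x \<and> y \<in> points im j x" for p j x y
    using same by auto
  then show "contents im' T U = contents im T U" by (simp add: contents_def)
qed

definition cluster :: "(nat \<Rightarrow> nat) \<Rightarrow> nat \<Rightarrow> nat set" where
  "cluster im a = contents im (root_table im) {Stored a}"

lemma cluster_subset: "tree_family im rm (root_table im) \<Longrightarrow> cluster im a \<subseteq> {..<n}"
  unfolding cluster_def by (rule contents_subset)

lemma root_table_upd:
  "a < n \<Longrightarrow> j < b \<Longrightarrow> root_table (im(root_addr a j := k)) = (root_table im)((Stored a, j) := decode k)"
  by (auto simp: root_table_def fun_eq_iff root_addr_eq split: place.splits)

lemma root_table_cong:
  assumes "\<And>k. k < trees \<Longrightarrow> im' k = im k" shows "root_table im' = root_table im"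
  using assms root_addr_less by (auto simp: root_table_def fun_eq_iff split: place.splits)

lemma stored_trees_cong:
  assumes "\<And>k. k < queue \<Longrightarrow> im' k = im k" "tree_family im rm (root_table im)"
  shows "tree_family im' rm (root_table im')" "cluster im' a = cluster im a"
proof -
  have roots: "root_table im' = root_table im" using assms(1) region_order by (intro root_table_cong) auto
  show "tree_family im' rm (root_table im')" "cluster im' a = cluster im a"
    unfolding cluster_def roots using tree_family_cong[OF assms] assms(1) by auto
qed

lemma root_table_simps [simp]:
  "root_table im (Carried, j) = None" "root_table im (Detached, j) = None"
  "a < n \<Longrightarrow> j < b \<Longrightarrow> root_table im (Stored a, j) = decode (im (root_addr a j))"
  by (simp_all add: root_table_def)

lemma root_table_StoredD: "root_table im (Stored a, j) = Some x \<Longrightarrow> a < n \<and> j < b \<and>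
    im (root_addr a j) = Suc x"
  by (auto simp: root_table_def split: if_splits)

lemma move_cases:
  assumes "move T p p' j (p1, k) = Some x" "p \<noteq> p'"
  obtains p2 where "T (p2, k) = Some x" "(p1 = p' \<and> p2 = p \<and> k = j) \<or>
      (p1 = p2 \<and> (p1, k) \<notin> {(p, j), (p', j)})"
  using assms by (auto simp: move_def split: if_splits)

lemma tree_family_move:
  assumes fam: "tree_family im rm T" and "p \<noteq> p'"
  shows "tree_family im rm (move T p p' j)"
  unfolding tree_family_def
proof (intro conjI allI impI)
  fix p1 k x assume "move T p p' j (p1, k) = Some x"
  then show "tree im rm k x" using move_cases tree_family_tree[OF fam] \<open>p \<noteq> p'\<close> by metis
next
  fix p1 k x p1' k' x'
  assume first: "move T p p' j (p1, k) = Some x" and second: "move T p p' j (p1', k') = Some x'"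
    and ne: "(p1, k) \<noteq> (p1', k')"
  obtain p2 where p2: "T (p2, k) = Some x"
      "(p1 = p' \<and> p2 = p \<and> k = j) \<or> (p1 = p2 \<and> (p1, k) \<notin> {(p, j), (p', j)})"
    using move_cases[OF first \<open>p \<noteq> p'\<close>] .
  obtain p2' where p2': "T (p2', k') = Some x'"
      "(p1' = p' \<and> p2' = p \<and> k' = j) \<or> (p1' = p2' \<and> (p1', k') \<notin> {(p, j), (p', j)})"
    using move_cases[OF second \<open>p \<noteq> p'\<close>] .
  have "(p2, k) \<noteq> (p2', k')" using p2(2) p2'(2) ne by auto
  then show "points im k x \<inter> points im k' x' = {}" by (rule tree_family_disjoint[OF fam p2(1) p2'(1)])
qed

lemma contents_move:
  assumes "T (p', j) = None" "p \<noteq> p'" "p \<in> U \<longleftrightarrow> p' \<in> U"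
  shows "contents im (move T p p' j) U = contents im T U"
proof (intro set_eqI iffI)
  fix y assume "y \<in> contents im (move T p p' j) U"
  then obtain p1 k x where p1: "p1 \<in> U" "move T p p' j (p1, k) = Some x" "y \<in> points im k x"
    by (auto simp: contents_def)
  obtain p2 where "T (p2, k) = Some x" "p1 = p' \<and> p2 = p \<or> p1 = p2"
    using move_cases[OF p1(2) assms(2)] by blast
  then show "y \<in> contents im T U" using p1 assms(3) by (auto intro: contentsI)
next
  fix y assume "y \<in> contents im T U"
  then obtain p1 k x where p1: "p1 \<in> U" "T (p1, k) = Some x" "y \<in> points im k x"
    by (auto simp: contents_def)
  then have "move T p p' j (if (p1, k) = (p, j) then p' else p1, k) = Some x"
    using assms(1,2) by (auto simp: move_def)
  then show "y \<in> contents im (move T p p' j) U" using p1 assms(3) by (intro contentsI) auto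
qed

end


section \<open>Candidates and the progress of a query\<close>

definition block :: "nat \<Rightarrow> nat \<Rightarrow> nat set" where
  "block L g = {g * L..<g * L + L}"

definition heavy_pairs :: "nat set \<Rightarrow> (nat \<Rightarrow> nat \<Rightarrow> real) \<Rightarrow> nat set \<Rightarrow> real \<Rightarrow> (nat \<times> nat) set" where
  "heavy_pairs I v B \<Delta> = (SIGMA i:I. {w \<in> B. \<Delta> \<le> v i w})"

definition separates :: "nat \<Rightarrow> (nat \<Rightarrow> nat \<Rightarrow> real) \<Rightarrow> nat \<Rightarrow> nat set \<Rightarrow> real \<Rightarrow> nat \<Rightarrow> bool" where
  "separates L v y B \<Delta> g \<longleftrightarrow> (\<exists>i\<in>block L g. \<Delta> \<le> v i y) \<and> card (heavy_pairs (block L g) v B \<Delta>) < 4 * L"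

lemma sum_fun_upd:
  fixes f :: "'b \<Rightarrow> 'c::comm_monoid_add"
  assumes "finite A" "k \<in> A"
  shows "(\<Sum>i\<in>A. f ((t(k := c)) i)) + f (t k) = (\<Sum>i\<in>A. f (t i)) + f c"
proof -
  have "(\<Sum>i\<in>A - {k}. f ((t(k := c)) i)) = (\<Sum>i\<in>A - {k}. f (t i))"
    by (intro sum.cong) auto
  then show ?thesis using assms by (simp add: sum.remove ac_simps)
qed

context projected
begin

definition rel :: "nat \<Rightarrow> nat \<Rightarrow> nat \<Rightarrow> real" where
  "rel q i w = proj i w - proj i q"

definition dist2 :: "(nat \<Rightarrow> real) \<Rightarrow> nat \<Rightarrow> nat \<Rightarrow> real" where
  "dist2 rm w q = (\<Sum>j<d. (rm (w * d + j) - rm (q * d + j))\<^sup>2)"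

definition candidate :: "(nat \<Rightarrow> nat) \<Rightarrow> (nat \<Rightarrow> real) \<Rightarrow> nat set \<Rightarrow> nat \<Rightarrow> nat \<Rightarrow> bool" where
  "candidate im rm C g u \<longleftrightarrow> (\<exists>i r x. u = code i r x \<and> i \<in> block group_dirs g \<and> i < dirs \<and>
     tree im rm r x \<and> points im r x \<subseteq> C)"

definition winner :: "(nat \<Rightarrow> nat) \<Rightarrow> nat \<Rightarrow> nat" where
  "winner im u = im (winners + (u - 1))"

definition child1 :: "nat \<Rightarrow> nat" where
  "child1 u = (if (u - 1) div n mod b = 0 then 0 else u - n)"

definition child2 :: "(nat \<Rightarrow> nat) \<Rightarrow> nat \<Rightarrow> nat" where
  "child2 im u = (if (u - 1) div n mod b = 0 then 0
     else u - n - (u - 1) mod n + im (trees + ((u - 1) mod trees - n)))"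

lemma dist2_nonneg: "0 \<le> dist2 rm w q"
  by (simp add: dist2_def sum_nonneg)

lemma block_less_dirs: "g < 3 * b \<Longrightarrow> i \<in> block group_dirs g \<Longrightarrow> i < dirs"
  using mult_le_mono1[of "Suc g" "3 * b" group_dirs] by (simp add: dirs_def block_def)

lemma child_code_leaf:
  assumes "x < n" shows "child1 (code i 0 x) = 0" "child2 im (code i 0 x) = 0"
  using code_decode[of 0 x i] b_pos assms by (simp_all add: child1_def child2_def)

lemma child_code_inner:
  assumes "x < n" "Suc r < b"
  shows "child1 (code i (Suc r) x) = code i r x"
    "child2 im (code i (Suc r) x) = code i r (right_child im r x)"
proof -
  let ?u = "code i (Suc r) x"
  note dec = code_decode[OF assms(2,1), of i]
  show "child1 ?u = code i r x" using dec(4) by (simp add: child1_def code_Suc_rank)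
  have "?u - n - x = code i r 0" by (simp add: code_def)
  moreover have "(?u - 1) mod trees - n = r * n + x" using dec(2) by simp
  ultimately show "child2 im ?u = code i r (right_child im r x)"
    using dec(3,4) by (simp add: child2_def right_child_def child_addr_def code_def)
qed

lemma candidate_le: "candidate im rm C g u \<Longrightarrow> u \<le> dirs * trees"
  unfolding candidate_def using code_le tree_rank_less tree_rep_less by blast

lemma candidate_winner:
  assumes "candidate im rm C g u" shows "winner im u \<in> C" "winner im u < n"
proof -
  obtain i r x where u: "u = code i r x" "i < dirs" "tree im rm r x" "points im r x \<subseteq> C"
    using assms unfolding candidate_def by blast
  then have "winner im u \<in> points im r x"
    using tree_winners_ok[OF u(3)] by (simp add: winners_ok_def winner_def winner_addr_code)
  then show "winner im u \<in> C" "winner im u < n" using u(4) points_subset[OF u(3)] by auto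
qed

lemma candidate_children:
  assumes "candidate im rm C g u"
  shows "child1 u = 0 \<or> candidate im rm C g (child1 u)"
    "child2 im u = 0 \<or> candidate im rm C g (child2 im u)"
proof -
  obtain i r x where u: "u = code i r x" and i: "i \<in> block group_dirs g" "i < dirs"
    and t: "tree im rm r x" "points im r x \<subseteq> C"
    using assms unfolding candidate_def by blast
  have x: "x < n" and r: "r < b" using tree_rep_less tree_rank_less t by auto
  have "(child1 u = 0 \<or> candidate im rm C g (child1 u)) \<and>
      (child2 im u = 0 \<or> candidate im rm C g (child2 im u))"
  proof (cases r)
    case 0
    then show ?thesis using child_code_leaf x u by simp
  next
    case (Suc r')
    have "child1 u = code i r' x" "child2 im u = code i r' (right_child im r' x)"
      unfolding u Suc using child_code_inner x r Suc by auto
    moreover have "tree im rm r' x" "tree im rm r' (right_child im r' x)"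
      "points im r' x \<subseteq> C" "points im r' (right_child im r' x) \<subseteq> C" using t Suc by auto
    ultimately show ?thesis using i unfolding candidate_def by blast
  qed
  then show "child1 u = 0 \<or> candidate im rm C g (child1 u)"
    "child2 im u = 0 \<or> candidate im rm C g (child2 im u)"
    by auto
qed

lemma key_tree:
  assumes "leaf_projs rm" "q < n" "i < dirs" "tree im rm r x"
  shows "key rm q (code i r x) = rel q i (winner im (code i r x))" "winner im (code i r x) \<in> points im r x"
    "w \<in> points im r x \<Longrightarrow> rel q i w \<le> key rm q (code i r x)"
proof -
  let ?u = "code i r x"
  have "(?u - 1) div trees = i"
    by (rule code_decode[OF tree_rank_less[OF assms(4)] tree_rep_less[OF assms(4)]])
  then have addr: "winners + ((?u - 1) div trees * trees + q) = winner_addr i 0 q"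
    by (simp add: winner_addr_def)
  have "rm (winner_addr i 0 q) = proj i q" using assms(1-3) by (simp add: leaf_projs_def)
  then have key_eq: "key rm q ?u = rm (winner_addr i r x) - proj i q"
    by (simp only: key_def addr winner_addr_code[of i r x])
  have winner_eq: "winner im ?u = im (winner_addr i r x)" by (simp add: winner_def winner_addr_code)
  have "winners_ok im rm r x" by (rule tree_winners_ok[OF assms(4)])
  then show "key rm q ?u = rel q i (winner im ?u)" "winner im ?u \<in> points im r x"
    "w \<in> points im r x \<Longrightarrow> rel q i w \<le> key rm q ?u"
    using assms(3) unfolding key_eq winner_eq by (auto simp: winners_ok_def rel_def)
qed

text \<open>
  A pop whose winner lies in \<open>B\<close> above the threshold decreases the total weight of the candidates, because
  the two children split the points of the tree and have smaller rank.
\<close>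

definition weight :: "(nat \<Rightarrow> nat) \<Rightarrow> nat \<Rightarrow> nat set \<Rightarrow> real \<Rightarrow> nat \<Rightarrow> nat" where
  "weight im q B \<Delta> u = (if u = 0 then 0 else
     let i = (u - 1) div trees; r = (u - 1) div n mod b; x = (u - 1) mod n
     in Suc r * card (points im r x \<inter> {w \<in> B. \<Delta> \<le> rel q i w}))"

lemma weight_0 [simp]: "weight im q B \<Delta> 0 = 0"
  by (simp add: weight_def)

lemma weight_code:
  assumes "r < b" "x < n"
  shows "weight im q B \<Delta> (code i r x) = Suc r * card (points im r x \<inter> {w \<in> B. \<Delta> \<le> rel q i w})"
  using code_decode[OF assms, of i] by (simp add: weight_def)

lemma weight_children:
  assumes "leaf_projs rm" "q < n" "candidate im rm C g u" "\<Delta> \<le> key rm q u" "winner im u \<in> B"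
  shows "weight im q B \<Delta> (child1 u) + weight im q B \<Delta> (child2 im u) < weight im q B \<Delta> u"
proof -
  obtain i r x where u: "u = code i r x" and i: "i < dirs" and t: "tree im rm r x"
    using assms(3) unfolding candidate_def by blast
  have x: "x < n" and r: "r < b" using tree_rep_less tree_rank_less t by auto
  define c where "c r x = card (points im r x \<inter> {w \<in> B. \<Delta> \<le> rel q i w})" for r x
  have wc: "weight im q B \<Delta> (code i r x) = Suc r * c r x" if "r < b" "x < n" for r x
    using weight_code[OF that] by (simp add: c_def)
  have "winner im u \<in> points im r x \<inter> {w \<in> B. \<Delta> \<le> rel q i w}"
    using key_tree(1,2)[OF assms(1,2) i t] assms(4,5) u by auto
  then have pos: "0 < c r x" unfolding c_def using finite_points by (auto simp: card_gt_0_iff)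
  show ?thesis
  proof (cases r)
    case 0
    then show ?thesis using child_code_leaf[OF x] wc[OF r x] pos u by simp
  next
    case (Suc r')
    let ?y = "right_child im r' x"
    have y: "?y < n" and disj: "points im r' x \<inter> points im r' ?y = {}" using t Suc tree_rep_less by auto
    have "points im r x \<inter> {w \<in> B. \<Delta> \<le> rel q i w} = (points im r' x \<inter> {w \<in> B. \<Delta> \<le> rel q i w}) \<union>
        (points im r' ?y \<inter> {w \<in> B. \<Delta> \<le> rel q i w})" unfolding Suc by auto
    then have split: "c r x = c r' x + c r' ?y"
      using disj finite_points by (auto simp: c_def intro!: card_Un_disjoint)
    have r': "r' < b" "Suc r' < b" using r Suc by auto
    have "weight im q B \<Delta> u = Suc (Suc r') * (c r' x + c r' ?y)"
      "weight im q B \<Delta> (child1 u) = Suc r' * c r' x" "weight im q B \<Delta> (child2 im u) = Suc r' * c r' ?y"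
      using u Suc child_code_inner[OF x r'(2)] wc r r' x y split by auto
    then show ?thesis using pos split by (simp add: algebra_simps)
  qed
qed

definition covered :: "(nat \<Rightarrow> nat) \<Rightarrow> (nat \<Rightarrow> real) \<Rightarrow> (nat \<Rightarrow> nat) \<Rightarrow> nat \<Rightarrow> nat \<Rightarrow> bool" where
  "covered im rm T i y \<longleftrightarrow> (\<exists>k<slots. \<exists>r x. T k = code i r x \<and> y \<in> points im r x \<and> tree im rm r x)"

text \<open>
  After \<open>p\<close> pops, either a point outside \<open>B\<close> has been found or the far point \<open>y\<close> is still covered by
  a candidate, which forces every pop so far to have consumed weight.
\<close>

definition progress :: "(nat \<Rightarrow> nat) \<Rightarrow> (nat \<Rightarrow> real) \<Rightarrow> nat set \<Rightarrow> nat \<Rightarrow> nat \<Rightarrow> nat \<Rightarrow>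
    (nat \<Rightarrow> nat) \<Rightarrow> real \<Rightarrow> bool" where
  "progress im rm C g q p T \<delta> \<longleftrightarrow> (\<forall>B \<Delta> i y. B \<subseteq> C \<longrightarrow> i \<in> block group_dirs g \<longrightarrow> y \<in> C - B \<longrightarrow>
     \<Delta> \<le> rel q i y \<longrightarrow> (\<exists>w\<in>C - B. dist2 rm w q \<le> \<delta>) \<or>
     covered im rm T i y \<and> (\<Sum>k<slots. weight im q B \<Delta> (T k)) + p
       \<le> b * card (heavy_pairs (block group_dirs g) (rel q) B \<Delta>))"

definition served :: "(nat \<Rightarrow> real) \<Rightarrow> nat set \<Rightarrow> nat \<Rightarrow> nat \<Rightarrow> real \<Rightarrow> bool" where
  "served rm C q g \<delta> \<longleftrightarrow> (\<forall>B \<Delta> y. B \<subseteq> C \<longrightarrow> y \<in> C - B \<longrightarrow> separates group_dirs (rel q) y B \<Delta> g \<longrightarrow>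
     (\<exists>w\<in>C - B. dist2 rm w q \<le> \<delta>))"

lemma served_mono: "served rm C q g \<delta> \<Longrightarrow> \<delta> \<le> \<delta>' \<Longrightarrow> served rm C q g \<delta>'"
  unfolding served_def by (meson order_trans)

lemma served_nonneg:
  assumes "served rm C q g \<delta>" "C \<noteq> {}" shows "0 \<le> \<delta>"
proof -
  obtain y where y: "y \<in> C" using assms(2) by blast
  have "g * group_dirs \<in> block group_dirs g" using group_dirs_pos by (simp add: block_def)
  then have "separates group_dirs (rel q) y {} (rel q (g * group_dirs) y) g"
    using group_dirs_pos by (auto simp: separates_def heavy_pairs_def)
  then obtain w where "dist2 rm w q \<le> \<delta>" using assms(1) y unfolding served_def by blast
  then show ?thesis using dist2_nonneg order_trans by blast
qed

lemma progress_empty: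
  assumes "progress im rm C g q p T \<delta>" "\<And>k. k < slots \<Longrightarrow> T k = 0"
  shows "progress im rm C g q p' T \<delta>"
proof -
  have "\<not> covered im rm T i y" for i y using assms(2) by (auto simp: covered_def)
  then show ?thesis using assms(1) unfolding progress_def by blast
qed

lemma progress_served:
  assumes "progress im rm C g q pops T \<delta>" shows "served rm C q g \<delta>"
  unfolding served_def
proof (intro allI impI)
  fix B \<Delta> y assume B: "B \<subseteq> C" "y \<in> C - B" and sep: "separates group_dirs (rel q) y B \<Delta> g"
  let ?H = "heavy_pairs (block group_dirs g) (rel q) B \<Delta>"
  obtain i where i: "i \<in> block group_dirs g" "\<Delta> \<le> rel q i y" and "card ?H < 4 * group_dirs"
    using sep unfolding separates_def by blast
  then have "b * card ?H < pops" using b_pos by (simp add: pops_def mult.commute)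
  then have "\<not> (\<Sum>k<slots. weight im q B \<Delta> (T k)) + pops \<le> b * card ?H" by linarith
  then show "\<exists>w\<in>C - B. dist2 rm w q \<le> \<delta>"
    using assms B i unfolding progress_def by blast
qed

lemma covered_children:
  assumes leafs: "leaf_projs rm" and q: "q < n" and i: "i < dirs" and cov: "covered im rm T i y"
    and k: "k < slots" "T k = u" and l: "l < slots" "l \<noteq> k" "T l = 0" and y: "y \<noteq> winner im u"
  shows "covered im rm (T(k := child1 u, l := child2 im u)) i y"
proof -
  obtain k' r x where k': "k' < slots" "T k' = code i r x" "y \<in> points im r x" "tree im rm r x"
    using cov unfolding covered_def by blast
  have "k' \<noteq> l" using k'(2) l(3) by auto
  show ?thesis
  proof (cases "k' = k")
    case False
    then show ?thesis using k' \<open>k' \<noteq> l\<close> unfolding covered_def by (intro exI[of _ k']) auto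
  next
    case True
    then have u: "u = code i r x" using k' k by simp
    have x: "x < n" "r < b" using k' tree_rep_less tree_rank_less by auto
    have "r \<noteq> 0" using key_tree(2)[OF leafs q i k'(4)] k'(3) u y by (cases r) auto
    then obtain r' where r': "r = Suc r'" by (cases r) auto
    have children: "child1 u = code i r' x" "child2 im u = code i r' (right_child im r' x)"
      unfolding u r' using child_code_inner x r' by auto
    from k'(3) r' consider "y \<in> points im r' x" | "y \<in> points im r' (right_child im r' x)" by auto
    then show ?thesis
    proof cases
      case 1
      then show ?thesis using children k l k'(4) r' unfolding covered_def by (intro exI[of _ k]) auto
    next
      case 2
      then show ?thesis using children l k'(4) r' unfolding covered_def by (intro exI[of _ l]) auto
    qed
  qed
qed

lemma progress_step:
  assumes pr: "progress im rm C g q p T \<delta>" and leafs: "leaf_projs rm" and q: "q < n" and g: "g < 3 * b"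
    and cand: "candidate im rm C g u" and k: "k < slots" "T k = u" and l: "l < slots" "l \<noteq> k" "T l = 0"
    and top: "\<And>i. i < slots \<Longrightarrow> T i \<noteq> 0 \<Longrightarrow> key rm q (T i) \<le> key rm q u"
  shows "progress im rm C g q (Suc p) (T(k := child1 u, l := child2 im u)) (max \<delta> (dist2 rm (winner im u) q))"
  unfolding progress_def
proof (intro allI impI)
  fix B \<Delta> i y
  assume B: "B \<subseteq> C" and i: "i \<in> block group_dirs g" and y: "y \<in> C - B" and \<Delta>: "\<Delta> \<le> rel q i y"
  let ?T = "T(k := child1 u, l := child2 im u)" and ?H = "heavy_pairs (block group_dirs g) (rel q) B \<Delta>"
  let ?found = "\<exists>w\<in>C - B. dist2 rm w q \<le> max \<delta> (dist2 rm (winner im u) q)"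
  have i': "i < dirs" by (rule block_less_dirs[OF g i])
  from pr B i y \<Delta> consider (found) w where "w \<in> C - B" "dist2 rm w q \<le> \<delta>" |
    (unfound) "covered im rm T i y" "(\<Sum>k<slots. weight im q B \<Delta> (T k)) + p \<le> b * card ?H"
    unfolding progress_def by blast
  then show "?found \<or> covered im rm ?T i y \<and> (\<Sum>k<slots. weight im q B \<Delta> (?T k)) + Suc p \<le> b * card ?H"
  proof cases
    case unfound
    show ?thesis
    proof (cases "winner im u \<in> B")
      case True
      obtain k' r x where k': "k' < slots" "T k' = code i r x" "y \<in> points im r x" "tree im rm r x"
        using unfound(1) unfolding covered_def by blast
      have "\<Delta> \<le> key rm q (T k')" using key_tree(3)[OF leafs q i' k'(4,3)] \<Delta> k'(2) by simp
      also have "\<dots> \<le> key rm q u" using top[OF k'(1)] k'(2) by simp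
      finally have less: "weight im q B \<Delta> (child1 u) + weight im q B \<Delta> (child2 im u) < weight im q B \<Delta> u"
        using weight_children[OF leafs q cand] True by blast
      have "(\<Sum>i<slots. weight im q B \<Delta> (?T i)) + weight im q B \<Delta> u =
          (\<Sum>i<slots. weight im q B \<Delta> (T i)) + weight im q B \<Delta> (child1 u) + weight im q B \<Delta> (child2 im u)"
        using sum_fun_upd[of "{..<slots}" l "weight im q B \<Delta>" "T(k := child1 u)" "child2 im u"]
          sum_fun_upd[of "{..<slots}" k "weight im q B \<Delta>" T "child1 u"] k l by simp
      moreover have "covered im rm ?T i y"
        using covered_children[OF leafs q i' unfound(1) k l] True y by blast
      ultimately show ?thesis using less unfound(2) by linarith
    next
      case False
      then have "winner im u \<in> C - B" using candidate_winner(1)[OF cand] by simp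
      moreover have "dist2 rm (winner im u) q \<le> max \<delta> (dist2 rm (winner im u) q)" by simp
      ultimately show ?thesis by blast
    qed
  qed (meson max.coboundedI1)
qed

end


section \<open>The initial candidates\<close>

context projected
begin

definition leaf :: "(nat \<Rightarrow> nat) \<Rightarrow> nat \<Rightarrow> nat \<Rightarrow> nat \<Rightarrow> nat" where
  "leaf im a g k = (if k < group_dirs * b then case root_table im (Stored a, k mod b) of
     None \<Rightarrow> 0 | Some x \<Rightarrow> code (g * group_dirs + k div b) (k mod b) x else 0)"

lemma leaf_cases:
  assumes "tree_family im rm (root_table im)"
  obtains "leaf im a g k = 0"
    | x where "k < group_dirs * b" "root_table im (Stored a, k mod b) = Some x" "tree im rm (k mod b) x"
      "points im (k mod b) x \<subseteq> cluster im a"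
      "g * group_dirs + k div b \<in> block group_dirs g"
      "leaf im a g k = code (g * group_dirs + k div b) (k mod b) x"
proof (cases "k < group_dirs * b \<and> root_table im (Stored a, k mod b) \<noteq> None")
  case True
  then obtain x where x: "root_table im (Stored a, k mod b) = Some x" by blast
  have "k div b < group_dirs" using True by (simp add: less_mult_imp_div_less)
  moreover have "points im (k mod b) x \<subseteq> cluster im a"
    unfolding cluster_def by (rule points_subset_contents[where p = "Stored a"]) (use x in auto)
  ultimately show thesis using that(2)[OF _ x tree_family_tree[OF assms x]] True x
    by (simp add: leaf_def block_def)
qed (use that(1) in \<open>auto simp: leaf_def\<close>)

lemma leaf_candidate:
  assumes "tree_family im rm (root_table im)" "g < 3 * b"
  shows "leaf im a g k = 0 \<or> candidate im rm (cluster im a) g (leaf im a g k)"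
  by (rule leaf_cases[OF assms(1), of a g k])
    (use block_less_dirs[OF assms(2)] in \<open>force simp: candidate_def\<close>)+

lemma leaf_covers:
  assumes fam: "tree_family im rm (root_table im)" and y: "y \<in> cluster im a"
    and i: "i \<in> block group_dirs g"
  shows "covered im rm (leaf im a g) i y"
proof -
  obtain j x where j: "root_table im (Stored a, j) = Some x" "y \<in> points im j x"
    using y by (auto simp: cluster_def contents_def)
  have jb: "j < b" using root_table_StoredD[OF j(1)] by simp
  let ?k = "(i - g * group_dirs) * b + j"
  have "i - g * group_dirs < group_dirs" using i by (auto simp: block_def)
  then have "Suc (i - g * group_dirs) * b \<le> group_dirs * b" by (intro mult_le_mono1) simp
  then have k: "?k < group_dirs * b" using jb by simp
  have "?k div b = i - g * group_dirs" "?k mod b = j" using jb by auto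
  then have "leaf im a g ?k = code i j x" using k j i by (simp add: leaf_def block_def)
  then show ?thesis
    using k slots_eq j(2) tree_family_tree[OF fam j(1)] unfolding covered_def by (intro exI[of _ ?k]) auto
qed

definition leaf_pairs :: "(nat \<Rightarrow> nat) \<Rightarrow> nat \<Rightarrow> nat \<Rightarrow> nat \<Rightarrow> nat set \<Rightarrow> real \<Rightarrow> nat \<Rightarrow> (nat \<times> nat) set" where
  "leaf_pairs im a g q B \<Delta> k = {(i, w) \<in> heavy_pairs (block group_dirs g) (rel q) B \<Delta>.
     i = g * group_dirs + k div b \<and> (\<exists>x. root_table im (Stored a, k mod b) = Some x \<and> w \<in> points im (k mod b) x)}"

lemma weight_leaf_le:
  assumes "tree_family im rm (root_table im)"
  shows "weight im q B \<Delta> (leaf im a g k) \<le> b * card (leaf_pairs im a g q B \<Delta> k)"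
  using assms
proof (cases rule: leaf_cases[where a = a and g = g and k = k])
  case (2 x)
  let ?i = "g * group_dirs + k div b" and ?r = "k mod b"
  have pairs: "leaf_pairs im a g q B \<Delta> k = {?i} \<times> (points im ?r x \<inter> {w \<in> B. \<Delta> \<le> rel q ?i w})"
    using 2 by (auto simp: leaf_pairs_def heavy_pairs_def)
  have "weight im q B \<Delta> (leaf im a g k) = Suc ?r * card (leaf_pairs im a g q B \<Delta> k)"
    unfolding pairs 2 using b_pos weight_code[OF _ tree_rep_less[OF 2(3)], of ?r]
    by (simp add: card_cartesian_product_singleton)
  also have "\<dots> \<le> b * card (leaf_pairs im a g q B \<Delta> k)"
    using b_pos by (intro mult_le_mono1) (simp add: Suc_le_eq)
  finally show ?thesis .
qed simp

lemma leaf_pairs_disjoint: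
  assumes "tree_family im rm (root_table im)" "k \<noteq> k'"
  shows "leaf_pairs im a g q B \<Delta> k \<inter> leaf_pairs im a g q B \<Delta> k' = {}"
proof (cases "k div b = k' div b")
  case True
  then have "k mod b \<noteq> k' mod b" using assms(2) by (metis div_mult_mod_eq)
  then have "points im (k mod b) x \<inter> points im (k' mod b) x' = {}"
    if "root_table im (Stored a, k mod b) = Some x" "root_table im (Stored a, k' mod b) = Some x'" for x x'
    using tree_family_disjoint[OF assms(1) that] by simp
  then show ?thesis unfolding leaf_pairs_def by blast
qed (auto simp: leaf_pairs_def)

lemma leaf_pairs_subset: "leaf_pairs im a g q B \<Delta> k \<subseteq> heavy_pairs (block group_dirs g) (rel q) B \<Delta>"
  by (auto simp: leaf_pairs_def)

lemma progress_leaves: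
  assumes fam: "tree_family im rm (root_table im)" and C: "C = cluster im a"
  shows "progress im rm C g q 0 (leaf im a g) \<delta>"
  unfolding progress_def
proof (intro allI impI disjI2 conjI)
  fix B \<Delta> i y
  assume B: "B \<subseteq> C" and i: "i \<in> block group_dirs g" and y: "y \<in> C - B"
  show "covered im rm (leaf im a g) i y" by (rule leaf_covers[OF fam _ i]) (use y C in simp)
  have "B \<subseteq> {..<n}" using B[unfolded C cluster_def] contents_subset[OF fam] by (rule order_trans)
  then have "finite B" using finite_subset by blast
  then have fin: "finite (heavy_pairs (block group_dirs g) (rel q) B \<Delta>)"
    by (auto simp: heavy_pairs_def block_def)
  have "(\<Sum>k<slots. weight im q B \<Delta> (leaf im a g k)) \<le> (\<Sum>k<slots. b * card (leaf_pairs im a g q B \<Delta> k))"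
    by (intro sum_mono weight_leaf_le[OF fam])
  also have "\<dots> = b * card (\<Union>k<slots. leaf_pairs im a g q B \<Delta> k)"
  proof -
    have "finite (leaf_pairs im a g q B \<Delta> k)" for k
      by (rule finite_subset[OF leaf_pairs_subset fin])
    then have "card (\<Union>k<slots. leaf_pairs im a g q B \<Delta> k) = (\<Sum>k<slots. card (leaf_pairs im a g q B \<Delta> k))"
      by (intro card_UN_disjoint ballI impI leaf_pairs_disjoint[OF fam]) simp_all
    then show ?thesis by (simp only: sum_distrib_left)
  qed
  also have "\<dots> \<le> b * card (heavy_pairs (block group_dirs g) (rel q) B \<Delta>)"
    by (intro mult_le_mono2 card_mono[OF fin] UN_least leaf_pairs_subset)
  finally show "(\<Sum>k<slots. weight im q B \<Delta> (leaf im a g k)) + 0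
      \<le> b * card (heavy_pairs (block group_dirs g) (rel q) B \<Delta>)" by simp
qed

end


section \<open>Queries\<close>

context projected
begin

lemma queue_node_slot:
  assumes "queue_ok q {} s" "0 < j" "j < 2 * slots"
  shows "\<exists>k<slots. slot s k = imem s (queue + j)"
  using assms(2,3)
proof (induction "2 * slots - j" arbitrary: j rule: less_induct)
  case less
  show ?case
  proof (cases "j < slots")
    case True
    have "\<exists>k<slots. slot s k = imem s (queue + 2 * j)" "\<exists>k<slots. slot s k = imem s (queue + (2 * j + 1))"
      using less.hyps[of "2 * j"] less.hyps[of "2 * j + 1"] less.prems True by auto
    then show ?thesis
      using queue_ok_better[OF assms(1) less.prems(1) True] better_cases by (metis empty_iff)
  next
    case False
    then show ?thesis using less.prems by (intro exI[of _ "j - slots"]) (simp add: slot_def)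
  qed
qed

lemma wp_distance:
  assumes par: "params (ireg s)" and regs: "ireg s Query_Point = q" "ireg s Winner = w" and q: "q < n"
    and w: "w < n"
  shows "wp m distance (\<lambda>t s'. t \<le> 3 + d * 4 \<and> imem s' = imem s \<and> frame {Coord} {Sqdist, Diff} s s' \<and>
    rreg s' Sqdist = dist2 (rmem s) w q) s"
proof -
  let ?s = "s\<lparr>rreg := (rreg s)(Sqdist := 0)\<rparr>"
  define I where "I = (\<lambda>k s'. imem s' = imem s \<and> frame {Coord} {Sqdist, Diff} s s' \<and> ireg s' Coord = k \<and>
      rreg s' Sqdist = (\<Sum>j<k. (rmem s (w * d + j) - rmem s (q * d + j))\<^sup>2))"
  let ?body = "RSet Diff (RSub (RLoad (\<acute>Winner *\<^sub>I \<acute>Dim +\<^sub>I \<acute>Coord)) (RLoad (\<acute>Query_Point *\<^sub>I \<acute>Dim +\<^sub>I \<acute>Coord)));;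
        RSet Sqdist (RAdd (RReg Sqdist) (RMul (RReg Diff) (RReg Diff)))"
  have "wp m (for_upto Coord Dim ?body) (\<lambda>t s'. t \<le> 2 + d * (2 + 2) \<and> I d s') ?s"
  proof (rule wp_for_upto)
    show "I 0 (?s\<lparr>ireg := (ireg ?s)(Coord := 0)\<rparr>)" by (simp add: I_def frame_def regs_same_off_def)
    fix k s1
    assume I: "I k s1"
    then have framed: "frame {Coord} {Sqdist, Diff} s s1" by (simp add: I_def)
    have par1: "params (ireg s1)" by (rule frame_params[OF framed _ par]) auto
    then show "ireg s1 Coord = k \<and> ireg s1 Dim = d" using I by (simp add: I_def)
    assume k: "k < d"
    have regs1: "ireg s1 Query_Point = q" "ireg s1 Winner = w" "ireg s1 Coord = k" "rmem s1 = rmem s"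
      using frame_ireg[OF framed] frame_rmem[OF framed] regs I by (simp_all add: I_def)
    have "w * d + k < m" "q * d + k < m" "w < m" "q < m"
      using coord_index_less[OF w k] coord_index_less[OF q k] region_order params_less w q by linarith+
    then show "wp m ?body (\<lambda>t s'. t \<le> 2 \<and> ireg s' Coord = k \<and>
        I (Suc k) (s'\<lparr>ireg := (ireg s')(Coord := Suc k)\<rparr>)) s1"
      using par1 regs1 I k params_less by (simp add: wp_simps I_def frame_def regs_same_off_def power2_eq_square)
  qed (rule params_less)
  then have "wp m (for_upto Coord Dim ?body) (\<lambda>t s'. Suc t \<le> 3 + d * 4 \<and> imem s' = imem s \<and>
      frame {Coord} {Sqdist, Diff} s s' \<and> rreg s' Sqdist = dist2 (rmem s) w q) ?s"
    by (rule wp_mono) (auto simp: I_def dist2_def)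
  then show ?thesis using params_less by (simp add: distance_def wp_simps)
qed

lemma wp_record_winner:
  assumes "params (ireg s)" "ireg s Query_Point = q" "ireg s Winner = w" "q < n" "w < n"
  defines "\<delta> \<equiv> dist2 (rmem s) w q"
  shows "wp m record_winner (\<lambda>t s'. t \<le> 6 + d * 4 \<and> imem s' = imem s \<and>
      frame {Coord, Result} {Best, Sqdist, Diff} s s' \<and>
    rreg s' Best = max (rreg s Best) \<delta> \<and> ireg s' Result = (if rreg s Best < \<delta> then w else ireg s Result)) s"
  unfolding record_winner_def
proof (rule wp_SeqI[OF wp_distance[OF assms(1-5)]], elim conjE)
  fix t s1
  assume t: "t \<le> 3 + d * 4" and im: "imem s1 = imem s" and framed: "frame {Coord} {Sqdist, Diff} s s1"
    and sq: "rreg s1 Sqdist = dist2 (rmem s) w q"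
  have "rreg s1 Best = rreg s Best" "ireg s1 Winner = w" "ireg s1 Result = ireg s Result" "w < m"
    using frame_rreg[OF framed] frame_ireg[OF framed] assms(3,5) params_less by auto
  moreover have "frame {Coord, Result} {Best, Sqdist, Diff} s s1" by (rule frame_mono[OF framed]) auto
  ultimately show "wp m (Cond (RLess (RReg Best) (RReg Sqdist)) (RSet Best (RReg Sqdist);;
      ISet Result \<acute>Winner) Skip)
    (\<lambda>t' s'. t + t' \<le> 6 + d * 4 \<and> imem s' = imem s \<and> frame {Coord, Result} {Best, Sqdist, Diff} s s' \<and>
       rreg s' Best = max (rreg s Best) \<delta> \<and> ireg s' Result = (if rreg s Best < \<delta> then w else ireg s Result)) s1"
    using t im sq by (auto simp: wp_simps frame_def regs_same_off_def \<delta>_def)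
qed

lemma wp_expand:
  assumes par: "params (ireg s)" and regs: "ireg s Top = u" "ireg s Index = u - 1"
    and cand: "candidate im rm C g u" and im: "\<And>a. a < queue \<Longrightarrow> imem s a = im a"
  shows "wp m expand (\<lambda>t s'. t \<le> 3 \<and> imem s' = imem s \<and> frame {Child1, Child2} {} s s' \<and>
    ireg s' Child1 = child1 u \<and> ireg s' Child2 = child2 im u) s"
proof -
  have u: "u \<le> dirs * trees" and child2: "child2 im u \<le> dirs * trees"
    using candidate_le[OF cand] candidate_children(2)[OF cand] candidate_le by auto
  have "trees + ((u - 1) mod trees - n) < 2 * trees" using trees_pos by (simp add: less_imp_diff_less)
  then have addr: "trees + ((u - 1) mod trees - n) < m"
    and load: "imem s (trees + ((u - 1) mod trees - n)) = im (trees + ((u - 1) mod trees - n))"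
    using region_order params_less im by auto
  have less: "(u - 1) mod trees < m" "(u - 1) mod n < m" "u < m" "u - 1 < m" "u - n < m" "child2 im u < m"
    using u child2 params_less by (auto intro: le_less_trans[OF mod_less_eq_dividend])
  have "im (trees + ((u - 1) mod trees - n)) < m" if "(u - 1) div n mod b \<noteq> 0"
    using child2 that params_less by (auto simp: child2_def)
  then show ?thesis
    using par regs params_less less addr load
    by (cases "(u - 1) div n mod b = 0")
      (simp_all add: expand_def wp_simps child1_def child2_def frame_def regs_same_off_def)
qed

lemma wp_set_children:
  assumes par: "params (ireg s)" and regs: "ireg s Query_Point = q" "ireg s Pos = slots + k"
    "ireg s Slot = l"
    and q: "q < n" and k: "k < slots" and l: "l < slots" and ok: "queue_ok q {} s"
    and codes: "ireg s Child1 \<le> dirs * trees" "ireg s Child2 \<le> dirs * trees"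
  shows "wp m set_children (\<lambda>t s'. t \<le> 6 + depth * 12 \<and> frame {Pos, Left, Right, Slot} {} s s' \<and>
    queue_ok q {} s' \<and> ireg s' Slot = Suc l \<and> slot s' = (slot s)(k := ireg s Child1, l := ireg s Child2)) s"
  unfolding set_children_def
proof (rule wp_SeqI[OF wp_set_leaf[OF par regs(2,1) q k codes(1) ok]], elim conjE)
  fix t1 s1
  assume t1: "t1 \<le> 2 + depth * 6" and frame1: "frame {Pos, Left, Right} {} s s1"
    and sl1: "slot s1 = (slot s)(k := ireg s Child1)" and ok1: "queue_ok q {} s1"
  let ?R = "{Pos, Left, Right, Slot}"
  let ?post = "\<lambda>t s'. t \<le> 6 + depth * 12 \<and> frame ?R {} s s' \<and> queue_ok q {} s' \<and> ireg s' Slot = Suc l \<and>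
    slot s' = (slot s)(k := ireg s Child1, l := ireg s Child2)"
  let ?s1 = "s1\<lparr>ireg := (ireg s1)(Pos := slots + l)\<rparr>"
  have fr1: "frame ?R {} s ?s1" using frame1 by (auto simp: frame_def regs_same_off_def)
  have par1: "params (ireg ?s1)" by (rule frame_params[OF fr1 _ par]) auto
  have regs1: "ireg ?s1 Pos = slots + l" "ireg ?s1 Query_Point = q" "ireg ?s1 Child2 \<le> dirs * trees"
    "ireg s1 Slot = l" "ireg s1 Child2 = ireg s Child2"
    using frame_ireg[OF frame1] regs codes by auto
  have "queue_ok q {} ?s1" using ok1 by simp
  note wp2 = wp_set_leaf[OF par1 regs1(1,2) q l regs1(3) this]
  have "wp m (set_leaf Child2;; incr Slot) (\<lambda>t. ?post (t1 + Suc t)) ?s1"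
  proof (rule wp_SeqI[OF wp2], elim conjE)
    fix t2 s2
    assume t2: "t2 \<le> 2 + depth * 6" and frame2: "frame {Pos, Left, Right} {} ?s1 s2"
      and sl2: "slot s2 = (slot ?s1)(l := ireg ?s1 Child2)" and ok2: "queue_ok q {} s2"
    have "frame ?R {} s s2" by (rule frame_trans[OF fr1 frame2]) auto
    moreover have "ireg s2 Slot = l" using frame_ireg[OF frame2, of Slot] regs1 by simp
    ultimately show "wp m (incr Slot) (\<lambda>t. ?post (t1 + Suc (t2 + t))) s2"
      using t1 t2 sl1 sl2 ok2 regs1 l params_less by (simp add: wp_incr frame_ireg_upd)
  qed
  then show "wp m (ISet Pos (\<acute>Slots +\<^sub>I \<acute>Slot);; set_leaf Child2;; incr Slot) (\<lambda>t. ?post (t1 + t)) s1"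
    using frame_params[OF frame1 _ par] regs1 l queue_less[of "slots + l"] params_less
    by (simp add: wp_Seq wp_ISet)
qed

lemma wp_replace_top:
  assumes par: "params (ireg s)" and regs: "ireg s Query_Point = q" "ireg s Top = u" "ireg s Index = u - 1"
      "ireg s Slot = l"
    and u: "imem s (queue + 1) = u" and q: "q < n" and ok: "queue_ok q {} s"
    and cand: "candidate im rm C g u" and im: "\<And>a. a < queue \<Longrightarrow> imem s a = im a"
    and l: "l < slots" "\<And>k. l \<le> k \<Longrightarrow> k < slots \<Longrightarrow> slot s k = 0"
  shows "wp m replace_top (\<lambda>t s'. t \<le> 11 + 15 * depth \<and>
      frame {Pos, Left, Right, Slot, Child1, Child2} {} s s' \<and>
    queue_ok q {} s' \<and> ireg s' Slot = Suc l \<and>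
    (\<exists>k<l. slot s k = u \<and> slot s' = (slot s)(k := child1 u, l := child2 im u))) s"
  unfolding replace_top_def
proof (rule wp_SeqI[OF wp_find_top[OF par regs(2) u ok]], elim conjE exE)
  fix t1 s1 k
  assume t1: "t1 \<le> 2 + depth * 3" and im1: "imem s1 = imem s" and frame1: "frame {Pos} {} s s1"
    and k: "k < slots" "ireg s1 Pos = slots + k" "slot s k = u"
  let ?R = "{Pos, Left, Right, Slot, Child1, Child2}"
  let ?post = "\<lambda>t s'. t \<le> 11 + 15 * depth \<and> frame ?R {} s s' \<and> queue_ok q {} s' \<and> ireg s' Slot = Suc l \<and>
    (\<exists>k<l. slot s k = u \<and> slot s' = (slot s)(k := child1 u, l := child2 im u))"
  have "u \<noteq> 0" using cand by (auto simp: candidate_def code_def)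
  then have kl: "k < l" using l(2)[of k] k by (cases "k < l") auto
  have par1: "params (ireg s1)" by (rule frame_params[OF frame1 _ par]) auto
  have regs1: "ireg s1 Top = u" "ireg s1 Index = u - 1" using frame_ireg[OF frame1] regs by auto
  have same1: "imem s1 a = im a" if "a < queue" for a using im im1 that by simp
  show "wp m (expand;; set_children) (\<lambda>t. ?post (t1 + t)) s1"
  proof (rule wp_SeqI[OF wp_expand[OF par1 regs1 cand same1]], assumption, elim conjE)
    fix t2 :: nat and s2
    assume t2: "t2 \<le> 3" and im2: "imem s2 = imem s1" and frame2: "frame {Child1, Child2} {} s1 s2"
      and ch: "ireg s2 Child1 = child1 u" "ireg s2 Child2 = child2 im u"
    have par2: "params (ireg s2)" by (rule frame_params[OF frame2 _ par1]) auto
    have regs2: "ireg s2 Query_Point = q" "ireg s2 Pos = slots + k" "ireg s2 Slot = l"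
      using frame_ireg[OF frame2] frame_ireg[OF frame1] k(2) regs by auto
    have ok2: "queue_ok q {} s2" using ok im1 im2 frame_rmem[OF frame1] frame_rmem[OF frame2]
      by (simp add: queue_ok_def)
    have sl2: "slot s2 = slot s" using im1 im2 by (simp add: slot_def fun_eq_iff)
    have "ireg s2 Child1 \<le> dirs * trees" "ireg s2 Child2 \<le> dirs * trees"
      using candidate_children[OF cand] candidate_le ch by auto
    note wp3 = wp_set_children[OF par2 regs2 q k(1) l(1) ok2 this]
    have "frame ?R {} s s3" if "frame {Pos, Left, Right, Slot} {} s2 s3" for s3
      by (rule frame_trans[OF frame_trans[OF frame1 frame2 subset_refl subset_refl] that]) auto
    then show "wp m set_children (\<lambda>t. ?post (t1 + (t2 + t))) s2"
      using t1 t2 kl k(3) sl2 ch by (auto intro!: wp_mono[OF wp3])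
  qed
qed

definition pop_inv :: "(nat \<Rightarrow> nat) \<Rightarrow> (nat \<Rightarrow> real) \<Rightarrow> nat set \<Rightarrow> nat \<Rightarrow> nat \<Rightarrow> state \<Rightarrow> bool" where
  "pop_inv im rm C g q s \<longleftrightarrow> params (ireg s) \<and> ireg s Query_Point = q \<and> rmem s = rm \<and>
      (\<forall>a<queue. imem s a = im a) \<and>
     queue_ok q {} s \<and> (\<forall>k<slots. slot s k = 0 \<or> candidate im rm C g (slot s k)) \<and>
     (\<forall>k. ireg s Slot \<le> k \<longrightarrow> k < slots \<longrightarrow> slot s k = 0)"

definition popped :: "(nat \<Rightarrow> nat) \<Rightarrow> nat \<Rightarrow> state \<Rightarrow> state \<Rightarrow> bool" where
  "popped im q s s' \<longleftrightarrow> (let u = imem s (queue + 1); \<delta> = dist2 (rmem s) (winner im u) q in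
     if u = 0 then slot s' = slot s \<and> ireg s' Slot = ireg s Slot \<and> ireg s' Result = ireg s Result \<and>
       rreg s' Best = rreg s Best
     else (\<exists>k<ireg s Slot. slot s k = u \<and> slot s' = (slot s)(k := child1 u, ireg s Slot := child2 im u)) \<and>
       ireg s' Slot = Suc (ireg s Slot) \<and> rreg s' Best = max (rreg s Best) \<delta> \<and>
       ireg s' Result = (if rreg s Best < \<delta> then winner im u else ireg s Result))"

lemma popped_cases:
  assumes "popped im q s s'"
  obtains (empty) "imem s (queue + 1) = 0" "slot s' = slot s" "ireg s' Slot = ireg s Slot"
      "ireg s' Result = ireg s Result" "rreg s' Best = rreg s Best"
    | (top) u \<delta> k where "u = imem s (queue + 1)" "u \<noteq> 0" "\<delta> = dist2 (rmem s) (winner im u) q"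
      "k < ireg s Slot" "slot s k = u" "slot s' = (slot s)(k := child1 u, ireg s Slot := child2 im u)"
      "ireg s' Slot = Suc (ireg s Slot)" "rreg s' Best = max (rreg s Best) \<delta>"
      "ireg s' Result = (if rreg s Best < \<delta> then winner im u else ireg s Result)"
  using assms unfolding popped_def Let_def by (metis (no_types))

definition pop_scratch :: "reg set" where
  "pop_scratch = {Pos, Left, Right, Slot, Top, Index, Winner, Coord, Result, Child1, Child2}"

definition pop_time :: nat where "pop_time = 21 + 4 * d + 15 * depth"

lemma wp_process_top:
  assumes inv: "pop_inv im rm C g q s" and q: "q < n" and l: "ireg s Slot < slots"
    and top: "imem s (queue + 1) = u" and cand: "candidate im rm C g u"
    and regs: "ireg s Top = u" "ireg s Index = u - 1" "ireg s Winner = winner im u"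
  shows "wp m (record_winner;; replace_top) (\<lambda>t s'. t \<le> 17 + 4 * d + 15 * depth \<and>
    frame pop_scratch {Best, Sqdist, Diff} s s' \<and> queue_ok q {} s' \<and> popped im q s s') s"
proof -
  have par: "params (ireg s)" and rq: "ireg s Query_Point = q" and ok: "queue_ok q {} s"
    and same: "\<And>a. a < queue \<Longrightarrow> imem s a = im a"
    and free: "\<And>k. ireg s Slot \<le> k \<Longrightarrow> k < slots \<Longrightarrow> slot s k = 0"
    using inv unfolding pop_inv_def by auto
  let ?\<delta> = "dist2 (rmem s) (winner im u) q"
  show ?thesis
  proof (rule wp_SeqI[OF wp_record_winner[OF par rq regs(3) q candidate_winner(2)[OF cand]]], elim conjE)
    fix t1 s1
    assume t1: "t1 \<le> 6 + d * 4" and im1: "imem s1 = imem s"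
      and frame1: "frame {Coord, Result} {Best, Sqdist, Diff} s s1"
      and best1: "rreg s1 Best = max (rreg s Best) ?\<delta>"
      and res1: "ireg s1 Result = (if rreg s Best < ?\<delta> then winner im u else ireg s Result)"
    have par1: "params (ireg s1)" by (rule frame_params[OF frame1 _ par]) auto
    have regs1: "ireg s1 Query_Point = q" "ireg s1 Top = u" "ireg s1 Index = u - 1"
      "ireg s1 Slot = ireg s Slot"
      using frame_ireg[OF frame1] rq regs by auto
    have sl1: "slot s1 = slot s" using im1 by (simp add: slot_def fun_eq_iff)
    have ok1: "queue_ok q {} s1" using ok im1 frame_rmem[OF frame1] by (simp add: queue_ok_def)
    have same1: "imem s1 a = im a" if "a < queue" for a using im1 same that by simp
    have top1: "imem s1 (queue + 1) = u" using im1 top by simp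
    have free1: "slot s1 k = 0" if "ireg s Slot \<le> k" "k < slots" for k using free that sl1 by simp
    show "wp m replace_top (\<lambda>t s'. t1 + t \<le> 17 + 4 * d + 15 * depth \<and>
      frame pop_scratch {Best, Sqdist, Diff} s s' \<and> queue_ok q {} s' \<and> popped im q s s') s1"
    proof (rule wp_mono[OF wp_replace_top[OF par1 regs1 top1 q ok1 cand same1 l free1]], assumption+, elim conjE exE)
      fix t2 s2 k
      assume t2: "t2 \<le> 11 + 15 * depth" and frame2:
        "frame {Pos, Left, Right, Slot, Child1, Child2} {} s1 s2"
        and ok2: "queue_ok q {} s2" and slot2: "ireg s2 Slot = Suc (ireg s Slot)"
        and k: "k < ireg s Slot" "slot s1 k = u"
        and sl2: "slot s2 = (slot s1)(k := child1 u, ireg s Slot := child2 im u)"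
      have "u \<noteq> 0" using cand by (auto simp: candidate_def code_def)
      then have "popped im q s s2"
        using k sl1 sl2 slot2 best1 res1 frame_ireg[OF frame2, of Result] frame_rreg[OF frame2, of Best] top
        by (auto simp: popped_def Let_def)
      moreover have "frame pop_scratch {Best, Sqdist, Diff} s s2"
        by (rule frame_trans[OF frame1 frame2]) (auto simp: pop_scratch_def)
      ultimately show "t1 + t2 \<le> 17 + 4 * d + 15 * depth \<and>
          frame pop_scratch {Best, Sqdist, Diff} s s2 \<and> queue_ok q {} s2 \<and> popped im q s s2"
        using t1 t2 ok2 by simp
    qed
  qed
qed

lemma wp_pop:
  assumes inv: "pop_inv im rm C g q s" and q: "q < n" and l: "ireg s Slot < slots"
  shows "wp m pop (\<lambda>t s'. t \<le> pop_time \<and> frame pop_scratch {Best, Sqdist, Diff} s s' \<and> queue_ok q {} s' \<and>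
    popped im q s s') s"
proof -
  have par: "params (ireg s)" and ok: "queue_ok q {} s" and im: "\<And>a. a < queue \<Longrightarrow> imem s a = im a"
    and cand: "\<And>k. k < slots \<Longrightarrow> slot s k = 0 \<or> candidate im rm C g (slot s k)"
    using inv unfolding pop_inv_def by auto
  let ?post = "\<lambda>t s'. t \<le> pop_time \<and> frame pop_scratch {Best, Sqdist, Diff} s s' \<and> queue_ok q {} s' \<and>
      popped im q s s'"
  define u where "u = imem s (queue + 1)"
  have u: "u \<le> dirs * trees" using queue_ok_code[OF ok, of 1] slots_pos by (simp add: u_def)
  have less: "queue + 1 < m" "u < m" "u - 1 < m" using u queue_less[of 1] slots_pos params_less by auto
  show ?thesis
  proof (cases "u = 0")
    case True
    have "?post 3 (s\<lparr>ireg := (ireg s)(Top := 0)\<rparr>)"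
      using True ok by (auto simp: u_def pop_time_def pop_scratch_def frame_ireg_upd frame_refl popped_def)
    then show ?thesis using True par less params_less by (simp add: pop_def wp_simps u_def numeral_3_eq_3)
  next
    case False
    obtain k where k: "k < slots" "slot s k = u"
      using queue_node_slot[OF ok, of 1] slots_pos by (auto simp: u_def)
    then have uc: "candidate im rm C g u" using cand[OF k(1)] False by simp
    have "winners + (u - 1) < queue" using key_index_less(1)[OF u q] by (simp add: queue_def)
    then have load: "imem s (winners + (u - 1)) = winner im u" "winners + (u - 1) < m"
      using im params_less by (auto simp: winner_def)
    let ?s = "s\<lparr>ireg := (ireg s)(Top := u, Index := u - 1, Winner := winner im u)\<rparr>"
    have inv': "pop_inv im rm C g q ?s" using inv by (simp add: pop_inv_def)
    have top': "imem ?s (queue + 1) = u" by (simp add: u_def)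
    have "wp m (record_winner;; replace_top) (\<lambda>t. ?post (Suc (Suc (Suc (Suc t))))) ?s"
      by (rule wp_mono[OF wp_process_top[OF inv' q _ top' uc]])
        (use l in \<open>auto simp: pop_time_def popped_def Let_def frame_def regs_same_off_def pop_scratch_def\<close>)
    then show ?thesis
      using False par less load candidate_winner(2)[OF uc] params_less by (simp add: pop_def wp_simps u_def)
  qed
qed

lemma pop_inv_popped:
  assumes inv: "pop_inv im rm C g q s" and framed: "frame pop_scratch F s s'" and ok: "queue_ok q {} s'"
    and pop: "popped im q s s'"
  shows "pop_inv im rm C g q s'"
proof -
  have cand: "\<forall>k<slots. slot s k = 0 \<or> candidate im rm C g (slot s k)"
    and free: "\<forall>k. ireg s Slot \<le> k \<longrightarrow> k < slots \<longrightarrow> slot s k = 0" using inv by (auto simp: pop_inv_def)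
  have "(\<forall>k<slots. slot s' k = 0 \<or> candidate im rm C g (slot s' k)) \<and>
      (\<forall>k. ireg s' Slot \<le> k \<longrightarrow> k < slots \<longrightarrow> slot s' k = 0)"
    using pop
  proof (cases rule: popped_cases)
    case empty
    then show ?thesis using cand free by simp
  next
    case (top u \<delta> k)
    show ?thesis
    proof (cases "k < slots")
      case True
      then have "candidate im rm C g u" using cand top by auto
      then show ?thesis using candidate_children cand free top by (auto simp: fun_upd_def)
    next
      case False
      then show ?thesis using cand free top by (auto simp: fun_upd_def)
    qed
  qed
  moreover have "params (ireg s')" by (rule frame_params[OF framed])
    (use inv in \<open>auto simp: pop_inv_def pop_scratch_def\<close>)
  ultimately show ?thesis using inv ok frame_ireg[OF framed, of Query_Point] frame_rmem[OF framed] frame_imem[OF framed]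
    by (auto simp: pop_inv_def pop_scratch_def)
qed

definition result_ok :: "(nat \<Rightarrow> real) \<Rightarrow> nat set \<Rightarrow> nat \<Rightarrow> state \<Rightarrow> bool" where
  "result_ok rm C q s \<longleftrightarrow> rreg s Best = -1 \<or> ireg s Result \<in> C \<and> rreg s Best = dist2 rm (ireg s Result) q"

lemma popped_step:
  assumes inv: "pop_inv im rm C g q s" and pop: "popped im q s s'" and slots: "ireg s Slot < slots"
    and leafs: "leaf_projs rm" and q: "q < n" and g: "g < 3 * b"
    and res: "result_ok rm C q s" and pr: "progress im rm C g q p (slot s) (rreg s Best)"
  shows "result_ok rm C q s'" "rreg s Best \<le> rreg s' Best" "ireg s' Slot \<le> Suc (ireg s Slot)"
    "progress im rm C g q (Suc p) (slot s') (rreg s' Best)"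
proof -
  have ok: "queue_ok q {} s" and rm: "rmem s = rm" using inv by (auto simp: pop_inv_def)
  have "result_ok rm C q s' \<and> rreg s Best \<le> rreg s' Best \<and> ireg s' Slot \<le> Suc (ireg s Slot) \<and>
    progress im rm C g q (Suc p) (slot s') (rreg s' Best)"
    using pop
  proof (cases rule: popped_cases)
    case empty
    have "slot s k = 0" if "k < slots" for k using queue_top_max_slot(1)[OF ok that] empty by auto
    then show ?thesis using empty res progress_empty[OF pr] by (simp add: result_ok_def)
  next
    case (top u \<delta> k)
    have k: "k < slots" using top slots by simp
    then have cand: "candidate im rm C g u" using inv top by (auto simp: pop_inv_def)
    have "slot s (ireg s Slot) = 0" using inv slots by (auto simp: pop_inv_def)
    then have "progress im rm C g q (Suc p) (slot s') (rreg s' Best)"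
      using progress_step[OF pr leafs q g cand k _ slots] queue_top_max_slot(2)[OF ok] top rm by auto
    moreover have "result_ok rm C q s'"
      using res top candidate_winner(1)[OF cand] dist2_nonneg[of rm "winner im u" q] rm
      by (auto simp: result_ok_def)
    ultimately show ?thesis using top by simp
  qed
  then show "result_ok rm C q s'" "rreg s Best \<le> rreg s' Best" "ireg s' Slot \<le> Suc (ireg s Slot)"
    "progress im rm C g q (Suc p) (slot s') (rreg s' Best)" by auto
qed

lemma wp_pops:
  assumes inv: "pop_inv im rm C g q s" and sl: "ireg s Slot = group_dirs * b"
    and leafs: "leaf_projs rm" and q: "q < n" and g: "g < 3 * b"
    and res: "result_ok rm C q s" and pr: "progress im rm C g q 0 (slot s) (rreg s Best)"
  shows "wp m (for_upto Popped Pops pop) (\<lambda>t s'. t \<le> 2 + pops * (pop_time + 2) \<and>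
    frame {Pos..Child2} {Best, Sqdist, Diff} s s' \<and> result_ok rm C q s' \<and> rreg s Best \<le> rreg s' Best \<and>
    served rm C q g (rreg s' Best)) s"
proof -
  define I where "I = (\<lambda>p s'. frame {Pos..Child2} {Best, Sqdist, Diff} s s' \<and> pop_inv im rm C g q s' \<and>
    ireg s' Popped = p \<and> ireg s' Slot \<le> group_dirs * b + p \<and> result_ok rm C q s' \<and> rreg s Best \<le> rreg s' Best \<and>
    progress im rm C g q p (slot s') (rreg s' Best))"
  have "wp m (for_upto Popped Pops pop) (\<lambda>t s'. t \<le> 2 + pops * (pop_time + 2) \<and> I pops s') s"
  proof (rule wp_for_upto)
    show "I 0 (s\<lparr>ireg := (ireg s)(Popped := 0)\<rparr>)"
      using inv sl res pr by (simp add: I_def frame_ireg_upd frame_refl pop_inv_def result_ok_def)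
    fix p s1
    assume I: "I p s1"
    then show "ireg s1 Popped = p \<and> ireg s1 Pops = pops" by (simp add: I_def pop_inv_def)
    assume p: "p < pops"
    have inv1: "pop_inv im rm C g q s1" and slot1: "ireg s1 Slot < slots" and res1: "result_ok rm C q s1"
      and framed: "frame {Pos..Child2} {Best, Sqdist, Diff} s s1"
      and pr1: "progress im rm C g q p (slot s1) (rreg s1 Best)" using I p slots_eq by (auto simp: I_def)
    show "wp m pop (\<lambda>t s'. t \<le> pop_time \<and> ireg s' Popped = p \<and>
        I (Suc p) (s'\<lparr>ireg := (ireg s')(Popped := Suc p)\<rparr>)) s1"
    proof (rule wp_mono[OF wp_pop[OF inv1 q slot1]], elim conjE, intro conjI)
      fix t s2
      assume frame2: "frame pop_scratch {Best, Sqdist, Diff} s1 s2" and ok2: "queue_ok q {} s2"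
        and pop: "popped im q s1 s2"
      show "ireg s2 Popped = p" using frame_ireg[OF frame2, of Popped] I
        by (simp add: I_def pop_scratch_def)
      have "frame {Pos..Child2} {Best, Sqdist, Diff} s s2"
        by (rule frame_trans[OF framed frame2]) (auto simp: pop_scratch_def)
      then show "I (Suc p) (s2\<lparr>ireg := (ireg s2)(Popped := Suc p)\<rparr>)"
        using I pop_inv_popped[OF inv1 frame2 ok2 pop] popped_step[OF inv1 pop slot1 leafs q g res1 pr1]
        by (simp add: I_def frame_ireg_upd pop_inv_def result_ok_def)
    qed
  qed (rule params_less)
  then show ?thesis by (rule wp_mono) (auto simp: I_def intro: progress_served)
qed

lemma root_le:
  assumes "tree_family im rm (root_table im)" "a < n" "j < b" shows "im (root_addr a j) \<le> n"
proof (cases "im (root_addr a j)")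
  case (Suc x)
  then have "root_table im (Stored a, j) = Some x" using assms by simp
  then show ?thesis using tree_rep_less[OF tree_family_tree[OF assms(1)]] Suc by fastforce
qed simp

lemma leaf_eq:
  assumes "k < group_dirs * b" "a < n" "im (root_addr a (k mod b)) \<noteq> 0"
  shows "leaf im a g k = (g * (group_dirs * b) + k) * n + im (root_addr a (k mod b))"
proof -
  have "g * (group_dirs * b) + k = (g * group_dirs + k div b) * b + k mod b"
    by (simp add: algebra_simps)
  then have "(g * (group_dirs * b) + k) * n = (g * group_dirs + k div b) * trees + k mod b * n"
    by (simp only: trees_def add_mult_distrib mult.assoc)
  moreover have "root_table im (Stored a, k mod b) = Some (im (root_addr a (k mod b)) - 1)"
    using assms b_pos by simp
  ultimately show ?thesis using assms by (simp add: leaf_def code_def)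
qed

lemma leaf_eq_0: "im (root_addr a (k mod b)) = 0 \<or> group_dirs * b \<le> k \<Longrightarrow> a < n \<Longrightarrow> leaf im a g k = 0"
  using b_pos by (auto simp: leaf_def)

lemma wp_fill_leaf:
  assumes par: "params (ireg s)" and regs: "ireg s Handle = a" "ireg s Group = g" "ireg s Slot = k"
    and a: "a < n" and g: "g < 3 * b" and k: "k < slots"
    and fam: "tree_family (imem s) (rmem s) (root_table (imem s))"
  shows "wp m fill_leaf (\<lambda>t s'. t \<le> 3 \<and> frame {Root} {} s s' \<and>
      slot s' = (slot s)(k := leaf (imem s) a g k)) s"
proof -
  let ?r = "imem s (root_addr a (k mod b))" and ?c = "g * (group_dirs * b) + k"
  have code: "g * (group_dirs * b) < m" "?c < m" "?c * n < m" "?c * n + ?r < m"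
    if "0 < ?r" "k < group_dirs * b"
  proof -
    have "leaf (imem s) a g k \<le> dirs * trees" using leaf_candidate[OF fam g, of a k] candidate_le by auto
    then have "?c * n + ?r < m" using leaf_eq[of k a "imem s" g] that a params_less by simp
    moreover have "?c \<le> ?c * n" using n_pos by simp
    ultimately show "g * (group_dirs * b) < m" "?c < m" "?c * n < m" "?c * n + ?r < m" by linarith+
  qed
  have less: "a * b < m" "root_addr a (k mod b) < m" "a < m" "k < m" "g < m" "queue + (slots + k) < m"
    "slots + k < m"
      "?r < m"
    using root_addr_less[of a "k mod b"] params_less queue_less[of "slots + k"] k a g root_le[OF fam a, of "k mod b"] b_pos
    by (auto simp: root_addr_def)
  let ?f = "s\<lparr>ireg := (ireg s)(Root := ?r), imem := (imem s)(queue + (slots + k) := leaf (imem s) a g k)\<rparr>"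
  have post: "frame {Root} {} s ?f" "slot ?f = (slot s)(k := leaf (imem s) a g k)"
    by (auto simp: frame_def regs_same_off_def slot_def)
  show ?thesis
  proof (cases "0 < ?r \<and> k < group_dirs * b")
    case True
    then show ?thesis using par regs less code params_less post leaf_eq[of k a "imem s" g] a
      by (simp add: fill_leaf_def wp_simps root_addr_def)
  next
    case False
    then show ?thesis using par regs less params_less post leaf_eq_0[of "imem s" a k g] a
      by (auto simp: fill_leaf_def wp_simps root_addr_def)
  qed
qed

lemma queue_ok_leaves:
  assumes "\<And>k. k < slots \<Longrightarrow> slot s k \<le> dirs * trees" shows "queue_ok q {..<slots} s"
proof -
  have "imem s (queue + k) \<le> dirs * trees" if "k < 2 * slots" "\<not> k < slots" for k
    using assms[of "k - slots"] that by (simp add: slot_def)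
  then show ?thesis by (simp add: queue_ok_def)
qed

lemma wp_fill_leaves:
  assumes par: "params (ireg s)" and regs: "ireg s Handle = a" "ireg s Group = g" and a: "a < n"
    and g: "g < 3 * b"
    and fam: "tree_family (imem s) (rmem s) (root_table (imem s))"
  shows "wp m (for_upto Slot Slots fill_leaf) (\<lambda>t s'. t \<le> 2 + slots * 5 \<and> frame {Slot, Root} {} s s' \<and>
    (\<forall>k<slots. slot s' k = leaf (imem s) a g k)) s"
proof -
  define I where "I = (\<lambda>k s'. frame {Slot, Root} {} s s' \<and> ireg s' Slot = k \<and>
      (\<forall>i<k. slot s' i = leaf (imem s) a g i))"
  have "wp m (for_upto Slot Slots fill_leaf) (\<lambda>t s'. t \<le> 2 + slots * (3 + 2) \<and> I slots s') s"
  proof (rule wp_for_upto)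
    show "I 0 (s\<lparr>ireg := (ireg s)(Slot := 0)\<rparr>)" by (simp add: I_def frame_ireg_upd frame_refl)
    fix k s1
    assume I: "I k s1"
    then have framed: "frame {Slot, Root} {} s s1" and slot1: "ireg s1 Slot = k" by (simp_all add: I_def)
    have par1: "params (ireg s1)" by (rule frame_params[OF framed _ par]) auto
    then show "ireg s1 Slot = k \<and> ireg s1 Slots = slots" using slot1 by simp
    assume k: "k < slots"
    have regs1: "ireg s1 Handle = a" "ireg s1 Group = g" using frame_ireg[OF framed] regs by simp_all
    have fam1: "tree_family (imem s1) (rmem s1) (root_table (imem s1))"
      using stored_trees_cong(1)[OF frame_imem[OF framed] fam] frame_rmem[OF framed] by simp
    have "root_table (imem s1) = root_table (imem s)"
      using frame_imem[OF framed] region_order by (intro root_table_cong) auto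
    then have leaf1: "leaf (imem s1) a g = leaf (imem s) a g" by (simp add: leaf_def fun_eq_iff)
    show "wp m fill_leaf (\<lambda>t s'. t \<le> 3 \<and> ireg s' Slot = k \<and>
        I (Suc k) (s'\<lparr>ireg := (ireg s')(Slot := Suc k)\<rparr>)) s1"
    proof (rule wp_mono[OF wp_fill_leaf[OF par1 regs1 slot1 a g k fam1]], elim conjE, intro conjI)
      fix t s2
      assume frame2: "frame {Root} {} s1 s2" and sl2: "slot s2 = (slot s1)(k := leaf (imem s1) a g k)"
      show "ireg s2 Slot = k" using frame_ireg[OF frame2, of Slot] slot1 by simp
      have "frame {Slot, Root} {} s s2" by (rule frame_trans[OF framed frame2]) auto
      then show "I (Suc k) (s2\<lparr>ireg := (ireg s2)(Slot := Suc k)\<rparr>)"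
        using I sl2 leaf1 by (simp add: I_def frame_ireg_upd less_Suc_eq)
    qed
  qed (rule params_less)
  then show ?thesis by (rule wp_mono) (auto simp: I_def)
qed

lemma wp_load_queue:
  assumes par: "params (ireg s)" and regs: "ireg s Handle = a" "ireg s Query_Point = q" "ireg s Group = g"
    and a: "a < n" and q: "q < n" and g: "g < 3 * b"
    and fam: "tree_family (imem s) (rmem s) (root_table (imem s))"
  shows "wp m load_queue (\<lambda>t s'. t \<le> 4 + slots * 11 \<and> frame {Pos..Root} {} s s' \<and> queue_ok q {} s' \<and>
    (\<forall>k<slots. slot s' k = leaf (imem s) a g k)) s"
  unfolding load_queue_def
proof (rule wp_SeqI[OF wp_fill_leaves[OF par regs(1,3) a g fam]], elim conjE)
  fix t1 s1
  assume t1: "t1 \<le> 2 + slots * 5" and frame1: "frame {Slot, Root} {} s s1"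
    and sl1: "\<forall>k<slots. slot s1 k = leaf (imem s) a g k"
  have par1: "params (ireg s1)" by (rule frame_params[OF frame1 _ par]) auto
  have q1: "ireg s1 Query_Point = q" using frame_ireg[OF frame1] regs by simp
  have "leaf (imem s) a g k \<le> dirs * trees" for k
    using leaf_candidate[OF fam g, of a k] candidate_le by auto
  then have ok1: "queue_ok q {..<slots} s1" using sl1 by (intro queue_ok_leaves) simp
  show "wp m build_queue (\<lambda>t s'. t1 + t \<le> 4 + slots * 11 \<and> frame {Pos..Root} {} s s' \<and> queue_ok q {} s' \<and>
      (\<forall>k<slots. slot s' k = leaf (imem s) a g k)) s1"
    by (rule wp_mono[OF wp_build_queue[OF par1 q1 q ok1]])
      (use t1 sl1 in \<open>auto intro: frame_trans[OF frame1]\<close>)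
qed

definition group_time :: nat where
  "group_time = 7 + slots * 11 + pops * (pop_time + 2)"

lemma wp_query_group:
  assumes par: "params (ireg s)" and regs: "ireg s Handle = a" "ireg s Query_Point = q" "ireg s Group = g"
    and a: "a < n" and q: "q < n" and g: "g < 3 * b"
    and fam: "tree_family (imem s) (rmem s) (root_table (imem s))" and leafs: "leaf_projs (rmem s)"
    and C: "C = cluster (imem s) a" and res: "result_ok (rmem s) C q s"
  shows "wp m query_group (\<lambda>t s'. t \<le> group_time \<and> frame {Pos..Child2} {Best, Sqdist, Diff} s s' \<and>
    result_ok (rmem s) C q s' \<and> rreg s Best \<le> rreg s' Best \<and> served (rmem s) C q g (rreg s' Best)) s"
  unfolding query_group_def
proof (rule wp_SeqI[OF wp_load_queue[OF par regs a q g fam]], elim conjE)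
  fix t1 s1
  let ?post = "\<lambda>t s'. t \<le> group_time \<and> frame {Pos..Child2} {Best, Sqdist, Diff} s s' \<and>
    result_ok (rmem s) C q s' \<and> rreg s Best \<le> rreg s' Best \<and> served (rmem s) C q g (rreg s' Best)"
  assume t1: "t1 \<le> 4 + slots * 11" and frame1: "frame {Pos..Root} {} s s1" and ok1: "queue_ok q {} s1"
    and sl1: "\<forall>k<slots. slot s1 k = leaf (imem s) a g k"
  let ?s1 = "s1\<lparr>ireg := (ireg s1)(Slot := group_dirs * b)\<rparr>"
  have framed: "frame {Pos..Child2} {Best, Sqdist, Diff} s ?s1"
    by (rule frame_ireg_upd[OF frame_mono[OF frame1]]) auto
  have par1: "params (ireg s1)" by (rule frame_params[OF frame1 _ par]) auto
  have cand: "leaf (imem s) a g k = 0 \<or> candidate (imem s) (rmem s) C g (leaf (imem s) a g k)" for k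
    unfolding C by (rule leaf_candidate[OF fam g])
  have slot1: "slot ?s1 k = leaf (imem s) a g k" if "k < slots" for k using sl1 that by simp
  have best: "rreg s1 Best = rreg s Best" "ireg s1 Result = ireg s Result"
    using frame_rreg[OF frame1] frame_ireg[OF frame1] by auto
  have "pop_inv (imem s) (rmem s) C g q ?s1"
    using par1 ok1 slot1 cand frame_ireg[OF frame1] regs(2) frame_rmem[OF framed] frame_imem[OF framed]
    by (auto simp: pop_inv_def leaf_def)
  moreover have "result_ok (rmem s) C q ?s1" using res best by (simp add: result_ok_def)
  moreover have "progress (imem s) (rmem s) C g q 0 (slot ?s1) (rreg ?s1 Best)"
    using progress_leaves[OF fam C] slot1 unfolding progress_def covered_def by (simp cong: conj_cong)
  ultimately have "wp m (for_upto Popped Pops pop) (\<lambda>t s'. t \<le> 2 + pops * (pop_time + 2) \<and>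
      frame {Pos..Child2} {Best, Sqdist, Diff} ?s1 s' \<and> result_ok (rmem s) C q s' \<and> rreg ?s1 Best \<le> rreg s' Best \<and>
      served (rmem s) C q g (rreg s' Best)) ?s1"
    using leafs q g by (intro wp_pops) auto
  then have "wp m (for_upto Popped Pops pop) (\<lambda>t. ?post (t1 + Suc t)) ?s1"
    by (rule wp_mono) (use t1 best frame_trans[OF framed] in \<open>auto simp: group_time_def\<close>)
  then show "wp m (ISet Slot (\<acute>Group_Dirs *\<^sub>I \<acute>Ranks);; for_upto Popped Pops pop) (\<lambda>t. ?post (t1 + t)) s1"
    using par1 params_less by (simp add: wp_Seq wp_ISet)
qed

lemma wp_query_groups:
  assumes par: "params (ireg s)" and regs: "ireg s Handle = a" "ireg s Query_Point = q" and a: "a < n"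
    and q: "q < n"
    and fam: "tree_family (imem s) (rmem s) (root_table (imem s))" and leafs: "leaf_projs (rmem s)"
    and C: "C = cluster (imem s) a" and res: "result_ok (rmem s) C q s"
  shows "wp m (for_upto Group Groups query_group) (\<lambda>t s'. t \<le> 2 + 3 * b * (group_time + 2) \<and>
    frame {Group..Child2} {Best, Sqdist, Diff} s s' \<and> result_ok (rmem s) C q s' \<and>
    (\<forall>g<3 * b. served (rmem s) C q g (rreg s' Best))) s"
proof -
  let ?rm = "rmem s"
  define I where "I = (\<lambda>g s'. frame {Group..Child2} {Best, Sqdist, Diff} s s' \<and> ireg s' Group = g \<and>
    result_ok ?rm C q s' \<and> (\<forall>g'<g. served ?rm C q g' (rreg s' Best)))"
  have "wp m (for_upto Group Groups query_group) (\<lambda>t s'. t \<le> 2 + 3 * b * (group_time + 2) \<and> I (3 * b) s') s"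
  proof (rule wp_for_upto)
    show "I 0 (s\<lparr>ireg := (ireg s)(Group := 0)\<rparr>)"
      using res by (simp add: I_def result_ok_def frame_ireg_upd frame_refl)
    fix g s1
    assume I: "I g s1"
    then have framed: "frame {Group..Child2} {Best, Sqdist, Diff} s s1" by (simp add: I_def)
    have par1: "params (ireg s1)" by (rule frame_params[OF framed _ par]) auto
    then show "ireg s1 Group = g \<and> ireg s1 Groups = 3 * b" using I by (simp add: I_def)
    assume g: "g < 3 * b"
    have regs1: "ireg s1 Handle = a" "ireg s1 Query_Point = q" "ireg s1 Group = g"
      using frame_ireg[OF framed] regs I by (simp_all add: I_def)
    have rm1: "rmem s1 = ?rm" by (rule frame_rmem[OF framed])
    have fam1: "tree_family (imem s1) (rmem s1) (root_table (imem s1))" and C1: "C = cluster (imem s1) a"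
      using stored_trees_cong[OF frame_imem[OF framed] fam] C rm1 by auto
    have "result_ok (rmem s1) C q s1" using I rm1 by (simp add: I_def)
    note wp_group = wp_query_group[OF par1 regs1 a q g fam1 leafs[folded rm1] C1 this]
    show "wp m query_group (\<lambda>t s'. t \<le> group_time \<and> ireg s' Group = g \<and>
        I (Suc g) (s'\<lparr>ireg := (ireg s')(Group := Suc g)\<rparr>)) s1"
    proof (rule wp_mono[OF wp_group], elim conjE, intro conjI)
      fix t s2
      assume frame2: "frame {Pos..Child2} {Best, Sqdist, Diff} s1 s2" and res2: "result_ok (rmem s1) C q s2"
        and best2: "rreg s1 Best \<le> rreg s2 Best" and served2: "served (rmem s1) C q g (rreg s2 Best)"
      show "ireg s2 Group = g" using frame_ireg[OF frame2, of Group] regs1 by simp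
      have "frame {Group..Child2} {Best, Sqdist, Diff} s s2" by (rule frame_trans[OF framed frame2]) auto
      moreover have "\<forall>g'<Suc g. served ?rm C q g' (rreg s2 Best)"
        using I served_mono[OF _ best2] served2 rm1 by (auto simp: I_def less_Suc_eq)
      ultimately show "I (Suc g) (s2\<lparr>ireg := (ireg s2)(Group := Suc g)\<rparr>)"
        using res2 rm1 by (simp add: I_def result_ok_def frame_ireg_upd)
    qed
  qed (rule params_less)
  then show ?thesis by (rule wp_mono) (simp add: I_def)
qed

definition query_time :: nat where "query_time = 5 + 3 * b * (group_time + 2)"

lemma wp_query_prog:
  assumes par: "params (ireg s)" and regs: "ireg s Handle = a" "ireg s Query_Point = q" and a: "a < n"
    and q: "q < n"
    and fam: "tree_family (imem s) (rmem s) (root_table (imem s))" and leafs: "leaf_projs (rmem s)"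
    and C: "C = cluster (imem s) a" and ne: "C \<noteq> {}"
  shows "wp m query_prog (\<lambda>t s'. t \<le> query_time \<and>
      frame (insert Handle {Group..Child2}) {Best, Sqdist, Diff} s s' \<and>
    ireg s' Handle \<in> C \<and> (\<forall>g<3 * b. served (rmem s) C q g (dist2 (rmem s) (ireg s' Handle) q))) s"
proof -
  let ?post = "\<lambda>t s'. t \<le> query_time \<and> frame (insert Handle {Group..Child2}) {Best, Sqdist, Diff} s s' \<and>
    ireg s' Handle \<in> C \<and> (\<forall>g<3 * b. served (rmem s) C q g (dist2 (rmem s) (ireg s' Handle) q))"
  let ?s = "s\<lparr>ireg := (ireg s)(Result := 0), rreg := (rreg s)(Best := -1)\<rparr>"
  have framed0: "frame {Group..Child2} {Best, Sqdist, Diff} s ?s" by (simp add: frame_def regs_same_off_def)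
  have "wp m (for_upto Group Groups query_group) (\<lambda>t s'. t \<le> 2 + 3 * b * (group_time + 2) \<and>
      frame {Group..Child2} {Best, Sqdist, Diff} ?s s' \<and> result_ok (rmem ?s) C q s' \<and>
      (\<forall>g<3 * b. served (rmem ?s) C q g (rreg s' Best))) ?s"
    using par regs a q fam leafs C by (intro wp_query_groups[where a = a]) (simp_all add: result_ok_def)
  then have "wp m (for_upto Group Groups query_group;; ISet Handle \<acute>Result) (\<lambda>t. ?post (Suc (Suc t))) ?s"
  proof (rule wp_SeqI, elim conjE)
    fix t s1
    assume t: "t \<le> 2 + 3 * b * (group_time + 2)"
      and frame1: "frame {Group..Child2} {Best, Sqdist, Diff} ?s s1"
      and res: "result_ok (rmem ?s) C q s1" and served: "\<forall>g<3 * b. served (rmem ?s) C q g (rreg s1 Best)"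
    have "served (rmem s) C q 0 (rreg s1 Best)" using served b_pos by simp
    then have "0 \<le> rreg s1 Best" by (rule served_nonneg[OF _ ne])
    then have r: "ireg s1 Result \<in> C" "rreg s1 Best = dist2 (rmem s) (ireg s1 Result) q"
      using res by (auto simp: result_ok_def)
    then have "ireg s1 Result < m" using cluster_subset[OF fam] C params_less(1) by (auto intro: less_trans)
    moreover have "frame (insert Handle {Group..Child2}) {Best, Sqdist, Diff} s s1"
      by (rule frame_trans[OF framed0 frame1]) auto
    ultimately show "wp m (ISet Handle \<acute>Result) (\<lambda>t'. ?post (Suc (Suc (t + t')))) s1"
      using t r served by (simp add: wp_ISet query_time_def frame_ireg_upd)
  qed
  then show ?thesis using params_less by (simp add: query_prog_def wp_simps)
qed

end


section \<open>Linking two trees\<close>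

context projected
begin

definition link_winner :: "(nat \<Rightarrow> real) \<Rightarrow> nat \<Rightarrow> nat \<Rightarrow> nat \<Rightarrow> nat \<Rightarrow> nat" where
  "link_winner rm j x y i = (if rm (winner_addr i j x) < rm (winner_addr i j y) then y else x)"

text \<open>\<open>N\<close> counts the directions in which the two trees have already been linked.\<close>

definition linked :: "nat \<Rightarrow> nat \<Rightarrow> nat \<Rightarrow> nat \<Rightarrow> (nat \<Rightarrow> nat) \<Rightarrow> (nat \<Rightarrow> real) \<Rightarrow> (nat \<Rightarrow> nat) \<Rightarrow> (nat \<Rightarrow> real) \<Rightarrow> bool" where
  "linked N j x y im rm im' rm' \<longleftrightarrow> im' (child_addr j x) = y \<and>
     (\<forall>i<N. im' (winner_addr i (Suc j) x) = im (winner_addr i j (link_winner rm j x y i)) \<and>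
        rm' (winner_addr i (Suc j) x) = rm (winner_addr i j (link_winner rm j x y i))) \<and>
     (\<forall>k. k \<noteq> child_addr j x \<longrightarrow> (\<forall>i<N. k \<noteq> winner_addr i (Suc j) x) \<longrightarrow> im' k = im k) \<and>
     (\<forall>k. (\<forall>i<N. k \<noteq> winner_addr i (Suc j) x) \<longrightarrow> rm' k = rm k)"

lemma linkedD:
  assumes "linked N j x y im rm im' rm'"
  shows linked_child: "im' (child_addr j x) = y"
    and linked_winner: "i < N \<Longrightarrow> im' (winner_addr i (Suc j) x) =
        im (winner_addr i j (link_winner rm j x y i))"
    and linked_proj: "i < N \<Longrightarrow> rm' (winner_addr i (Suc j) x) = rm (winner_addr i j (link_winner rm j x y i))"
    and linked_imem: "k \<noteq> child_addr j x \<Longrightarrow> (\<And>i. i < N \<Longrightarrow> k \<noteq> winner_addr i (Suc j) x) \<Longrightarrow> im' k = im k"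
    and linked_rmem: "(\<And>i. i < N \<Longrightarrow> k \<noteq> winner_addr i (Suc j) x) \<Longrightarrow> rm' k = rm k"
  using assms unfolding linked_def by blast+

lemma child_addr_neq_winner_addr: "j < b \<Longrightarrow> x < n \<Longrightarrow> child_addr j x \<noteq> winner_addr i r x'"
  using child_addr_less[of j x] winners_le_winner_addr[of i r x'] region_order by linarith

lemma linked_0: "linked 0 j x y im rm (im(child_addr j x := y)) rm"
  by (simp add: linked_def)

lemma linked_Suc:
  assumes lk: "linked N j x y im rm im' rm'" and j: "Suc j < b" and x: "x < n"
    and z: "z = winner_addr N j (link_winner rm j x y N)"
  shows "linked (Suc N) j x y im rm (im'(winner_addr N (Suc j) x := im z)) (rm'(winner_addr N (Suc j) x := rm z))"
proof -
  have "winner_addr i (Suc j) x \<noteq> winner_addr N (Suc j) x" if "i \<noteq> N" for i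
    using winner_addr_eq[OF j x j x] that by simp
  moreover have "child_addr j x \<noteq> winner_addr N (Suc j) x" using j x
    by (intro child_addr_neq_winner_addr) auto
  ultimately show ?thesis
    using lk unfolding linked_def z by (auto simp: less_Suc_eq)
qed

lemma linked_winner_same_rank:
  assumes "linked N j x y im rm im' rm'" "Suc j < b" "x < n" "w < n"
  shows "im' (winner_addr i j w) = im (winner_addr i j w)"
    "rm' (winner_addr i j w) = rm (winner_addr i j w)"
proof -
  have "winner_addr i j w \<noteq> winner_addr i' (Suc j) x" for i' using assms by (subst winner_addr_eq) auto
  moreover have "winner_addr i j w \<noteq> child_addr j x" using assms child_addr_neq_winner_addr[of j x]
    by (metis Suc_lessD)
  ultimately show "im' (winner_addr i j w) = im (winner_addr i j w)"
    "rm' (winner_addr i j w) = rm (winner_addr i j w)"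
    using linked_imem[OF assms(1)] linked_rmem[OF assms(1)] by auto
qed

lemma linked_other_tree:
  assumes lk: "linked dirs j x y im rm im' rm'" and j: "Suc j < b" "x < n" and t: "tree im rm r z"
    and other: "x \<notin> points im r z \<or> r \<le> j"
  shows "tree im' rm' r z" "points im' r z = points im r z"
proof -
  have r: "r < b" using tree_rank_less t by blast
  have "tree im' rm' r z \<and> points im' r z = points im r z"
  proof (rule tree_cong[OF t])
    fix r' x' assume r': "r' < r" "x' \<in> points im r z"
    then have less: "r' < b" "x' < n" using points_subset[OF t] r by auto
    then have "child_addr r' x' \<noteq> child_addr j x" using child_addr_eq[of r' x' j x] r' j other by auto
    then show "im' (child_addr r' x') = im (child_addr r' x')"
      using child_addr_neq_winner_addr[OF less] by (intro linked_imem[OF lk]) auto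
  next
    fix i r' x' assume "i < dirs" and r': "r' \<le> r" "x' \<in> points im r z"
    then have "r' < b" "x' < n" using points_subset[OF t] r by auto
    then have "winner_addr i r' x' \<noteq> winner_addr i' (Suc j) x" for i'
      using winner_addr_eq[of r' x' "Suc j" x] r' j other by auto
    moreover have "winner_addr i r' x' \<noteq> child_addr j x" using child_addr_neq_winner_addr[of j x] j
      by (metis Suc_lessD)
    ultimately show "im' (winner_addr i r' x') = im (winner_addr i r' x') \<and>
        rm' (winner_addr i r' x') = rm (winner_addr i r' x')"
      using linked_imem[OF lk] linked_rmem[OF lk] by auto
  qed
  then show "tree im' rm' r z" "points im' r z = points im r z" by auto
qed

lemma linked_tree:
  assumes lk: "linked dirs j x y im rm im' rm'" and tx: "tree im rm j x" and ty: "tree im rm j y"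
    and disj: "points im j x \<inter> points im j y = {}"
  shows "tree im' rm' (Suc j) x" "points im' (Suc j) x = points im j x \<union> points im j y"
proof -
  have j: "Suc j < b" by (rule disjoint_trees_rank_less[OF tx ty disj])
  have x: "x < n" using tree_rep_less tx by blast
  have left: "tree im' rm' j x" "points im' j x = points im j x"
    and right: "tree im' rm' j y" "points im' j y = points im j y"
    using linked_other_tree[OF lk j x] tx ty by auto
  have child: "right_child im' j x = y" using linked_child[OF lk] by (simp add: right_child_def)
  show pts: "points im' (Suc j) x = points im j x \<union> points im j y" using left right child by simp
  have "winners_ok im' rm' (Suc j) x"
    unfolding winners_ok_def pts
  proof (intro allI impI)
    fix i assume i: "i < dirs"
    define z where "z = link_winner rm j x y i"
    have winner_le: "rm (winner_addr i j x) \<le> rm (winner_addr i j z)"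
      "rm (winner_addr i j y) \<le> rm (winner_addr i j z)"
      by (auto simp: z_def link_winner_def)
    have ok: "winners_ok im rm j x" "winners_ok im rm j y" using tree_winners_ok tx ty by auto
    have "proj i w \<le> rm (winner_addr i j z)" if "w \<in> points im j x \<union> points im j y" for w
      using that order_trans[OF _ winner_le(1)] order_trans[OF _ winner_le(2)] ok i
      by (auto simp: winners_ok_def)
    moreover have "z = x \<or> z = y" by (auto simp: z_def link_winner_def)
    then have "im (winner_addr i j z) \<in> points im j x \<union> points im j y \<and>
        rm (winner_addr i j z) = proj i (im (winner_addr i j z))"
      using ok i by (auto simp: winners_ok_def)
    ultimately have "im (winner_addr i j z) \<in> points im j x \<union> points im j y \<and>
        rm (winner_addr i j z) = proj i (im (winner_addr i j z)) \<and>
        (\<forall>w\<in>points im j x \<union> points im j y. proj i w \<le> rm (winner_addr i j z))" by blast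
    then show "im' (winner_addr i (Suc j) x) \<in> points im j x \<union> points im j y \<and>
        rm' (winner_addr i (Suc j) x) = proj i (im' (winner_addr i (Suc j) x)) \<and>
        (\<forall>w\<in>points im j x \<union> points im j y. proj i w \<le> rm' (winner_addr i (Suc j) x))"
      unfolding linked_winner[OF lk i] linked_proj[OF lk i] z_def .
  qed
  then show "tree im' rm' (Suc j) x" using left right child disj by simp
qed

lemma linked_leaf_projs:
  assumes "linked dirs j x y im rm im' rm'" "leaf_projs rm" "Suc j < b" "x < n"
  shows "leaf_projs rm'"
proof -
  have "rm' (winner_addr i 0 w) = rm (winner_addr i 0 w)" if "w < n" for i w
    by (rule linked_rmem[OF assms(1)]) (use assms that in \<open>simp add: winner_addr_eq\<close>)
  then show ?thesis using assms(2) by (simp add: leaf_projs_def)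
qed

context
  fixes im rm im' rm' T p p' j x y
  assumes fam: "tree_family im rm T" and px: "T (p, j) = Some x" and py: "T (p', j) = Some y"
    and ne: "p \<noteq> p'" and lk: "linked dirs j x y im rm im' rm'"
begin

lemma linked_rank_less: "Suc j < b"
  by (rule disjoint_trees_rank_less[OF tree_family_tree[OF fam px] tree_family_tree[OF fam py]])
    (use tree_family_disjoint[OF fam px py] ne in simp)

lemma linked_new_tree: "tree im' rm' (Suc j) x" "points im' (Suc j) x = points im j x \<union> points im j y"
  using linked_tree[OF lk tree_family_tree[OF fam px] tree_family_tree[OF fam py]]
    tree_family_disjoint[OF fam px py] ne by auto

lemma linked_old_tree:
  assumes "T (p2, k) = Some z" "(p2, k) \<notin> {(p, j), (p', j)}"
  shows "tree im' rm' k z" "points im' k z = points im k z" "points im k z \<inter> points im' (Suc j) x = {}"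
proof -
  show disj: "points im k z \<inter> points im' (Suc j) x = {}"
    using tree_family_disjoint[OF fam assms(1) px] tree_family_disjoint[OF fam assms(1) py] assms(2)
    unfolding linked_new_tree(2) by blast
  then have "x \<notin> points im k z" using rep_in_points by blast
  moreover have "x < n" using tree_rep_less tree_family_tree[OF fam px] by blast
  ultimately show "tree im' rm' k z" "points im' k z = points im k z"
    using linked_other_tree[OF lk linked_rank_less _ tree_family_tree[OF fam assms(1)]] by auto
qed

lemma linked_table_cases:
  assumes "(T((p, j) := None, (p', j) := None, (p, Suc j) \<mapsto> x)) (p2, k) = Some z"
  obtains "p2 = p" "k = Suc j" "z = x"
    | "(p2, k) \<noteq> (p, Suc j)" "T (p2, k) = Some z" "(p2, k) \<notin> {(p, j), (p', j)}"
  using assms by (auto split: if_splits)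

lemma tree_family_link: "tree_family im' rm' (T((p, j) := None, (p', j) := None, (p, Suc j) \<mapsto> x))"
    (is "tree_family _ _ ?T")
  unfolding tree_family_def
proof (intro conjI allI impI)
  fix p2 k z assume "?T (p2, k) = Some z"
  then show "tree im' rm' k z"
    by (rule linked_table_cases) (auto intro: linked_new_tree linked_old_tree simp del: tree.simps)
next
  fix p2 k z p2' k' z'
  assume first: "?T (p2, k) = Some z" and second: "?T (p2', k') = Some z'" and ne': "(p2, k) \<noteq> (p2', k')"
  show "points im' k z \<inter> points im' k' z' = {}"
  proof (rule linked_table_cases[OF first]; rule linked_table_cases[OF second])
    assume new: "p2 = p" "k = Suc j" "z = x" and old: "T (p2', k') = Some z'"
      "(p2', k') \<notin> {(p, j), (p', j)}"
    show ?thesis using linked_old_tree(3)[OF old] unfolding linked_old_tree(2)[OF old] new by blast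
  next
    assume new: "p2' = p" "k' = Suc j" "z' = x" and old: "T (p2, k) = Some z" "(p2, k) \<notin> {(p, j), (p', j)}"
    show ?thesis using linked_old_tree(3)[OF old] unfolding linked_old_tree(2)[OF old] new .
  next
    assume old: "T (p2, k) = Some z" "(p2, k) \<notin> {(p, j), (p', j)}"
      and old': "T (p2', k') = Some z'" "(p2', k') \<notin> {(p, j), (p', j)}"
    show ?thesis unfolding linked_old_tree(2)[OF old] linked_old_tree(2)[OF old']
      by (rule tree_family_disjoint[OF fam old(1) old'(1) ne'])
  qed (use ne' in auto)
qed

lemma contents_link:
  assumes "T (p, Suc j) = None" "p \<in> U \<longleftrightarrow> p' \<in> U"
  shows "contents im' (T((p, j) := None, (p', j) := None, (p, Suc j) \<mapsto> x)) U = contents im T U"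
    (is "contents _ ?T _ = _")
proof (intro set_eqI iffI)
  fix w assume "w \<in> contents im' ?T U"
  then obtain p2 k z where p2: "p2 \<in> U" "?T (p2, k) = Some z" "w \<in> points im' k z"
    by (auto simp: contents_def)
  from p2(2) show "w \<in> contents im T U"
  proof (rule linked_table_cases)
    assume "p2 = p" "k = Suc j" "z = x"
    then have "p \<in> U" "w \<in> points im j x \<union> points im j y" using p2 by (auto simp flip: linked_new_tree(2))
    then show ?thesis using px py assms(2) by (auto simp: contents_def)
  next
    assume old: "T (p2, k) = Some z" "(p2, k) \<notin> {(p, j), (p', j)}"
    then have "w \<in> points im k z" using p2(3) linked_old_tree(2) by simp
    then show ?thesis using p2(1) old(1) by (auto simp: contents_def)
  qed
next
  fix w assume "w \<in> contents im T U"
  then obtain p2 k z where p2: "p2 \<in> U" "T (p2, k) = Some z" "w \<in> points im k z"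
    by (auto simp: contents_def)
  show "w \<in> contents im' ?T U"
  proof (cases "(p2, k) \<in> {(p, j), (p', j)}")
    case True
    then have "p \<in> U" "w \<in> points im' (Suc j) x" unfolding linked_new_tree(2)
      using p2 px py assms(2) by auto
    moreover have "?T (p, Suc j) = Some x" by simp
    ultimately show ?thesis unfolding contents_def by blast
  next
    case False
    then have "?T (p2, k) = Some z" "w \<in> points im' k z"
      using p2 assms(1) linked_old_tree(2)[OF p2(2)] by auto
    then show ?thesis using p2(1) unfolding contents_def by blast
  qed
qed

end

lemma wp_link_dir:
  assumes par: "params (ireg s)" and regs: "ireg s Rank = j" "ireg s Carry = Suc x"
    "ireg s Other = Suc y" "ireg s Dir = i"
    and j: "Suc j < b" and x: "x < n" and y: "y < n" and i: "i < dirs"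
    and win: "imem s (winner_addr i j x) < n" "imem s (winner_addr i j y) < n"
    and z: "z = winner_addr i j (link_winner (rmem s) j x y i)"
  shows "wp m link_dir (\<lambda>t s'. t \<le> 6 \<and> regs_same_off {Addr1..Addr_Max} s s' \<and>
    imem s' = (imem s)(winner_addr i (Suc j) x := imem s z) \<and> rmem s' = (rmem s)(winner_addr i (Suc j) x := rmem s z)) s"
proof -
  let ?x = "winner_addr i j x" and ?y = "winner_addr i j y" and ?new = "winner_addr i (Suc j) x"
  have addr: "winners + (i * trees + (j * n + x)) = ?x" "winners + (i * trees + (j * n + y)) = ?y"
    "?x + n = ?new"
    by (simp_all add: winner_addr_def)
  have less: "?x < m" "?y < m" "?new < m" "i * trees + (j * n + x) < m" "i * trees + (j * n + y) < m"
      "i * trees < m" "j * n + x < m" "j * n + y < m" "j * n < m" "i < m" "j < m" "Suc x < m" "Suc y < m"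
    using winner_addr_less[OF i _ x, of j] winner_addr_less[OF i _ y, of j] winner_addr_less[OF i j x] j x y i params_less
    unfolding winner_addr_def by linarith+
  have win_less: "imem s ?x < m" "imem s ?y < m" using win params_less(1) by (auto intro: less_trans)
  have neq: "?x \<noteq> ?new" "?y \<noteq> ?new" using winner_addr_eq[of j _ "Suc j" x i i] j x y by auto
  show ?thesis
  proof (cases "rmem s ?x < rmem s ?y")
    case True
    then show ?thesis using par regs addr less win_less neq params_less z
      by (simp add: link_dir_def wp_simps link_winner_def regs_same_off_def)
  next
    case False
    then show ?thesis using par regs addr less win_less neq params_less z
      by (simp add: link_dir_def wp_simps link_winner_def regs_same_off_def)
  qed
qed

lemma wp_link:
  assumes par: "params (ireg s)" and regs: "ireg s Rank = j" "ireg s Carry = Suc x" "ireg s Other = Suc y"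
    and j: "Suc j < b" and x: "x < n" and y: "y < n"
    and win: "\<And>i w. i < dirs \<Longrightarrow> w \<in> {x, y} \<Longrightarrow> imem s (winner_addr i j w) < n"
  shows "wp m link (\<lambda>t s'. t \<le> 3 + dirs * 8 \<and> linked dirs j x y (imem s) (rmem s) (imem s') (rmem s') \<and>
    regs_same_off {Dir..Addr_Max} s s') s"
proof -
  define I where "I = (\<lambda>i s'. linked i j x y (imem s) (rmem s) (imem s') (rmem s') \<and>
    regs_same_off {Dir..Addr_Max} s s' \<and> ireg s' Dir = i)"
  let ?s = "s\<lparr>imem := (imem s)(child_addr j x := y)\<rparr>"
  have "wp m (for_upto Dir Dirs link_dir) (\<lambda>t s'. t \<le> 2 + dirs * (6 + 2) \<and> I dirs s') ?s"
  proof (rule wp_for_upto)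
    show "I 0 (?s\<lparr>ireg := (ireg ?s)(Dir := 0)\<rparr>)" by (simp add: I_def linked_0 regs_same_off_def)
    fix i s1
    assume I: "I i s1"
    then have same: "regs_same_off {Dir..Addr_Max} s s1" by (simp add: I_def)
    have par1: "params (ireg s1)" by (rule params_regs_same_off[OF same _ par]) auto
    then show "ireg s1 Dir = i \<and> ireg s1 Dirs = dirs" using I by (simp add: I_def)
    assume i: "i < dirs"
    have lk: "linked i j x y (imem s) (rmem s) (imem s1) (rmem s1)" using I by (simp add: I_def)
    have regs1: "ireg s1 Rank = j" "ireg s1 Carry = Suc x" "ireg s1 Other = Suc y" "ireg s1 Dir = i"
      using regs same I by (simp_all add: regs_same_off_def I_def)
    have old: "imem s1 (winner_addr i j w) = imem s (winner_addr i j w)"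
      "rmem s1 (winner_addr i j w) = rmem s (winner_addr i j w)"
      if "w \<in> {x, y}" for w using linked_winner_same_rank[OF lk j x] that x y by auto
    let ?z = "winner_addr i j (link_winner (rmem s) j x y i)"
    have "link_winner (rmem s1) j x y i = link_winner (rmem s) j x y i" using old
      by (simp add: link_winner_def)
    then have z: "?z = winner_addr i j (link_winner (rmem s1) j x y i)" by simp
    have old_z: "imem s1 ?z = imem s ?z" "rmem s1 ?z = rmem s ?z" by (rule old, simp add: link_winner_def)+
    have win1: "imem s1 (winner_addr i j x) < n" "imem s1 (winner_addr i j y) < n" using win[OF i] old
      by simp_all
    show "wp m link_dir (\<lambda>t s'. t \<le> 6 \<and> ireg s' Dir = i \<and>
        I (Suc i) (s'\<lparr>ireg := (ireg s')(Dir := Suc i)\<rparr>)) s1"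
      by (rule wp_mono[OF wp_link_dir[OF par1 regs1 j x y i win1 z]])
        (use linked_Suc[OF lk j x refl] same regs1 in \<open>auto simp: I_def regs_same_off_def old_z\<close>)
  qed (rule params_less)
  then have "wp m (for_upto Dir Dirs link_dir) (\<lambda>t s'. Suc t \<le> 3 + dirs * 8 \<and>
      linked dirs j x y (imem s) (rmem s) (imem s') (rmem s') \<and> regs_same_off {Dir..Addr_Max} s s') ?s"
    by (rule wp_mono) (auto simp: I_def)
  moreover have "child_addr j x < m" "j * n + x < m" "j * n < m" "j < m" "Suc x < m" "Suc y < m"
    using child_addr_less[of j x] tree_index_less[of j x] region_order params_less j x y by auto
  ultimately show ?thesis
    using par regs params_less by (simp add: link_def wp_simps child_addr_def)
qed

end


section \<open>Merging\<close>

context projected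
begin

definition merge_table :: "nat \<Rightarrow> state \<Rightarrow> table" where
  "merge_table j s = (root_table (imem s))((Carried, j) := decode (ireg s Carry), (Detached, j) := decode (ireg s Other))"

definition merge_places :: "nat \<Rightarrow> nat \<Rightarrow> place set" where
  "merge_places a c = {Stored a, Stored c, Carried, Detached}"

text \<open>
  The invariant of merging \<open>c\<close> into \<open>a\<close> at rank \<open>j\<close>. The roots of \<open>c\<close> of rank below \<open>l\<close> have been taken
  away, and no point has crossed the boundary between the places taking part and the others.
\<close>

definition merge_inv :: "state \<Rightarrow> nat \<Rightarrow> nat \<Rightarrow> nat \<Rightarrow> nat \<Rightarrow> state \<Rightarrow> bool" where
  "merge_inv s0 a c j l s \<longleftrightarrow> params (ireg s) \<and> ireg s Handle = a \<and> ireg s Handle2 = c \<and>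
     tree_family (imem s) (rmem s) (merge_table j s) \<and>
     (\<forall>U. merge_places a c \<subseteq> U \<or> merge_places a c \<inter> U = {} \<longrightarrow>
        contents (imem s) (merge_table j s) U = contents (imem s0) (root_table (imem s0)) U) \<and>
     (\<forall>j'<l. merge_table j s (Stored c, j') = None) \<and>
     leaf_projs (rmem s) \<and> (\<forall>k<winners. rmem s k = rmem s0 k)"

lemma merge_inv_contents:
  "merge_inv s0 a c j l s \<Longrightarrow> merge_places a c \<subseteq> U \<or> merge_places a c \<inter> U = {} \<Longrightarrow>
    contents (imem s) (merge_table j s) U = contents (imem s0) (root_table (imem s0)) U"
  unfolding merge_inv_def by blast

lemma merge_table_simps [simp]:
  "merge_table j s (Carried, j) = decode (ireg s Carry)"
  "merge_table j s (Detached, j) = decode (ireg s Other)"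
  "merge_table j s (Stored e, k) = root_table (imem s) (Stored e, k)"
  "j' \<noteq> j \<Longrightarrow> merge_table j s (Carried, j') = None"
  by (simp_all add: merge_table_def)

lemma merge_table_ireg_upd [simp]:
  "x \<notin> {Carry, Other} \<Longrightarrow> merge_table j (s\<lparr>ireg := (ireg s)(x := v)\<rparr>) = merge_table j s"
  by (simp add: merge_table_def)

lemma merge_inv_ireg_upd:
  "x \<notin> {Carry, Other, Handle, Handle2} \<union> {2..13} \<Longrightarrow>
    merge_inv s0 a c j l (s\<lparr>ireg := (ireg s)(x := v)\<rparr>) = merge_inv s0 a c j l s"
  by (simp add: merge_inv_def)

lemma merge_table_empty: "ireg s Carry = 0 \<Longrightarrow> ireg s Other = 0 \<Longrightarrow> merge_table j s = root_table (imem s)"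
  by (auto simp: merge_table_def fun_eq_iff)

lemma merge_inv_move:
  assumes inv: "merge_inv s0 a c j l s"
    and same: "regs_same_off {Carry, Other} s s'" "rmem s' = rmem s" "\<And>k. trees \<le> k \<Longrightarrow> imem s' k = imem s k"
    and p: "p \<in> merge_places a c" "p' \<in> merge_places a c" "p \<noteq> p'"
    and free: "merge_table j s (p', j) = None"
    and table': "merge_table j s' = move (merge_table j s) p p' j"
    and taken: "\<And>j'. j' < l' \<Longrightarrow> move (merge_table j s) p p' j (Stored c, j') = None"
  shows "merge_inv s0 a c j l' s'"
proof -
  let ?T = "merge_table j s" and ?T' = "merge_table j s'"
  have fam: "tree_family (imem s) (rmem s) ?T'"
    unfolding table' using inv by (intro tree_family_move p(3)) (simp add: merge_inv_def)
  have fam': "tree_family (imem s') (rmem s') ?T'"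
    unfolding same(2) by (rule tree_family_cong(1)[OF _ fam]) (rule same(3))
  have cont: "contents (imem s') ?T' U = contents (imem s) ?T' U" for U
    by (rule tree_family_cong(2)[OF _ fam]) (rule same(3))
  have "contents (imem s') ?T' U = contents (imem s0) (root_table (imem s0)) U"
    if "merge_places a c \<subseteq> U \<or> merge_places a c \<inter> U = {}" for U
  proof -
    have "p \<in> U \<longleftrightarrow> p' \<in> U" using that p(1,2) by blast
    then have "contents (imem s) ?T' U = contents (imem s) ?T U"
      unfolding table' by (rule contents_move[where T = "merge_table j s", OF free p(3)])
    then show ?thesis using cont[of U] merge_inv_contents[OF inv that] by simp
  qed
  moreover have "params (ireg s')" "ireg s' Handle = a" "ireg s' Handle2 = c"
    using params_regs_same_off[OF same(1)] same(1) inv by (auto simp: merge_inv_def regs_same_off_def)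
  ultimately show ?thesis using inv fam' taken same(2) by (simp add: merge_inv_def table')
qed

lemma merge_inv_Some_less:
  assumes "merge_inv s0 a c j l s" "merge_table j s (p, k) = Some x" shows "x < n"
proof -
  have "tree_family (imem s) (rmem s) (merge_table j s)" using assms(1) by (simp add: merge_inv_def)
  then show ?thesis using assms(2) by (rule tree_rep_less[OF tree_family_tree])
qed

lemma merge_inv_regs_le:
  assumes "merge_inv s0 a c j l s" shows "ireg s Carry \<le> n" "ireg s Other \<le> n"
proof -
  have "k \<le> n" if "merge_table j s (p, j) = decode k" for p k
    using merge_inv_Some_less[OF assms, of p j "k - 1"] that by (cases k) auto
  then show "ireg s Carry \<le> n" "ireg s Other \<le> n" using merge_table_simps(1,2) by blast+
qed

lemma merge_inv_root_le:
  assumes "merge_inv s0 a c j l s" "e < n" "j' < b" shows "imem s (root_addr e j') \<le> n"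
proof (cases "imem s (root_addr e j')")
  case (Suc x)
  then have "merge_table j s (Stored e, j') = Some x" using assms by simp
  then show ?thesis using merge_inv_Some_less[OF assms(1)] Suc by (metis Suc_leI)
qed simp

lemma wp_take_root:
  assumes inv: "merge_inv s0 a c j l s" and rank: "ireg s Rank = j" "j < b" and other: "ireg s Other = 0"
    and handle: "ireg s h = e" "h \<in> {Handle, Handle2}" "e < n"
    and taken: "\<And>j'. j' < l' \<Longrightarrow> move (merge_table j s) (Stored e) Detached j (Stored c, j') = None"
  shows "wp m (take_root h) (\<lambda>t s'. t = 2 \<and> merge_inv s0 a c j l' s' \<and> ireg s' Rank = j \<and>
    ireg s' Carry = ireg s Carry \<and> merge_table j s' (Stored e, j) = None) s"
proof -
  let ?k = "root_addr e j"
  let ?s = "s\<lparr>ireg := (ireg s)(Other := imem s ?k), imem := (imem s)(?k := 0)\<rparr>"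
  have k: "?k < trees" using handle(3) rank(2) by (rule root_addr_less)
  have "e * b \<le> ?k" "j \<le> ?k" by (simp_all add: root_addr_def)
  then have less: "?k < m" "e * b < m" "j < m" "e < m" "imem s ?k < m" "0 < m"
    using k handle(3) params_less merge_inv_root_le[OF inv handle(3) rank(2)] by linarith+
  have "e \<in> {a, c}" using handle inv by (auto simp: merge_inv_def)
  then have place: "Stored e \<in> merge_places a c" by (auto simp: merge_places_def)
  have table': "merge_table j ?s = move (merge_table j s) (Stored e) Detached j"
    using handle(3) rank(2) by (auto simp: merge_table_def move_def root_table_upd fun_eq_iff)
  have "merge_inv s0 a c j l' ?s"
    by (rule merge_inv_move[OF inv _ _ _ place _ _ _ table' taken])
      (use k other in \<open>auto simp: regs_same_off_def merge_places_def\<close>)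
  moreover have "merge_table j ?s (Stored e, j) = None" unfolding table' by (simp add: move_def)
  moreover have "params (ireg s)" using inv by (simp add: merge_inv_def)
  moreover have "h \<noteq> Other" using handle(2) by auto
  ultimately show ?thesis
    using handle(1) rank less params_less(3) by (simp add: take_root_def wp_simps root_addr_def)
qed

lemma merge_inv_shift_carry:
  assumes inv: "merge_inv s0 a c j l s" and carry: "ireg s Carry = 0"
  shows "merge_inv s0 a c j l (s\<lparr>ireg := (ireg s)(Carry := ireg s Other, Other := 0)\<rparr>)"
proof (rule merge_inv_move[OF inv, where p = Detached and p' = Carried])
  show "move (merge_table j s) Detached Carried j (Stored c, j') = None" if "j' < l" for j'
    using inv that by (simp add: merge_inv_def move_def)
qed (auto simp: regs_same_off_def merge_places_def carry merge_table_def move_def fun_eq_iff)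

lemma merge_inv_store_carry:
  assumes inv: "merge_inv s0 a c j l s" and other: "ireg s Other = 0" and j: "j < b" and ac: "a < n" "a \<noteq> c"
    and free: "merge_table j s (Stored a, j) = None"
  shows "merge_inv s0 a c j l (s\<lparr>imem := (imem s)(root_addr a j := ireg s Carry), ireg := (ireg s)(Carry := 0)\<rparr>)"
proof (rule merge_inv_move[OF inv, where p = Carried and p' = "Stored a"])
  show "move (merge_table j s) Carried (Stored a) j (Stored c, j') = None" if "j' < l" for j'
    using inv that ac by (simp add: merge_inv_def move_def)
  show "merge_table j (s\<lparr>imem := (imem s)(root_addr a j := ireg s Carry), ireg := (ireg s)(Carry := 0)\<rparr>) =
      move (merge_table j s) Carried (Stored a) j"
    using ac j by (auto simp: merge_table_def move_def root_table_upd fun_eq_iff)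
qed (use free root_addr_less[OF ac(1) j] in \<open>auto simp: regs_same_off_def merge_places_def\<close>)

lemma merge_inv_next_rank:
  assumes "merge_inv s0 a c j l s" "ireg s Carry = 0" "ireg s Other = 0"
  shows "merge_inv s0 a c (Suc j) l s"
  using assms by (simp add: merge_inv_def merge_table_empty)

lemma merge_inv_link:
  assumes inv: "merge_inv s0 a c j l s" and regs: "ireg s Carry = Suc x" "ireg s Other = Suc y"
    and j: "j < b"
    and lk: "linked dirs j x y (imem s) (rmem s) (imem s') (rmem s')"
    and same: "regs_same_off {Dir..Addr_Max} s s'"
  shows "merge_inv s0 a c (Suc j) l (s'\<lparr>ireg := (ireg s')(Other := 0)\<rparr>)"
proof -
  let ?T = "merge_table j s" and ?s = "s'\<lparr>ireg := (ireg s')(Other := 0)\<rparr>"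
  let ?T' = "?T((Carried, j) := None, (Detached, j) := None, (Carried, Suc j) \<mapsto> x)"
  have fam: "tree_family (imem s) (rmem s) ?T" using inv by (simp add: merge_inv_def)
  have px: "?T (Carried, j) = Some x" and py: "?T (Detached, j) = Some y" using regs by auto
  note link = fam px py _ lk
  have x: "x < n" using tree_rep_less tree_family_tree[OF fam px] by blast
  have Suc_j: "Suc j < b" by (rule linked_rank_less[OF link]) simp
  have "imem s' k = imem s k" if "k < trees" for k
    using that trees_le_child_addr[of j x] winners_le_winner_addr region_order
    by (intro linked_imem[OF lk]) (metis leD, metis leD order_trans)
  then have roots: "root_table (imem s') = root_table (imem s)" by (rule root_table_cong)
  have T': "merge_table (Suc j) ?s = ?T'"
    using same regs by (auto simp: merge_table_def roots fun_eq_iff regs_same_off_def)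
  have "contents (imem s') ?T' U = contents (imem s0) (root_table (imem s0)) U"
    if "merge_places a c \<subseteq> U \<or> merge_places a c \<inter> U = {}" for U
  proof -
    have "contents (imem s') ?T' U = contents (imem s) ?T U"
      using that by (intro contents_link[OF link]) (auto simp: merge_places_def)
    then show ?thesis using merge_inv_contents[OF inv that] by simp
  qed
  moreover have "tree_family (imem s') (rmem s') ?T'" by (rule tree_family_link[OF link]) simp
  moreover have "leaf_projs (rmem s')" using linked_leaf_projs[OF lk _ Suc_j x] inv
    by (simp add: merge_inv_def)
  moreover have "rmem s' k = rmem s k" if "k < winners" for k
    using that winners_le_winner_addr by (intro linked_rmem[OF lk]) (metis leD)
  moreover have "params (ireg s')" "ireg s' Handle = a" "ireg s' Handle2 = c"
    using params_regs_same_off[OF same] same inv by (auto simp: merge_inv_def regs_same_off_def)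
  ultimately show ?thesis using inv unfolding merge_inv_def T' by (simp add: roots)
qed

lemma wp_merge_link:
  assumes inv: "merge_inv s0 a c j l s" and rank: "ireg s Rank = j" "j < b"
    and regs: "ireg s Carry \<noteq> 0" "ireg s Other \<noteq> 0"
  shows "wp m (link;; ISet Other (IConst 0)) (\<lambda>t s'. t \<le> 4 + dirs * 8 \<and> merge_inv s0 a c (Suc j) l s' \<and>
    ireg s' Rank = j \<and> ireg s' Other = 0) s"
proof -
  obtain x y where xy: "ireg s Carry = Suc x" "ireg s Other = Suc y" using regs by (meson not0_implies_Suc)
  have fam: "tree_family (imem s) (rmem s) (merge_table j s)" using inv by (simp add: merge_inv_def)
  have px: "merge_table j s (Carried, j) = Some x" and py: "merge_table j s (Detached, j) = Some y"
    using xy by auto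
  have tx: "tree (imem s) (rmem s) j x" and ty: "tree (imem s) (rmem s) j y"
    using tree_family_tree[OF fam px] tree_family_tree[OF fam py] by auto
  have Suc_j: "Suc j < b"
    using disjoint_trees_rank_less[OF tx ty] tree_family_disjoint[OF fam px py] by simp
  have win: "imem s (winner_addr i j w) < n" if "i < dirs" "w \<in> {x, y}" for i w
    using that winner_less tx ty by blast
  have par: "params (ireg s)" using inv by (simp add: merge_inv_def)
  show ?thesis
  proof (rule wp_SeqI[OF wp_link[OF par rank(1) xy Suc_j tree_rep_less[OF tx] tree_rep_less[OF ty] win]],
      assumption+, elim conjE)
    fix t s'
    assume t: "t \<le> 3 + dirs * 8" and lk: "linked dirs j x y (imem s) (rmem s) (imem s') (rmem s')"
      and same: "regs_same_off {Dir..Addr_Max} s s'"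
    have "ireg s' Rank = j" using same rank by (simp add: regs_same_off_def)
    then show "wp m (ISet Other (IConst 0)) (\<lambda>t' s'. t + t' \<le> 4 + dirs * 8 \<and> merge_inv s0 a c (Suc j) l s' \<and>
        ireg s' Rank = j \<and> ireg s' Other = 0) s'"
      using t merge_inv_link[OF inv xy rank(2) lk same] params_less by (simp add: wp_ISet)
  qed
qed

lemma wp_fill_carry:
  assumes inv: "merge_inv s0 a c j l s"
  shows "wp m fill_carry (\<lambda>t s'. t \<le> 3 \<and> merge_inv s0 a c j l s' \<and> ireg s' Rank = ireg s Rank \<and>
    (ireg s' Carry = 0 \<longrightarrow> ireg s' Other = 0)) s"
  using merge_inv_shift_carry[OF inv] merge_inv_regs_le[OF inv] inv params_less(1,14)
  by (auto simp: fill_carry_def wp_simps)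

lemma wp_settle_carry:
  assumes inv: "merge_inv s0 a c j (Suc j) s" and rank: "ireg s Rank = j" "j < b"
    and carry: "ireg s Carry \<noteq> 0"
    and ac: "a < n" "a \<noteq> c"
  shows "wp m settle_carry (\<lambda>t s'. t \<le> 8 + dirs * 8 \<and> merge_inv s0 a c (Suc j) (Suc j) s' \<and>
    ireg s' Rank = j \<and> ireg s' Other = 0) s"
  unfolding settle_carry_def
proof (rule wp_SeqI[where P = "\<lambda>t s'. t \<le> 3 \<and> merge_inv s0 a c j (Suc j) s' \<and> ireg s' Rank = j \<and>
    ireg s' Carry \<noteq> 0 \<and> (ireg s' Other = 0 \<longrightarrow> merge_table j s' (Stored a, j) = None)"], goal_cases)
  case 1
  have regs: "ireg s Handle = a" "params (ireg s)" using inv by (auto simp: merge_inv_def)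
  have "move (merge_table j s) (Stored a) Detached j (Stored c, j') = None" if "j' < Suc j" for j'
    using inv that ac by (simp add: merge_inv_def move_def)
  then have "wp m (take_root Handle) (\<lambda>t s'. t = 2 \<and> merge_inv s0 a c j (Suc j) s' \<and> ireg s' Rank = j \<and>
      ireg s' Carry = ireg s Carry \<and> merge_table j s' (Stored a, j) = None) s" if "ireg s Other = 0"
    using inv rank that regs ac by (intro wp_take_root) auto
  then show ?case using inv rank carry merge_inv_regs_le[OF inv] params_less(1,14)
    by (auto simp: wp_Cond wp_Skip elim!: wp_mono)
next
  case (2 t s1)
  then have inv1: "merge_inv s0 a c j (Suc j) s1" and regs: "ireg s1 Rank = j" "ireg s1 Carry \<noteq> 0"
    and free: "ireg s1 Other = 0 \<Longrightarrow> merge_table j s1 (Stored a, j) = None" and t: "t \<le> 3" by auto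
  have par: "params (ireg s1)" and a1: "ireg s1 Handle = a" using inv1 by (auto simp: merge_inv_def)
  have less: "ireg s1 Carry < m" "ireg s1 Other < m" "root_addr a j < m" "a * b < m" "j < m" "a < m"
    using merge_inv_regs_le[OF inv1] root_addr_less[OF ac(1) rank(2)] params_less ac(1) rank(2)
    unfolding root_addr_def by linarith+
  show ?case
  proof (cases "ireg s1 Other = 0")
    case True
    have "merge_inv s0 a c (Suc j) (Suc j)
        (s1\<lparr>imem := (imem s1)(root_addr a j := ireg s1 Carry), ireg := (ireg s1)(Carry := 0)\<rparr>)"
      by (rule merge_inv_next_rank, rule merge_inv_store_carry[OF inv1 True rank(2) ac free[OF True]])
        (use True in auto)
    then show ?thesis using True regs par a1 less params_less t by (simp add: wp_simps root_addr_def)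
  next
    case False
    have "wp m (link;; ISet Other (IConst 0)) (\<lambda>t' s'. t + Suc t' \<le> 8 + dirs * 8 \<and>
        merge_inv s0 a c (Suc j) (Suc j) s' \<and> ireg s' Rank = j \<and> ireg s' Other = 0) s1"
      by (rule wp_mono[OF wp_merge_link[OF inv1 regs(1) rank(2) regs(2) False]]) (use t in auto)
    then show ?thesis using False less params_less by (simp add: wp_Cond)
  qed
qed

lemma wp_merge_rank:
  assumes inv: "merge_inv s0 a c j j s" and regs: "ireg s Rank = j" "ireg s Other = 0"
    and j: "j < b" and ac: "a < n" "c < n" "a \<noteq> c"
  shows "wp m merge_rank (\<lambda>t s'. t \<le> 14 + dirs * 8 \<and> merge_inv s0 a c (Suc j) (Suc j) s' \<and>
    ireg s' Rank = j \<and> ireg s' Other = 0) s"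
  unfolding merge_rank_def
proof (rule wp_SeqI)
  have "move (merge_table j s) (Stored c) Detached j (Stored c, j') = None" if "j' < Suc j" for j'
    using inv that by (auto simp: merge_inv_def move_def less_Suc_eq)
  moreover have "ireg s Handle2 = c" using inv by (simp add: merge_inv_def)
  ultimately show "wp m (take_root Handle2) (\<lambda>t s'. t = 2 \<and> merge_inv s0 a c j (Suc j) s' \<and>
      ireg s' Rank = j \<and>
      ireg s' Carry = ireg s Carry \<and> merge_table j s' (Stored c, j) = None) s"
    using inv regs j ac by (intro wp_take_root) auto
  fix t1 :: nat and s1
  assume taken: "t1 = 2 \<and> merge_inv s0 a c j (Suc j) s1 \<and> ireg s1 Rank = j \<and>
      ireg s1 Carry = ireg s Carry \<and> merge_table j s1 (Stored c, j) = None"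
  then have inv1: "merge_inv s0 a c j (Suc j) s1" by simp
  show "wp m (fill_carry;; Cond (\<acute>Carry =\<^sub>I IConst 0) Skip settle_carry)
    (\<lambda>t s'. t1 + t \<le> 14 + dirs * 8 \<and> merge_inv s0 a c (Suc j) (Suc j) s' \<and> ireg s' Rank = j \<and> ireg s' Other = 0) s1"
  proof (rule wp_SeqI[OF wp_fill_carry[OF inv1]], elim conjE)
    fix t2 :: nat and s2
    assume t2: "t2 \<le> 3" and inv2: "merge_inv s0 a c j (Suc j) s2" and rank2: "ireg s2 Rank = ireg s1 Rank"
      and empty: "ireg s2 Carry = 0 \<longrightarrow> ireg s2 Other = 0"
    have "ireg s2 Carry < m" "0 < m" using merge_inv_regs_le[OF inv2] params_less(1) by auto
    moreover have "wp m settle_carry (\<lambda>t s'. t1 + (t2 + Suc t) \<le> 14 + dirs * 8 \<and>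
        merge_inv s0 a c (Suc j) (Suc j) s' \<and> ireg s' Rank = j \<and> ireg s' Other = 0) s2" if "ireg s2 Carry \<noteq> 0"
      by (rule wp_mono[OF wp_settle_carry[OF inv2 _ j that ac(1,3)]]) (use taken t2 rank2 in auto)
    ultimately show "wp m (Cond (\<acute>Carry =\<^sub>I IConst 0) Skip settle_carry)
      (\<lambda>t s'. t1 + (t2 + t) \<le> 14 + dirs * 8 \<and> merge_inv s0 a c (Suc j) (Suc j) s' \<and> ireg s' Rank = j \<and>
        ireg s' Other = 0) s2"
      using merge_inv_next_rank[OF inv2] empty taken t2 rank2 by (auto simp: wp_Cond wp_Skip)
  qed
qed

lemma merge_inv_final:
  assumes inv: "merge_inv s0 a c b b s" and other: "ireg s Other = 0"
  shows "tree_family (imem s) (rmem s) (root_table (imem s))"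
    and "cluster (imem s) a = cluster (imem s0) a \<union> cluster (imem s0) c"
    and "e \<noteq> a \<Longrightarrow> e \<noteq> c \<Longrightarrow> cluster (imem s) e = cluster (imem s0) e"
proof -
  have fam: "tree_family (imem s) (rmem s) (merge_table b s)" using inv by (simp add: merge_inv_def)
  have "decode (ireg s Carry) \<noteq> Some x" for x
    using tree_rank_less[OF tree_family_tree[OF fam, of Carried b x]] by auto
  then have "ireg s Carry = 0" by (cases "ireg s Carry") auto
  then have table: "merge_table b s = root_table (imem s)" using other by (rule merge_table_empty)
  show "tree_family (imem s) (rmem s) (root_table (imem s))" using fam by (simp only: table)
  note cont = merge_inv_contents[OF inv, unfolded table]
  have "root_table (imem s) (Stored c, j) = None" for j
  proof (cases "j < b")
    case True
    then show ?thesis using inv by (simp add: merge_inv_def)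
  qed (auto simp: root_table_def)
  then have "contents (imem s) (root_table (imem s)) (merge_places a c) = cluster (imem s) a"
    by (auto simp: contents_def cluster_def merge_places_def)
  moreover have "contents (imem s0) (root_table (imem s0)) (merge_places a c) =
      cluster (imem s0) a \<union> cluster (imem s0) c"
    by (auto simp: contents_def cluster_def merge_places_def)
  ultimately show "cluster (imem s) a = cluster (imem s0) a \<union> cluster (imem s0) c"
    using cont[of "merge_places a c"] by simp
  show "cluster (imem s) e = cluster (imem s0) e" if "e \<noteq> a" "e \<noteq> c"
    unfolding cluster_def using that by (intro cont) (auto simp: merge_places_def)
qed

definition merge_time :: nat where "merge_time = 4 + b * (16 + dirs * 8)"

lemma wp_merge_prog:
  assumes par: "params (ireg s)" and regs: "ireg s Handle = a" "ireg s Handle2 = c"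
    and ac: "a < n" "c < n" "a \<noteq> c"
    and fam: "tree_family (imem s) (rmem s) (root_table (imem s))" and leafs: "leaf_projs (rmem s)"
  shows "wp m merge_prog (\<lambda>t s'. t \<le> merge_time \<and> params (ireg s') \<and> ireg s' Handle = a \<and>
    tree_family (imem s') (rmem s') (root_table (imem s')) \<and> leaf_projs (rmem s') \<and>
    cluster (imem s') a = cluster (imem s) a \<union> cluster (imem s) c \<and>
    (\<forall>e. e \<noteq> a \<longrightarrow> e \<noteq> c \<longrightarrow> cluster (imem s') e = cluster (imem s) e) \<and>
    (\<forall>k<winners. rmem s' k = rmem s k)) s"
proof -
  let ?s = "s\<lparr>ireg := (ireg s)(Carry := 0, Other := 0)\<rparr>"
  define I where "I = (\<lambda>j s'. merge_inv s a c j j s' \<and> ireg s' Rank = j \<and> ireg s' Other = 0)"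
  have "wp m (for_upto Rank Ranks merge_rank) (\<lambda>t s'. t \<le> 2 + b * (14 + dirs * 8 + 2) \<and> I b s') ?s"
  proof (rule wp_for_upto)
    have "merge_inv s a c 0 0 ?s"
      using par regs fam leafs by (simp add: merge_inv_def merge_table_empty)
    then show "I 0 (?s\<lparr>ireg := (ireg ?s)(Rank := 0)\<rparr>)" using merge_inv_ireg_upd[of Rank s a c 0 0 ?s 0]
      by (simp add: I_def)
    show "ireg s' Rank = j \<and> ireg s' Ranks = b" if "I j s'" for j s'
      using that by (auto simp: I_def merge_inv_def)
    show "wp m merge_rank (\<lambda>t s''. t \<le> 14 + dirs * 8 \<and> ireg s'' Rank = j \<and>
        I (Suc j) (s''\<lparr>ireg := (ireg s'')(Rank := Suc j)\<rparr>)) s'" if "j < b" "I j s'" for j s'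
      using that ac by (intro wp_mono[OF wp_merge_rank[of s a c j s']])
        (auto simp: I_def merge_inv_ireg_upd)
  qed (rule params_less)
  then have "wp m (for_upto Rank Ranks merge_rank) (\<lambda>t s'. Suc (Suc t) \<le> merge_time \<and> I b s') ?s"
    by (rule wp_mono) (simp add: merge_time_def)
  moreover have "params (ireg s') \<and> ireg s' Handle = a \<and>
    tree_family (imem s') (rmem s') (root_table (imem s')) \<and> leaf_projs (rmem s') \<and>
    cluster (imem s') a = cluster (imem s) a \<union> cluster (imem s) c \<and>
    (\<forall>e. e \<noteq> a \<longrightarrow> e \<noteq> c \<longrightarrow> cluster (imem s') e = cluster (imem s) e) \<and>
    (\<forall>k<winners. rmem s' k = rmem s k)" if "I b s'" for s'
    using merge_inv_final[of s a c s'] that by (auto simp: I_def merge_inv_def)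
  ultimately show ?thesis using params_less by (auto simp: merge_prog_def wp_simps elim!: wp_mono)
qed

end


section \<open>Initialization\<close>

definition same_data :: "state \<Rightarrow> state \<Rightarrow> bool" where
  "same_data s s' \<longleftrightarrow> imem s' = imem s \<and> rmem s' = rmem s \<and> rreg s' = rreg s \<and> coins s' = coins s \<and>
      used s' = used s"

context machine
begin

lemma two_power_less:
  assumes "k \<le> b" shows "2 ^ k < m"
proof -
  have "(2::nat) ^ k \<le> 2 ^ b" using assms by (intro power_increasing) auto
  then show ?thesis using memory by linarith
qed

lemma wp_init_ranks:
  assumes "ireg s Points = n"
  shows "wp m init_ranks (\<lambda>t s'. t \<le> 3 + b * 3 \<and> same_data s s' \<and> regs_same_off {Ranks, Count} s s' \<and>
      ireg s' Ranks = b) s"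
proof -
  define I where "I = (\<lambda>k (s' :: state). same_data s s' \<and> regs_same_off {Ranks, Count} s s' \<and>
      ireg s' Ranks = k \<and> ireg s' Count = 2 ^ k)"
  let ?s = "s\<lparr>ireg := (ireg s)(Ranks := 0, Count := 1)\<rparr>"
  have "wp m (While (BNot (\<acute>Points <\<^sub>I \<acute>Count)) (ISet Count (\<acute>Count *\<^sub>I IConst 2);; incr Ranks))
    (\<lambda>t s'. t \<le> 1 + b * (2 + 1) \<and> I b s') ?s"
  proof (rule wp_while_count)
    show "I 0 ?s" by (simp add: I_def same_data_def regs_same_off_def)
    show "bok m s1 (BNot (\<acute>Points <\<^sub>I \<acute>Count)) \<and> bval s1 (BNot (\<acute>Points <\<^sub>I \<acute>Count)) \<and>
      wp m (ISet Count (\<acute>Count *\<^sub>I IConst 2);; incr Ranks) (\<lambda>t s'. t \<le> 2 \<and> I (Suc k) s') s1"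
      if "k < b" "I k s1" for k s1
    proof -
      have "(2::nat) ^ k \<le> 2 ^ (b - 1)" using that(1) by (intro power_increasing) auto
      then have "2 ^ k \<le> n" using n_lower by (rule order_trans)
      then show ?thesis using that assms two_power_less[of k] two_power_less[of "Suc k"] params_less
        by (auto simp: I_def wp_simps wp_incr same_data_def regs_same_off_def mult.commute)
    qed
    show "bok m s1 (BNot (\<acute>Points <\<^sub>I \<acute>Count)) \<and> \<not> bval s1 (BNot (\<acute>Points <\<^sub>I \<acute>Count))" if "I b s1" for s1
      using that assms n_upper two_power_less[of b] params_less(1) by (simp add: I_def regs_same_off_def)
  qed
  then show ?thesis using params_less(14) by (auto simp: init_ranks_def wp_simps I_def elim!: wp_mono)
qed

lemma wp_init_layout:
  assumes "ireg s Points = n" "ireg s Dim = d" "ireg s Ranks = b" "ireg s Scale = W"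
  shows "wp m init_layout (\<lambda>t s'. t = 8 \<and> same_data s s' \<and> params (ireg s')) s"
proof -
  have eqs: "64 * (b * W) = group_dirs" "b * n = trees" "2 * trees + n * d = winners"
    "3 * b * group_dirs = dirs"
      "winners + dirs * trees = queue" "5 * (group_dirs * b) = slots" "4 * (group_dirs * b) = pops"
    by (simp_all add: group_dirs_def trees_def winners_def dirs_def queue_def slots_def pops_def mult.assoc)
  have "b * W \<le> group_dirs" "n * d \<le> winners" "2 * trees \<le> winners" by (simp_all flip: eqs(1,3))
  then have less: "b * W < m" "W < m" "n * d < m" "2 * trees < m" "64 < m" "2 < m" "3 < m" "4 < m" "5 < m"
    using params_less(5,7,14) two_power_less[OF order_refl] W_upper by linarith+
  have "params ((ireg s)(Group_Dirs := group_dirs, Groups := 3 * b, Trees := trees, Winners := winners,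
      Dirs := dirs, Queue := queue, Slots := slots, Pops := pops))"
    unfolding params_def using assms by simp
  then show ?thesis
    using assms less params_less eqs
    unfolding init_layout_def by (simp add: wp_Seq wp_ISet same_data_def)
qed

lemma wp_init_roots:
  assumes par: "params (ireg s)"
  shows "wp m init_roots (\<lambda>t s'. t \<le> 2 + n * 3 \<and> params (ireg s') \<and> rmem s' = rmem s \<and> coins s' = coins s \<and>
    used s' = used s \<and> imem s' = override_on (imem s) (\<lambda>k. Suc (k div b)) ((\<lambda>a. root_addr a 0) ` {..<n})) s"
proof -
  define I where "I = (\<lambda>a (s' :: state). params (ireg s') \<and> rmem s' = rmem s \<and> coins s' = coins s \<and>
      used s' = used s \<and>
    ireg s' Point = a \<and> imem s' = override_on (imem s) (\<lambda>k. Suc (k div b)) ((\<lambda>a. root_addr a 0) ` {..<a}))"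
  have "wp m (for_upto Point Points (IStore (\<acute>Point *\<^sub>I \<acute>Ranks) (\<acute>Point +\<^sub>I IConst 1)))
    (\<lambda>t s'. t \<le> 2 + n * (1 + 2) \<and> I n s') s"
  proof (rule wp_for_upto)
    show "I 0 (s\<lparr>ireg := (ireg s)(Point := 0)\<rparr>)" using par by (simp add: I_def)
    show "wp m (IStore (\<acute>Point *\<^sub>I \<acute>Ranks) (\<acute>Point +\<^sub>I IConst 1))
        (\<lambda>t s'. t \<le> 1 \<and> ireg s' Point = a \<and> I (Suc a) (s'\<lparr>ireg := (ireg s')(Point := Suc a)\<rparr>)) s1"
      if "a < n" "I a s1" for a s1
      using that root_addr_less[of a 0] b_pos params_less
      by (auto simp: I_def wp_simps root_addr_def lessThan_Suc override_on_insert)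
  qed (auto simp: I_def params_less)
  then show ?thesis unfolding init_roots_def by (rule wp_mono) (auto simp: I_def)
qed

definition row :: "nat \<Rightarrow> nat set" where
  "row i = winner_addr i 0 ` {..<n}"

lemma winner_addr_0: "winner_addr i 0 x = winners + i * trees + x"
  by (simp add: winner_addr_def)

lemma coord_notin_row: "x < n \<Longrightarrow> j < d \<Longrightarrow> x * d + j \<notin> row i"
  using coord_index_less[of x j] region_order(3) by (auto simp: row_def winner_addr_0)

lemma wp_init_winners:
  assumes par: "params (ireg s)" and r: "ireg s Row = winners + i * trees" and i: "i < dirs"
  shows "wp m init_winners (\<lambda>t s'. t \<le> 2 + n * 3 \<and> regs_same_off {Point} s s' \<and> rmem s' = rmem s \<and>
    coins s' = coins s \<and> used s' = used s \<and>
    imem s' = override_on (imem s) (\<lambda>k. k - winner_addr i 0 0) (row i)) s"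
proof -
  define I where "I = (\<lambda>x (s' :: state). regs_same_off {Point} s s' \<and> rmem s' = rmem s \<and>
      coins s' = coins s \<and> used s' = used s \<and>
    ireg s' Point = x \<and> imem s' = override_on (imem s) (\<lambda>k. k - winner_addr i 0 0) (winner_addr i 0 ` {..<x}))"
  have params1: "params (ireg s1)" if "I x s1" for x s1
    by (rule params_regs_same_off[OF _ _ par]) (use that in \<open>auto simp: I_def\<close>)
  have "wp m (for_upto Point Points (IStore (\<acute>Row +\<^sub>I \<acute>Point) \<acute>Point)) (\<lambda>t s'. t \<le> 2 + n * (1 + 2) \<and>
      I n s') s"
  proof (rule wp_for_upto)
    show "I 0 (s\<lparr>ireg := (ireg s)(Point := 0)\<rparr>)" by (simp add: I_def regs_same_off_def)
    show "ireg s1 Point = x \<and> ireg s1 Points = n" if "I x s1" for x s1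
      using that params1[OF that] by (simp add: I_def)
    show "wp m (IStore (\<acute>Row +\<^sub>I \<acute>Point) \<acute>Point)
        (\<lambda>t s'. t \<le> 1 \<and> ireg s' Point = x \<and> I (Suc x) (s'\<lparr>ireg := (ireg s')(Point := Suc x)\<rparr>)) s1"
      if "x < n" "I x s1" for x s1
    proof -
      have "ireg s1 Row = winners + i * trees" using that(2) r by (simp add: I_def regs_same_off_def)
      then show ?thesis
        using that winner_addr_less[OF i b_pos that(1)] params_less
        by (auto simp: I_def wp_simps regs_same_off_def winner_addr_0 lessThan_Suc override_on_insert)
    qed
  qed (rule params_less)
  then show ?thesis unfolding init_winners_def by (rule wp_mono) (auto simp: I_def row_def)
qed

lemma wp_add_coordinate:
  assumes par: "params (ireg s)" and r: "ireg s Row = winners + i * trees" "ireg s Coord = j"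
    and i: "i < dirs" and j: "j < d"
  shows "wp m add_coordinate (\<lambda>t s'. t \<le> 3 + n * 3 \<and> regs_same_off {Point} s s' \<and> imem s' = imem s \<and>
    coins s' = coins s \<and> used s' = Suc (used s) \<and>
    rmem s' = override_on (rmem s) (\<lambda>k. rmem s k + coins s (used s) * rmem s ((k - winner_addr i 0 0) * d + j)) (row i)) s"
proof -
  let ?g = "coins s (used s)"
  let ?f = "\<lambda>k. rmem s k + ?g * rmem s ((k - winner_addr i 0 0) * d + j)"
  let ?s = "s\<lparr>rreg := (rreg s)(Gauss := ?g), used := Suc (used s)\<rparr>"
  let ?body = "RStore (\<acute>Row +\<^sub>I \<acute>Point)
          (RAdd (RLoad (\<acute>Row +\<^sub>I \<acute>Point)) (RMul (RReg Gauss) (RLoad (\<acute>Point *\<^sub>I \<acute>Dim +\<^sub>I \<acute>Coord))))"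
  define I where "I = (\<lambda>x (s' :: state). regs_same_off {Point} s s' \<and> imem s' = imem s \<and>
      coins s' = coins s \<and> used s' = Suc (used s) \<and>
    rreg s' Gauss = ?g \<and> ireg s' Point = x \<and> rmem s' = override_on (rmem s) ?f (winner_addr i 0 ` {..<x}))"
  have params1: "params (ireg s1)" if "I x s1" for x s1
    by (rule params_regs_same_off[OF _ _ par]) (use that in \<open>auto simp: I_def\<close>)
  have "wp m (for_upto Point Points ?body) (\<lambda>t s'. t \<le> 2 + n * (1 + 2) \<and> I n s') ?s"
  proof (rule wp_for_upto)
    show "I 0 (?s\<lparr>ireg := (ireg ?s)(Point := 0)\<rparr>)" by (simp add: I_def regs_same_off_def)
    show "ireg s1 Point = x \<and> ireg s1 Points = n" if "I x s1" for x s1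
      using that params1[OF that] by (simp add: I_def)
    show "wp m ?body (\<lambda>t s'. t \<le> 1 \<and> ireg s' Point = x \<and>
        I (Suc x) (s'\<lparr>ireg := (ireg s')(Point := Suc x)\<rparr>)) s1"
      if x: "x < n" and I: "I x s1" for x s1
    proof -
      have regs1: "ireg s1 Row = winners + i * trees" "ireg s1 Coord = j" "ireg s1 Point = x"
        using I r by (auto simp: I_def regs_same_off_def)
      have coord: "x * d + j < winners" using coord_index_less[OF x j] region_order(3) by linarith
      have less: "winners + i * trees + x < m" "x * d + j < m" "x < m" "j < m" "i * trees < m"
        using winner_addr_less[OF i b_pos x] coord x j params_less unfolding winner_addr_0 by linarith+
      have "x * d + j \<notin> winner_addr i 0 ` {..<x}" "winner_addr i 0 x \<notin> winner_addr i 0 ` {..<x}"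
        using coord by (auto simp: winner_addr_0)
      then have "rmem s1 (x * d + j) = rmem s (x * d + j)"
        "rmem s1 (winner_addr i 0 x) = rmem s (winner_addr i 0 x)"
        using I by (simp_all add: I_def)
      then show ?thesis
        using I regs1 params1[OF I] less params_less
        by (auto simp: I_def wp_simps regs_same_off_def winner_addr_0 lessThan_Suc override_on_insert)
    qed
  qed (rule params_less)
  then show ?thesis
    unfolding add_coordinate_def wp_Seq wp_Sample by (rule wp_mono) (auto simp: I_def row_def)
qed

definition row_time :: nat where "row_time = 5 + n * 3 + d * (5 + n * 3)"

text \<open>The direction is drawn from position \<open>u\<close> of the coins on; only its first \<open>j\<close> coordinates count.\<close>

definition drawn_proj :: "(nat \<Rightarrow> real) \<Rightarrow> (nat \<Rightarrow> real) \<Rightarrow> nat \<Rightarrow> nat \<Rightarrow> nat \<Rightarrow> real" where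
  "drawn_proj \<omega> rm u j x = (\<Sum>j'<j. \<omega> (u + j') * rm (x * d + j'))"

lemma wp_add_coordinates:
  assumes par: "params (ireg s)" and r: "ireg s Row = winners + i * trees" and i: "i < dirs"
    and zero: "\<And>k. k \<in> row i \<Longrightarrow> rmem s k = 0"
  shows "wp m (for_upto Coord Dim add_coordinate) (\<lambda>t s'. t \<le> 2 + d * (5 + n * 3) \<and>
    regs_same_off {Point, Coord} s s' \<and> coins s' = coins s \<and> used s' = used s + d \<and> imem s' = imem s \<and>
    rmem s' = override_on (rmem s) (\<lambda>k. drawn_proj (coins s) (rmem s) (used s) d (k - winner_addr i 0 0)) (row i)) s"
proof -
  define I where "I = (\<lambda>j (s' :: state). regs_same_off {Point, Coord} s s' \<and> coins s' = coins s \<and>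
    used s' = used s + j \<and> imem s' = imem s \<and> ireg s' Coord = j \<and>
    rmem s' = override_on (rmem s) (\<lambda>k. drawn_proj (coins s) (rmem s) (used s) j (k - winner_addr i 0 0)) (row i))"
  have "wp m (for_upto Coord Dim add_coordinate) (\<lambda>t s'. t \<le> 2 + d * (3 + n * 3 + 2) \<and> I d s') s"
  proof (rule wp_for_upto)
    show "I 0 (s\<lparr>ireg := (ireg s)(Coord := 0)\<rparr>)"
      using zero by (auto simp: I_def regs_same_off_def drawn_proj_def override_on_def fun_eq_iff)
    fix j s1
    assume I: "I j s1"
    have par1: "params (ireg s1)" by (rule params_regs_same_off[OF _ _ par]) (use I in \<open>auto simp: I_def\<close>)
    then show "ireg s1 Coord = j \<and> ireg s1 Dim = d" using I by (simp add: I_def)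
    assume j: "j < d"
    have coord: "(k - winner_addr i 0 0) * d + j \<notin> row i" if "k \<in> row i" for k
    proof -
      have "k - winner_addr i 0 0 < n" using that by (auto simp: row_def winner_addr_0)
      then show ?thesis using j by (rule coord_notin_row)
    qed
    have regs1: "ireg s1 Row = winners + i * trees" "ireg s1 Coord = j" using I r
      by (auto simp: I_def regs_same_off_def)
    show "wp m add_coordinate (\<lambda>t s'. t \<le> 3 + n * 3 \<and> ireg s' Coord = j \<and>
        I (Suc j) (s'\<lparr>ireg := (ireg s')(Coord := Suc j)\<rparr>)) s1"
      by (rule wp_mono[OF wp_add_coordinate[OF par1 regs1 i j]])
        (use I coord in \<open>auto simp: I_def regs_same_off_def override_on_def fun_eq_iff drawn_proj_def\<close>)
  qed (rule params_less)
  then show ?thesis by (rule wp_mono) (simp add: I_def)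
qed

lemma wp_project_row:
  assumes par: "params (ireg s)" and dir: "ireg s Dir = i" and i: "i < dirs"
    and zero: "\<And>k. k \<in> row i \<Longrightarrow> rmem s k = 0"
  shows "wp m project_row (\<lambda>t s'. t \<le> row_time \<and> regs_same_off {Row, Point, Coord} s s' \<and>
    coins s' = coins s \<and> used s' = used s + d \<and>
    imem s' = override_on (imem s) (\<lambda>k. k - winner_addr i 0 0) (row i) \<and>
    rmem s' = override_on (rmem s) (\<lambda>k. drawn_proj (coins s) (rmem s) (used s) d (k - winner_addr i 0 0)) (row i)) s"
proof -
  let ?post = "\<lambda>t s'. t \<le> row_time \<and> regs_same_off {Row, Point, Coord} s s' \<and>
    coins s' = coins s \<and> used s' = used s + d \<and>
    imem s' = override_on (imem s) (\<lambda>k. k - winner_addr i 0 0) (row i) \<and>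
    rmem s' = override_on (rmem s) (\<lambda>k. drawn_proj (coins s) (rmem s) (used s) d (k - winner_addr i 0 0)) (row i)"
  let ?s = "s\<lparr>ireg := (ireg s)(Row := winners + i * trees)\<rparr>"
  have "params (ireg ?s)" "ireg ?s Row = winners + i * trees" using par by auto
  note init = wp_init_winners[OF this i]
  have "wp m (init_winners;; for_upto Coord Dim add_coordinate) (\<lambda>t. ?post (Suc t)) ?s"
  proof (rule wp_SeqI[OF init], elim conjE)
    fix t1 s1
    assume t1: "t1 \<le> 2 + n * 3" and same1: "regs_same_off {Point} ?s s1" and rm1: "rmem s1 = rmem ?s"
      and co1: "coins s1 = coins ?s" "used s1 = used ?s"
      and im1: "imem s1 = override_on (imem ?s) (\<lambda>k. k - winner_addr i 0 0) (row i)"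
    have par1: "params (ireg s1)" by (rule params_regs_same_off[OF same1]) (use par in auto)
    have row1: "ireg s1 Row = winners + i * trees" using same1 by (simp add: regs_same_off_def)
    have zero1: "rmem s1 k = 0" if "k \<in> row i" for k using that rm1 zero by simp
    show "wp m (for_upto Coord Dim add_coordinate) (\<lambda>t. ?post (Suc (t1 + t))) s1"
      by (rule wp_mono[OF wp_add_coordinates[OF par1 row1 i zero1]], assumption)
        (use t1 same1 rm1 co1 im1 in \<open>auto simp: row_time_def regs_same_off_def\<close>)
  qed
  moreover have "i * trees < m" "i < m" "winners + i * trees < m"
    using winner_addr_less[OF i b_pos n_pos] i params_less unfolding winner_addr_0 by linarith+
  ultimately show ?thesis using par dir params_less
    by (simp add: project_row_def wp_Seq[of _ "ISet _ _"] wp_ISet)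
qed

definition rows :: "nat \<Rightarrow> nat set" where "rows N = (\<Union>i<N. row i)"

lemma row_notin_rows: assumes "k \<in> row i" shows "k \<notin> rows i"
proof
  assume "k \<in> rows i"
  then obtain i' where "i' < i" "k \<in> row i'" by (auto simp: rows_def)
  then show False using assms b_pos by (auto simp: row_def winner_addr_eq)
qed

definition rows_drawn :: "nat \<Rightarrow> state \<Rightarrow> state \<Rightarrow> bool" where
  "rows_drawn N s s' \<longleftrightarrow>
     (\<forall>i<N. \<forall>x<n. imem s' (winner_addr i 0 x) = x \<and>
        rmem s' (winner_addr i 0 x) = drawn_proj (coins s) (rmem s) (i * d) d x) \<and>
     (\<forall>k. k \<notin> rows N \<longrightarrow> imem s' k = imem s k \<and> rmem s' k = rmem s k)"

lemma rows_drawn_Suc: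
  assumes drawn: "rows_drawn i s s1"
    and im: "imem s2 = override_on (imem s1) (\<lambda>k. k - winner_addr i 0 0) (row i)"
    and rm: "rmem s2 = override_on (rmem s1) (\<lambda>k. drawn_proj (coins s) (rmem s1) (i * d) d (k - winner_addr i 0 0)) (row i)"
  shows "rows_drawn (Suc i) s s2"
proof -
  have coord: "rmem s1 (x * d + j) = rmem s (x * d + j)" if "x < n" "j < d" for x j
    using drawn coord_notin_row[OF that] by (auto simp: rows_drawn_def rows_def)
  have "imem s2 (winner_addr i' 0 x) = x \<and> rmem s2 (winner_addr i' 0 x) =
      drawn_proj (coins s) (rmem s) (i' * d) d x"
    if "i' < Suc i" "x < n" for i' x
  proof (cases "i' = i")
    case True
    then have "winner_addr i' 0 x \<in> row i" "winner_addr i' 0 x - winner_addr i 0 0 = x"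
      using that by (auto simp: row_def winner_addr_0)
    then show ?thesis using im rm coord[OF that(2)] True by (simp add: drawn_proj_def)
  next
    case False
    then have "winner_addr i' 0 x \<notin> row i" using that b_pos by (auto simp: row_def winner_addr_eq)
    then show ?thesis using im rm drawn that False by (simp add: rows_drawn_def)
  qed
  moreover have "imem s2 k = imem s k \<and> rmem s2 k = rmem s k" if "k \<notin> rows (Suc i)" for k
    using that im rm drawn by (auto simp: rows_drawn_def rows_def less_Suc_eq)
  ultimately show ?thesis by (simp add: rows_drawn_def)
qed

lemma wp_init_projections:
  assumes par: "params (ireg s)" and used: "used s = 0" and zero: "\<And>k. winners \<le> k \<Longrightarrow> rmem s k = 0"
  shows "wp m init_projections (\<lambda>t s'. t \<le> 2 + dirs * (row_time + 2) \<and> params (ireg s') \<and>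
      rows_drawn dirs s s') s"
proof -
  define I where "I = (\<lambda>i (s' :: state). params (ireg s') \<and> coins s' = coins s \<and> used s' = i * d \<and>
      ireg s' Dir = i \<and>
    rows_drawn i s s')"
  have "wp m (for_upto Dir Dirs project_row) (\<lambda>t s'. t \<le> 2 + dirs * (row_time + 2) \<and> I dirs s') s"
  proof (rule wp_for_upto)
    show "I 0 (s\<lparr>ireg := (ireg s)(Dir := 0)\<rparr>)" using par used by (simp add: I_def rows_drawn_def)
    show "ireg s1 Dir = i \<and> ireg s1 Dirs = dirs" if "I i s1" for i s1 using that by (simp add: I_def)
    show "wp m project_row (\<lambda>t s'. t \<le> row_time \<and> ireg s' Dir = i \<and>
        I (Suc i) (s'\<lparr>ireg := (ireg s')(Dir := Suc i)\<rparr>)) s1"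
      if i: "i < dirs" and I: "I i s1" for i s1
    proof -
      have par1: "params (ireg s1)" and dir1: "ireg s1 Dir = i" and drawn: "rows_drawn i s s1"
        using I by (simp_all add: I_def)
      have zero1: "rmem s1 k = 0" if "k \<in> row i" for k
      proof -
        have "winners \<le> k" using that winners_le_winner_addr by (auto simp: row_def)
        then show ?thesis using drawn row_notin_rows[OF that] zero by (simp add: rows_drawn_def)
      qed
      show ?thesis
      proof (rule wp_mono[OF wp_project_row[OF par1 dir1 i zero1]], assumption, elim conjE, intro conjI)
        fix t s2
        assume same2: "regs_same_off {Row, Point, Coord} s1 s2"
        then show "ireg s2 Dir = i" using dir1 by (simp add: regs_same_off_def)
        have par2: "params (ireg s2)" by (rule params_regs_same_off[OF same2 _ par1]) auto
        assume "coins s2 = coins s1" "used s2 = used s1 + d"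
          "imem s2 = override_on (imem s1) (\<lambda>k. k - winner_addr i 0 0) (row i)"
          "rmem s2 = override_on (rmem s1)
            (\<lambda>k. drawn_proj (coins s1) (rmem s1) (used s1) d (k - winner_addr i 0 0)) (row i)"
        with I rows_drawn_Suc[OF drawn, of s2] par2 show "I (Suc i) (s2\<lparr>ireg := (ireg s2)(Dir := Suc i)\<rparr>)"
          by (simp add: I_def rows_drawn_def)
      qed
    qed
  qed (rule params_less)
  then show ?thesis unfolding init_projections_def by (rule wp_mono) (simp add: I_def)
qed

end


section \<open>The invariant of the data structure\<close>

definition projection :: "nat \<Rightarrow> (nat \<Rightarrow> real) \<Rightarrow> nat \<Rightarrow> (nat \<Rightarrow> real) \<Rightarrow> real" where
  "projection d z i \<omega> = (\<Sum>j<d. \<omega> (i * d + j) * z j)"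

fun after :: "point set set \<Rightarrow> operation list \<Rightarrow> point set set" where
  "after P [] = P"
| "after P (Query S q # ops) = after P ops"
| "after P (Merge S S' # ops) = after (insert (S \<union> S') (P - {S, S'})) ops"

lemma admissible_append:
  "admissible X P (ops @ ops') \<longleftrightarrow> admissible X P ops \<and> admissible X (after P ops) ops'"
  by (induction X P ops rule: admissible.induct) auto

lemma after_append: "after P (ops @ ops') = after (after P ops) ops'"
  by (induction P ops rule: after.induct) auto

lemma partition_on_merge:
  assumes "partition_on A P" "S \<in> P" "S' \<in> P"
  shows "partition_on A (insert (S \<union> S') (P - {S, S'}))"
proof -
  have disj: "T \<inter> T' = {}" if "T \<in> P" "T' \<in> P" "T \<noteq> T'" for T T'
    using assms(1) that by (meson disjointD partition_onD2)
  have merged: "(S \<union> S') \<inter> T = {}" if "T \<in> P - {S, S'}" for T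
    using disj[OF assms(2), of T] disj[OF assms(3), of T] that by auto
  have "disjoint (insert (S \<union> S') (P - {S, S'}))"
  proof (rule disjointI)
    fix T T' assume "T \<in> insert (S \<union> S') (P - {S, S'})" "T' \<in> insert (S \<union> S') (P - {S, S'})" "T \<noteq> T'"
    then consider "T = S \<union> S'" "T' \<in> P - {S, S'}" | "T' = S \<union> S'" "T \<in> P - {S, S'}" | "T \<in> P" "T' \<in> P"
      "T \<noteq> T'" by blast
    then show "T \<inter> T' = {}" by cases (use merged disj in blast)+
  qed
  moreover have "\<Union>(insert (S \<union> S') (P - {S, S'})) = \<Union>P" using assms(2,3) by blast
  ultimately show ?thesis using assms by (auto simp: partition_on_def)
qed

lemma partition_on_after:
  "partition_on X P \<Longrightarrow> admissible X P ops \<Longrightarrow> partition_on X (after P ops)"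
  by (induction X P ops rule: admissible.induct) (auto intro: partition_on_merge)

locale afn_input = machine +
  fixes \<alpha> :: real and e :: nat and xs :: "point list"
  assumes length_xs: "length xs = n" and distinct_xs: "distinct xs" and dims: "p \<in> set xs \<Longrightarrow> length p = d"
    and \<alpha>: "1 < \<alpha>" and W_eq: "W = 2 ^ e" and e_lower: "real b \<le> real e * \<alpha>\<^sup>2"
    and e_upper: "k < e \<Longrightarrow> real k * \<alpha>\<^sup>2 < real b"
begin

definition point_proj :: "(nat \<Rightarrow> real) \<Rightarrow> nat \<Rightarrow> nat \<Rightarrow> real" where
  "point_proj \<omega> i x = projection d ((!) (xs ! x)) i \<omega>"

definition positions :: "point set \<Rightarrow> nat set" where
  "positions S = {x. x < n \<and> xs ! x \<in> S}"

definition stored :: "(nat \<Rightarrow> real) \<Rightarrow> bool" where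
  "stored rm \<longleftrightarrow> (\<forall>x<n. \<forall>j<d. rm (x * d + j) = xs ! x ! j)"

definition near :: "point set \<Rightarrow> point \<Rightarrow> nat set" where
  "near S q = {x \<in> positions S. l2 q (xs ! x) < Max (l2 q ` S) / \<alpha>}"

text \<open>Some group of directions separates a point that may be returned from all points that must not be.\<close>

definition separated :: "point set \<Rightarrow> point \<Rightarrow> (nat \<Rightarrow> real) \<Rightarrow> bool" where
  "separated S q \<omega> \<longleftrightarrow> (\<exists>g<3 * b. \<exists>\<Delta>. \<exists>y\<in>positions S - near S q.
     separates group_dirs (\<lambda>i x. point_proj \<omega> i x - point_proj \<omega> i (position xs q)) y (near S q) \<Delta> g)"

lemma position_nth: assumes "x < n" shows "position xs (xs ! x) = x"
  unfolding position_def using assms distinct_xs length_xs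
  by (intro the_equality) (auto simp: nth_eq_iff_index_eq)

lemma position_less: "q \<in> set xs \<Longrightarrow> position xs q < n"
  using position_nth by (metis in_set_conv_nth length_xs)

lemma nth_position: "q \<in> set xs \<Longrightarrow> xs ! position xs q = q"
  using position_nth by (metis in_set_conv_nth length_xs)

lemma position_in_positions: "q \<in> set xs \<Longrightarrow> q \<in> S \<Longrightarrow> position xs q \<in> positions S"
  by (simp add: positions_def position_less nth_position)

lemma positions_nonempty: "S \<subseteq> set xs \<Longrightarrow> S \<noteq> {} \<Longrightarrow> positions S \<noteq> {}"
  using position_in_positions[of _ S] by blast

lemma positions_Un: "positions (S \<union> S') = positions S \<union> positions S'"
  by (auto simp: positions_def)

lemma positions_singleton: "x \<in> set xs \<Longrightarrow> positions {x} = {position xs x}"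
  using position_in_positions[of x "{x}"] position_nth by (auto simp: positions_def)

end

locale afn = afn_input +
  fixes \<omega> :: "nat \<Rightarrow> real"

sublocale afn \<subseteq> projected n d b W m "point_proj \<omega>" ..

context afn
begin

lemma dist2_l2:
  assumes "stored rm" "w < n" "q \<in> set xs"
  shows "dist2 rm w (position xs q) = (l2 q (xs ! w))\<^sup>2"
proof -
  have "(l2 q (xs ! w))\<^sup>2 = (\<Sum>j<d. (q ! j - xs ! w ! j)\<^sup>2)"
    using dims[OF assms(3)] by (simp add: l2_def L2_set_def sum_nonneg)
  also have "\<dots> = dist2 rm w (position xs q)"
    unfolding dist2_def using assms position_less nth_position
    by (intro sum.cong) (auto simp: stored_def power2_commute)
  finally show ?thesis by simp
qed

definition handles_ok :: "(nat \<Rightarrow> nat) \<Rightarrow> point set set \<Rightarrow> handles \<Rightarrow> bool" where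
  "handles_ok im P h \<longleftrightarrow> inj_on h P \<and> (\<forall>S\<in>P. h S < n \<and> cluster im (h S) = positions S)"

definition ds_inv :: "point set set \<Rightarrow> state \<times> handles \<Rightarrow> bool" where
  "ds_inv P = (\<lambda>(s, h). params (ireg s) \<and> stored (rmem s) \<and> leaf_projs (rmem s) \<and>
     tree_family (imem s) (rmem s) (root_table (imem s)) \<and> handles_ok (imem s) P h)"

lemma handles_ok_merge:
  assumes ok: "handles_ok im P h" and P: "partition_on (set xs) P" and S: "S \<in> P" "S' \<in> P" "S \<noteq> S'"
    and merged: "cluster im' (h S) = cluster im (h S) \<union> cluster im (h S')"
    and others: "\<And>a. a \<noteq> h S \<Longrightarrow> a \<noteq> h S' \<Longrightarrow> cluster im' a = cluster im a"
  shows "handles_ok im' (insert (S \<union> S') (P - {S, S'})) (h(S \<union> S' := h S))"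
proof -
  let ?h = "h(S \<union> S' := h S)" and ?P = "insert (S \<union> S') (P - {S, S'})"
  have inj: "inj_on h P" using ok by (simp add: handles_ok_def)
  have old: "T \<noteq> S \<union> S' \<and> h T \<noteq> h S \<and> h T \<noteq> h S'" if "T \<in> P - {S, S'}" for T
  proof -
    have "T \<inter> S = {}" "S \<noteq> {}" using P S that by (auto simp: partition_on_def disjoint_def)
    moreover have "h T \<noteq> h S" "h T \<noteq> h S'" using inj S that by (auto dest: inj_onD)
    ultimately show ?thesis by blast
  qed
  have "inj_on ?h (P - {S, S'}) \<longleftrightarrow> inj_on h (P - {S, S'})" by (rule inj_on_cong) (use old in simp)
  moreover have "h S \<notin> ?h ` (P - {S, S'})"
  proof
    assume "h S \<in> ?h ` (P - {S, S'})"
    then obtain T where "T \<in> P - {S, S'}" "h S = ?h T" by (rule imageE)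
    then show False using old[of T] by simp
  qed
  ultimately have "inj_on ?h ?P" using inj_on_diff[OF inj] by (auto simp: inj_on_insert)
  moreover have "?h T < n \<and> cluster im' (?h T) = positions T" if "T \<in> ?P" for T
  proof (cases "T = S \<union> S'")
    case True
    then show ?thesis using merged ok S by (simp add: handles_ok_def positions_Un)
  next
    case False
    then have T: "T \<in> P - {S, S'}" using that by auto
    then show ?thesis using others old[OF T] ok by (simp add: handles_ok_def)
  qed
  ultimately show ?thesis unfolding handles_ok_def by blast
qed

lemma served_approx_farthest:
  assumes st: "stored rm" and q: "q \<in> set xs" and r: "r \<in> positions S" and sep: "separated S q \<omega>"
    and served: "\<forall>g<3 * b. served rm (positions S) (position xs q) g (dist2 rm r (position xs q))"
  shows "approx_farthest \<alpha> S q (xs ! r)"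
proof -
  have near: "near S q \<subseteq> positions S" by (auto simp: near_def)
  obtain g \<Delta> y where g: "g < 3 * b" and y: "y \<in> positions S - near S q"
    and sep_y: "separates group_dirs (rel (position xs q)) y (near S q) \<Delta> g"
    using sep unfolding separated_def rel_def[abs_def] by blast
  obtain w where w: "w \<in> positions S - near S q" "dist2 rm w (position xs q) \<le> dist2 rm r (position xs q)"
    using served g near y sep_y unfolding served_def by blast
  have "w < n" "r < n" using w r by (auto simp: positions_def)
  then have "(l2 q (xs ! w))\<^sup>2 \<le> (l2 q (xs ! r))\<^sup>2" using w(2) by (simp add: dist2_l2[OF st _ q])
  then have "l2 q (xs ! w) \<le> l2 q (xs ! r)" by (rule power2_le_imp_le) (simp add: l2_def)
  moreover have "Max (l2 q ` S) / \<alpha> \<le> l2 q (xs ! w)" using w(1) by (auto simp: near_def)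
  ultimately show ?thesis using r by (simp add: approx_farthest_def positions_def)
qed

lemma query_step:
  assumes inv: "ds_inv P (s, h)" and S: "S \<in> P" "S \<subseteq> set xs" "S \<noteq> {}" and q: "q \<in> set xs"
  obtains t s' where "op_step m afn_structure xs (s, h) (Query S q) t (s', h)" "t \<le> query_time"
    "ds_inv P (s', h)"
    "ireg s' Handle < n" "separated S q \<omega> \<Longrightarrow> approx_farthest \<alpha> S q (xs ! ireg s' Handle)"
proof -
  let ?q = "position xs q"
  let ?s = "with_args (h S) ?q s"
  have par: "params (ireg ?s)" and regs: "ireg ?s Handle = h S" "ireg ?s Query_Point = ?q"
    and st: "stored (rmem ?s)" and leafs: "leaf_projs (rmem ?s)"
    and fam: "tree_family (imem ?s) (rmem ?s) (root_table (imem ?s))"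
    and hS: "h S < n" "positions S = cluster (imem ?s) (h S)"
    using inv S(1) by (auto simp: ds_inv_def handles_ok_def with_args_def)
  obtain t s' where step: "big_step m query_prog ?s t s'" and t: "t \<le> query_time"
    and framed: "frame (insert Handle {Group..Child2}) {Best, Sqdist, Diff} ?s s'"
    and r: "ireg s' Handle \<in> positions S"
    and served: "\<forall>g<3 * b. served (rmem ?s) (positions S) ?q g (dist2 (rmem ?s) (ireg s' Handle) ?q)"
    using wp_query_prog[OF par regs hS(1) position_less[OF q] fam leafs hS(2) positions_nonempty[OF S(2,3)]]
    unfolding wp_def by auto
  have "op_step m afn_structure xs (s, h) (Query S q) t (s', h)"
    by (rule op_step.Query) (use step in \<open>simp add: afn_structure_def\<close>)
  moreover have "params (ireg s')" by (rule frame_params[OF framed _ par]) auto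
  then have "ds_inv P (s', h)"
    using inv stored_trees_cong[OF frame_imem[OF framed] fam] frame_rmem[OF framed]
    by (auto simp: ds_inv_def handles_ok_def with_args_def)
  moreover have "separated S q \<omega> \<Longrightarrow> approx_farthest \<alpha> S q (xs ! ireg s' Handle)"
    using served_approx_farthest[OF st q r _ served] .
  ultimately show thesis using that t r by (auto simp: positions_def)
qed

lemma merge_step:
  assumes inv: "ds_inv P (s, h)" and P: "partition_on (set xs) P" and S: "S \<in> P" "S' \<in> P" "S \<noteq> S'"
  obtains t s' h' where "op_step m afn_structure xs (s, h) (Merge S S') t (s', h')" "t \<le> merge_time"
    "ds_inv (insert (S \<union> S') (P - {S, S'})) (s', h')"
proof -
  let ?s = "with_args (h S) (h S') s"
  let ?P = "insert (S \<union> S') (P - {S, S'})"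
  have par: "params (ireg ?s)" and regs: "ireg ?s Handle = h S" "ireg ?s Handle2 = h S'"
    and st: "stored (rmem ?s)" and leafs: "leaf_projs (rmem ?s)"
    and fam: "tree_family (imem ?s) (rmem ?s) (root_table (imem ?s))"
    and hS: "h S < n" "h S' < n" and ok: "handles_ok (imem ?s) P h"
    using inv S by (auto simp: ds_inv_def handles_ok_def with_args_def)
  have "h S \<noteq> h S'" using inv S by (auto simp: ds_inv_def handles_ok_def dest: inj_onD)
  note wp_merge = wp_merge_prog[OF par regs hS this fam leafs]
  obtain t s' where step: "big_step m merge_prog ?s t s'" and t: "t \<le> merge_time"
    and post: "params (ireg s')" "ireg s' Handle = h S" "leaf_projs (rmem s')"
      "tree_family (imem s') (rmem s') (root_table (imem s'))"
    and merged: "cluster (imem s') (h S) = cluster (imem ?s) (h S) \<union> cluster (imem ?s) (h S')"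
    and others: "\<And>a. a \<noteq> h S \<Longrightarrow> a \<noteq> h S' \<Longrightarrow> cluster (imem s') a = cluster (imem ?s) a"
    and rm: "\<And>k. k < winners \<Longrightarrow> rmem s' k = rmem ?s k"
    using wp_merge unfolding wp_def by auto
  have "stored (rmem s')"
    using st rm less_le_trans[OF coord_index_less region_order(3)] by (simp add: stored_def)
  moreover have "handles_ok (imem s') ?P (h(S \<union> S' := h S))"
    by (rule handles_ok_merge[OF ok P S merged others])
  ultimately have "ds_inv ?P (s', h(S \<union> S' := h S))" unfolding ds_inv_def prod.case using post by blast
  moreover have "op_step m afn_structure xs (s, h) (Merge S S') t (s', h(S \<union> S' := ireg s' 0))"
    by (rule op_step.Merge) (use step in \<open>simp add: afn_structure_def\<close>)
  ultimately show thesis using that t post(2) by simp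
qed

end

context afn_input
begin

lemma e_le: "e \<le> b"
  using W_upper W_eq by simp

lemma wp_init_scale:
  assumes regs: "ireg s Ranks = b" "rreg s Alpha = \<alpha>"
  shows "wp m init_scale (\<lambda>t s'. t \<le> 3 + b * 3 \<and> same_data s s' \<and> regs_same_off {Scale, Count} s s' \<and>
      ireg s' Scale = W) s"
proof -
  define I where "I = (\<lambda>k (s' :: state). same_data s s' \<and> regs_same_off {Scale, Count} s s' \<and>
    ireg s' Scale = 2 ^ k \<and> ireg s' Count = k)"
  let ?b = "RLess (RMul (ROfInt \<acute>Count) (RMul (RReg Alpha) (RReg Alpha))) (ROfInt \<acute>Ranks)"
  let ?s = "s\<lparr>ireg := (ireg s)(Scale := 1, Count := 0)\<rparr>"
  have test: "bok m s1 ?b \<and> (bval s1 ?b \<longleftrightarrow> real k * \<alpha>\<^sup>2 < real b)" if "k \<le> e" "I k s1" for k s1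
    using that e_le params_less(3) regs by (auto simp: I_def same_data_def regs_same_off_def power2_eq_square)
  have "wp m (While ?b (ISet Scale (\<acute>Scale *\<^sub>I IConst 2);; incr Count)) (\<lambda>t s'. t \<le> 1 + e * (2 + 1) \<and>
      I e s') ?s"
  proof (rule wp_while_count)
    show "I 0 ?s" by (simp add: I_def same_data_def regs_same_off_def)
    show "bok m s1 ?b \<and> bval s1 ?b \<and>
        wp m (ISet Scale (\<acute>Scale *\<^sub>I IConst 2);; incr Count) (\<lambda>t s'. t \<le> 2 \<and> I (Suc k) s') s1"
      if k: "k < e" and I: "I k s1" for k s1
    proof -
      have "2 ^ k < m" "2 ^ Suc k < m" using k e_le by (intro two_power_less; simp)+
      then have "wp m (ISet Scale (\<acute>Scale *\<^sub>I IConst 2);; incr Count) (\<lambda>t s'. t \<le> 2 \<and> I (Suc k) s') s1"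
        using k I e_le params_less(3,14) by (auto simp: I_def wp_simps wp_incr same_data_def regs_same_off_def mult.commute)
      then show ?thesis using test[of k s1] e_upper[OF k] k I by simp
    qed
    show "bok m s1 ?b \<and> \<not> bval s1 ?b" if "I e s1" for s1
      using test[OF order_refl that] e_lower by simp
  qed
  then have "wp m (While ?b (ISet Scale (\<acute>Scale *\<^sub>I IConst 2);;
      incr Count)) (\<lambda>t s'. Suc (Suc t) \<le> 3 + b * 3 \<and>
      same_data s s' \<and> regs_same_off {Scale, Count} s s' \<and> ireg s' Scale = W) ?s"
    by (rule wp_mono) (use e_le W_eq in \<open>auto simp: I_def\<close>)
  then show ?thesis using params_less(14) by (simp add: init_scale_def wp_Seq wp_ISet)
qed

lemma wp_init_sizes:
  assumes regs: "ireg s Handle = n" "ireg s Query_Point = d" "rreg s Alpha = \<alpha>"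
  shows "wp m init_sizes (\<lambda>t s'. t \<le> 16 + 6 * b \<and> same_data s s' \<and> params (ireg s')) s"
proof -
  let ?s = "s\<lparr>ireg := (ireg s)(Points := n, Dim := d)\<rparr>"
  have "ireg ?s Points = n" by simp
  note wp_ranks = wp_init_ranks[OF this]
  have "wp m (init_ranks;; init_scale;; init_layout)
    (\<lambda>t s'. Suc (Suc t) \<le> 16 + 6 * b \<and> same_data s s' \<and> params (ireg s')) ?s"
  proof (rule wp_SeqI[OF wp_ranks], elim conjE)
    fix t1 s1
    assume t1: "t1 \<le> 3 + b * 3" and same1: "same_data ?s s1" "regs_same_off {Ranks, Count} ?s s1"
      and b1: "ireg s1 Ranks = b"
    then have "rreg s1 Alpha = \<alpha>" using regs(3) by (simp add: same_data_def)
    note wp_scale = wp_init_scale[OF b1 this]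
    show "wp m (init_scale;; init_layout)
      (\<lambda>t s'. Suc (Suc (t1 + t)) \<le> 16 + 6 * b \<and> same_data s s' \<and> params (ireg s')) s1"
    proof (rule wp_SeqI[OF wp_scale], elim conjE)
      fix t2 s2
      assume t2: "t2 \<le> 3 + b * 3" and same2: "same_data s1 s2" "regs_same_off {Scale, Count} s1 s2"
        and W2: "ireg s2 Scale = W"
      have "ireg s2 Points = n" "ireg s2 Dim = d" "ireg s2 Ranks = b"
        using same1(2) same2(2) b1 by (simp_all add: regs_same_off_def)
      from wp_init_layout[OF this W2]
      show "wp m init_layout (\<lambda>t s'. Suc (Suc (t1 + (t2 + t))) \<le> 16 + 6 * b \<and> same_data s s' \<and>
          params (ireg s')) s2"
        by (rule wp_mono) (use t1 t2 same1(1) same2(1) in \<open>auto simp: same_data_def\<close>)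
    qed
  qed
  then show ?thesis using regs params_less(1,2) by (simp add: init_sizes_def wp_Seq wp_ISet)
qed

end

context afn
begin

definition init_time :: nat where "init_time = 20 + 6 * b + n * 3 + dirs * (row_time + 2)"

lemma singleton_trees:
  assumes im: "\<And>i x. i < dirs \<Longrightarrow> x < n \<Longrightarrow> im (winner_addr i 0 x) = x" and leafs: "leaf_projs rm"
    and roots: "\<And>a j. a < n \<Longrightarrow> j < b \<Longrightarrow> im (root_addr a j) = (if j = 0 then Suc a else 0)"
  shows "tree_family im rm (root_table im)" "a < n \<Longrightarrow> cluster im a = {a}"
proof -
  have rt: "root_table im (p, j) = Some x \<longleftrightarrow> p = Stored x \<and> j = 0 \<and> x < n" for p j x
    using roots b_pos by (auto simp: root_table_def split: place.splits)
  have "tree im rm 0 x" if "x < n" for x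
    using that im leafs by (simp add: winners_ok_def leaf_projs_def)
  then show "tree_family im rm (root_table im)" unfolding tree_family_def rt by auto
  show "cluster im a = {a}" if "a < n" using that by (auto simp: cluster_def contents_def rt)
qed

lemma handles_ok_init:
  assumes "\<And>a. a < n \<Longrightarrow> cluster im a = {a}"
  shows "handles_ok im (singletons (set xs)) (\<lambda>S. position xs (the_elem S))"
  unfolding handles_ok_def
proof
  show "inj_on (\<lambda>S. position xs (the_elem S)) (singletons (set xs))"
    unfolding singletons_def by (intro inj_onI) (metis imageE nth_position the_elem_eq)
  show "\<forall>S\<in>singletons (set xs). position xs (the_elem S) < n \<and>
      cluster im (position xs (the_elem S)) = positions S"
    using assms position_less positions_singleton by (auto simp: singletons_def)
qed

lemma stored_start: "stored (rmem (start xs d \<alpha> \<omega>))"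
  using coord_index_less length_xs by (simp add: stored_def start_def)

lemma rows_drawn_leaf_projs:
  assumes "rows_drawn dirs s s'" "stored (rmem s)" "coins s = \<omega>" shows "leaf_projs (rmem s')"
  using assms by (simp add: rows_drawn_def leaf_projs_def point_proj_def projection_def drawn_proj_def stored_def)

lemma below_winners_notin_rows: "k < winners \<Longrightarrow> k \<notin> rows N"
  by (auto simp: rows_def row_def winner_addr_def)

lemma ds_inv_init:
  assumes par: "params (ireg s')" and drawn: "rows_drawn dirs s s'" and rm: "rmem s = rmem (start xs d \<alpha> \<omega>)"
    and coins: "coins s = \<omega>"
    and im: "imem s = override_on (\<lambda>_. 0) (\<lambda>k. Suc (k div b)) ((\<lambda>a. root_addr a 0) ` {..<n})"
  shows "ds_inv (singletons (set xs)) (s', \<lambda>S. position xs (the_elem S))"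
proof -
  have old: "imem s' k = imem s k" "rmem s' k = rmem s k" if "k < winners" for k
    using drawn below_winners_notin_rows[OF that] by (auto simp: rows_drawn_def)
  have roots: "imem s' (root_addr a j) = (if j = 0 then Suc a else 0)" if "a < n" "j < b" for a j
  proof -
    have "root_addr a j < winners" using root_addr_less[OF that] region_order by linarith
    then have "imem s' (root_addr a j) = imem s (root_addr a j)" by (rule old)
    moreover have "root_addr a j \<in> (\<lambda>a. root_addr a 0) ` {..<n} \<longleftrightarrow> j = 0"
      using root_addr_eq[OF that(2) b_pos] that(1) by auto
    ultimately show ?thesis using b_pos by (simp add: im override_on_def root_addr_def)
  qed
  have "stored (rmem s')"
    using stored_start old(2) less_le_trans[OF coord_index_less region_order(3)]
    by (simp add: stored_def rm)
  moreover have leafs: "leaf_projs (rmem s')"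
    using rows_drawn_leaf_projs[OF drawn] stored_start rm coins by simp
  moreover have winners: "imem s' (winner_addr i 0 x) = x" if "i < dirs" "x < n" for i x
    using drawn that by (simp add: rows_drawn_def)
  moreover note singleton_trees[OF winners leafs roots]
  ultimately show ?thesis using par handles_ok_init by (simp add: ds_inv_def)
qed

lemma initialize_step:
  obtains t s where "big_step m init_prog (start xs d \<alpha> \<omega>) t s" "t \<le> init_time"
    "ds_inv (singletons (set xs)) (s, \<lambda>S. position xs (the_elem S))"
proof -
  let ?s = "start xs d \<alpha> \<omega>"
  let ?inv = "\<lambda>s. ds_inv (singletons (set xs)) (s, \<lambda>S. position xs (the_elem S))"
  have "ireg ?s Handle = n" "ireg ?s Query_Point = d" "rreg ?s Alpha = \<alpha>" using length_xs
    by (simp_all add: start_def)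
  note wp_sizes = wp_init_sizes[OF this]
  have "wp m init_prog (\<lambda>t s. t \<le> init_time \<and> ?inv s) ?s"
    unfolding init_prog_def
  proof (rule wp_SeqI[OF wp_sizes], elim conjE)
    fix t1 s1
    assume t1: "t1 \<le> 16 + 6 * b" and same1: "same_data ?s s1" and par1: "params (ireg s1)"
    show "wp m (init_roots;; init_projections) (\<lambda>t s. t1 + t \<le> init_time \<and> ?inv s) s1"
    proof (rule wp_SeqI[OF wp_init_roots[OF par1]], elim conjE)
      fix t2 and s2 :: state
      assume t2: "t2 \<le> 2 + n * 3" and par2: "params (ireg s2)" and rm2: "rmem s2 = rmem s1"
        and co2: "coins s2 = coins s1" "used s2 = used s1"
        and im2: "imem s2 = override_on (imem s1) (\<lambda>k. Suc (k div b)) ((\<lambda>a. root_addr a 0) ` {..<n})"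
      have rm: "rmem s2 = rmem ?s" and co: "coins s2 = \<omega>" and used: "used s2 = 0"
        and im: "imem s2 = override_on (\<lambda>_. 0) (\<lambda>k. Suc (k div b)) ((\<lambda>a. root_addr a 0) ` {..<n})"
        using same1 rm2 co2 im2 by (simp_all add: same_data_def start_def)
      have zero: "rmem s2 k = 0" if "winners \<le> k" for k
        using that region_order(3) length_xs by (simp add: rm start_def)
      show "wp m init_projections (\<lambda>t s. t1 + (t2 + t) \<le> init_time \<and> ?inv s) s2"
        by (rule wp_mono[OF wp_init_projections[OF par2 used zero]], assumption)
          (use t1 t2 ds_inv_init[OF _ _ rm co im] in \<open>auto simp: init_time_def\<close>)
    qed
  qed
  then show thesis using that unfolding wp_def by blast
qed

lemma op_step_inv:
  assumes inv: "ds_inv P c" and P: "partition_on (set xs) P" and adm: "admissible (set xs) P [opn]"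
  obtains t c' where "op_step m afn_structure xs c opn t c'" "ds_inv (after P [opn]) c'"
proof -
  obtain s h where c: "c = (s, h)" by (cases c)
  show thesis
  proof (cases opn)
    case (Query S q)
    then have S: "S \<in> P" "S \<subseteq> set xs" "S \<noteq> {}" and q: "q \<in> set xs" using adm P
      by (auto simp: partition_on_def)
    show thesis by (rule query_step[OF inv[unfolded c] S q]) (use that Query c in simp)
  next
    case (Merge S S')
    then have S: "S \<in> P" "S' \<in> P" "S \<noteq> S'" using adm by auto
    show thesis by (rule merge_step[OF inv[unfolded c] P S]) (use that Merge c in simp)
  qed
qed

end


section \<open>Operation sequences\<close>

lemma op_step_deterministic: "op_step m D xs c opn t1 c1 \<Longrightarrow> op_step m D xs c opn t2 c2 \<Longrightarrow> c1 = c2"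
  by (auto elim!: op_step.cases dest: big_step_deterministic)

context afn
begin

abbreviation reached :: "operation list \<Rightarrow> point set set" where
  "reached ops \<equiv> after (singletons (set xs)) ops"

lemma partition_on_reached:
  "admissible (set xs) (singletons (set xs)) ops \<Longrightarrow> partition_on (set xs) (reached ops)"
  by (rule partition_on_after) (simp_all add: singletons_def partition_on_singletons)

lemma run_inv:
  assumes "run m afn_structure xs d \<alpha> \<omega> ops c" "admissible (set xs) (singletons (set xs)) ops"
  shows "ds_inv (reached ops) c"
  using assms
proof (induction rule: run.induct)
  case (Init t s)
  obtain t' s' where "big_step m init_prog (start xs d \<alpha> \<omega>) t' s'"
    and inv: "ds_inv (singletons (set xs)) (s', \<lambda>S. position xs (the_elem S))"
    by (rule initialize_step)
  then have "s' = s" using Init big_step_deterministic by (fastforce simp: afn_structure_def)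
  then show ?case using inv by simp
next
  case (Step ops c opn t c')
  then have adm: "admissible (set xs) (singletons (set xs)) ops" "admissible (set xs) (reached ops) [opn]"
    by (auto simp: admissible_append)
  obtain t' c'' where step: "op_step m afn_structure xs c opn t' c''"
    and inv: "ds_inv (after (reached ops) [opn]) c''"
    by (rule op_step_inv[OF Step.IH[OF adm(1)] partition_on_reached[OF adm(1)] adm(2)])
  have "c'' = c'" by (rule op_step_deterministic[OF step Step.hyps(2)])
  then show ?case using inv by (simp add: after_append)
qed

lemma run_exists:
  assumes "admissible (set xs) (singletons (set xs)) ops"
  obtains c where "run m afn_structure xs d \<alpha> \<omega> ops c"
  using assms
proof (induction ops arbitrary: thesis rule: rev_induct)
  case Nil
  show ?case by (rule initialize_step, rule Nil(1), rule run.Init) (simp add: afn_structure_def)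
next
  case (snoc opn ops)
  then have adm: "admissible (set xs) (singletons (set xs)) ops" "admissible (set xs) (reached ops) [opn]"
    by (auto simp: admissible_append)
  obtain c where c: "run m afn_structure xs d \<alpha> \<omega> ops c" using snoc.IH[OF _ adm(1)] by blast
  obtain t c' where "op_step m afn_structure xs c opn t c'"
    by (rule op_step_inv[OF run_inv[OF c adm(1)] partition_on_reached[OF adm(1)] adm(2)])
  then show ?case using snoc.prems(1) run.Step[OF c] by blast
qed

lemma admissible_query:
  assumes "admissible (set xs) (singletons (set xs)) (ops @ [Query S q])"
  shows "admissible (set xs) (singletons (set xs)) ops" "S \<in> reached ops" "S \<subseteq> set xs" "S \<noteq> {}" "q \<in> set xs"
proof -
  show adm: "admissible (set xs) (singletons (set xs)) ops" and S: "S \<in> reached ops" and "q \<in> set xs"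
    using assms by (auto simp: admissible_append)
  show "S \<subseteq> set xs" "S \<noteq> {}" using partition_on_reached[OF adm] S by (auto simp: partition_on_def)
qed

lemma query_after_run:
  assumes adm: "admissible (set xs) (singletons (set xs)) (ops @ [Query S q])"
    and run: "run m afn_structure xs d \<alpha> \<omega> ops c"
  obtains t s' h' where "op_step m afn_structure xs c (Query S q) t (s', h')" "t \<le> query_time"
    "ireg s' Handle < n" "separated S q \<omega> \<Longrightarrow> approx_farthest \<alpha> S q (xs ! ireg s' Handle)"
proof -
  obtain s h where c: "c = (s, h)" by (cases c)
  show thesis
    by (rule query_step[OF run_inv[OF run[unfolded c] admissible_query(1)[OF adm]] admissible_query(2-5)[OF adm]])
      (use that c in blast)
qed

lemma separated_query_succeeds:
  assumes adm: "admissible (set xs) (singletons (set xs)) (ops @ [Query S q])" and sep: "separated S q \<omega>"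
  shows "query_succeeds m afn_structure xs d \<alpha> \<omega> ops S q"
proof -
  obtain c where run: "run m afn_structure xs d \<alpha> \<omega> ops c"
    by (rule run_exists[OF admissible_query(1)[OF adm]])
  show ?thesis
    unfolding query_succeeds_def length_xs by (rule query_after_run[OF adm run]) (use run sep in blast)
qed

lemma merge_after_run:
  assumes adm: "admissible (set xs) (singletons (set xs)) (ops @ [Merge S S'])"
    and run: "run m afn_structure xs d \<alpha> \<omega> ops c"
  obtains t c' where "op_step m afn_structure xs c (Merge S S') t c'" "t \<le> merge_time"
proof -
  have adm': "admissible (set xs) (singletons (set xs)) ops" "S \<in> reached ops" "S' \<in> reached ops" "S \<noteq> S'"
    using adm by (auto simp: admissible_append)
  obtain s h where c: "c = (s, h)" by (cases c)
  show thesis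
    by (rule merge_step[OF run_inv[OF run[unfolded c] adm'(1)] partition_on_reached[OF adm'(1)] adm'(2-4)])
      (use that c in blast)
qed

lemma merged_clusters_nonempty:
  assumes "admissible (set xs) (singletons (set xs)) (ops @ [Merge S S'])"
  shows "0 < card S" "0 < card S'"
proof -
  have P: "partition_on (set xs) (reached ops)" using partition_on_reached assms
    by (auto simp: admissible_append)
  have "0 < card T" if "T \<in> reached ops" for T
  proof -
    have "T \<subseteq> set xs" "T \<noteq> {}" using P that by (auto simp: partition_on_def)
    then show ?thesis by (auto simp: card_gt_0_iff intro: finite_subset)
  qed
  then show "0 < card S" "0 < card S'" using assms by (auto simp: admissible_append)
qed

end


section \<open>Gaussian projections\<close>

lemma exp_three_halves_le: "exp (3 / 2 :: real) \<le> 9 / 2"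
proof -
  have "exp (3 / 2 :: real) ^ 2 = exp 1 ^ 3"
    by (simp flip: exp_of_nat_mult)
  also have "\<dots> \<le> 2.72 ^ 3" using e_less_272 by (intro power_mono) auto
  also have "\<dots> \<le> (9 / 2 :: real) ^ 2" by (simp add: power2_eq_square power3_eq_cube)
  finally show ?thesis by (rule power2_le_imp_le) simp
qed

lemma std_normal_density_shift_le:
  assumes "0 \<le> x" "x \<le> y"
  shows "std_normal_density y \<le> exp (- x\<^sup>2 / 2) * normal_density x 1 y"
proof -
  have "x * x \<le> x * y" using assms by (intro mult_left_mono)
  then have "- y\<^sup>2 / 2 \<le> - x\<^sup>2 / 2 + - (y - x)\<^sup>2 / 2" by (simp add: power2_eq_square algebra_simps)
  then have "exp (- y\<^sup>2 / 2) \<le> exp (- x\<^sup>2 / 2) * exp (- (y - x)\<^sup>2 / 2)" by (simp flip: exp_add)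
  then show ?thesis by (simp add: normal_density_def divide_right_mono)
qed

lemma std_normal_density_ge:
  assumes "0 \<le> x" "x \<le> y" "y \<le> x + 1 / (1 + x)"
  shows "exp (- x\<^sup>2 / 2) * (2 / 27) \<le> std_normal_density y"
proof -
  define \<delta> where "\<delta> = 1 / (1 + x)"
  have \<delta>: "0 < \<delta>" "\<delta> \<le> 1" "x * \<delta> \<le> 1" using assms(1) by (auto simp: \<delta>_def field_simps)
  have "\<delta> * \<delta> \<le> 1 * 1" using \<delta> by (intro mult_mono) auto
  then have "(x + \<delta>)\<^sup>2 \<le> x\<^sup>2 + 3" using \<delta> by (simp add: power2_eq_square algebra_simps)
  moreover have "y\<^sup>2 \<le> (x + \<delta>)\<^sup>2" using assms by (intro power_mono) (auto simp: \<delta>_def)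
  ultimately have "exp (- x\<^sup>2 / 2 + - (3 / 2)) \<le> exp (- y\<^sup>2 / 2)" by simp
  then have "exp (- x\<^sup>2 / 2) * exp (- (3 / 2)) \<le> exp (- y\<^sup>2 / 2)" by (simp only: exp_add)
  moreover have "exp (- x\<^sup>2 / 2) * (2 / 9) \<le> exp (- x\<^sup>2 / 2) * exp (- (3 / 2))"
    using exp_three_halves_le by (intro mult_left_mono) (simp_all add: exp_minus field_simps)
  ultimately have "exp (- x\<^sup>2 / 2) * (2 / 9) \<le> exp (- y\<^sup>2 / 2)" by linarith
  moreover have "sqrt (2 * pi) \<le> 3"
    by (rule real_le_lsqrt) (use pi_less_4 in auto)
  ultimately have "exp (- x\<^sup>2 / 2) * (2 / 9) / 3 \<le> exp (- y\<^sup>2 / 2) / sqrt (2 * pi)"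
    by (intro frac_le) auto
  then show ?thesis by (simp add: normal_density_def)
qed

context prob_space
begin

lemma std_normal_tail_le:
  assumes X: "distributed M lborel X std_normal_density" and x: "0 \<le> x"
  shows "prob {\<omega> \<in> space M. x \<le> X \<omega>} \<le> exp (- x\<^sup>2 / 2)"
proof -
  let ?c = "exp (- x\<^sup>2 / 2)"
  have "emeasure M {\<omega> \<in> space M. x \<le> X \<omega>} = emeasure M (X -` {x..} \<inter> space M)"
    by (intro arg_cong[where f = "emeasure M"]) auto
  also have "\<dots> = (\<integral>\<^sup>+y. ennreal (std_normal_density y) * indicator {x..} y \<partial>lborel)"
    by (rule distributed_emeasure[OF X]) simp
  also have "\<dots> \<le> (\<integral>\<^sup>+y. ennreal ?c * ennreal (normal_density x 1 y) \<partial>lborel)"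
    using std_normal_density_shift_le[OF x]
    by (intro nn_integral_mono) (auto simp: indicator_def simp flip: ennreal_mult)
  also have "\<dots> = ennreal ?c * (\<integral>\<^sup>+y. ennreal (normal_density x 1 y) \<partial>lborel)"
    by (rule nn_integral_cmult) simp
  also have "(\<integral>\<^sup>+y. ennreal (normal_density x 1 y) \<partial>lborel) = 1"
    using prob_space.emeasure_space_1[OF prob_space_normal_density[of 1 x]] by (simp add: emeasure_density)
  finally show ?thesis by (simp add: emeasure_eq_measure)
qed

lemma std_normal_tail_ge:
  assumes X: "distributed M lborel X std_normal_density" and x: "0 \<le> x"
  shows "exp (- x\<^sup>2 / 2) / (27 / 2 * (1 + x)) \<le> prob {\<omega> \<in> space M. x \<le> X \<omega>}"
proof -
  define k \<delta> where "k = exp (- x\<^sup>2 / 2) * (2 / 27)" and "\<delta> = 1 / (1 + x)"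
  have "0 \<le> k" "0 \<le> \<delta>" using x by (simp_all add: k_def \<delta>_def)
  then have "ennreal (k * \<delta>) = (\<integral>\<^sup>+y. ennreal k * indicator {x..x + \<delta>} y \<partial>lborel)"
    by (simp add: nn_integral_cmult_indicator ennreal_mult)
  also have "\<dots> \<le> (\<integral>\<^sup>+y. ennreal (std_normal_density y) * indicator {x..} y \<partial>lborel)"
    unfolding k_def \<delta>_def using std_normal_density_ge[OF x]
    by (intro nn_integral_mono) (auto simp: indicator_def)
  also have "\<dots> = emeasure M (X -` {x..} \<inter> space M)"
    by (rule distributed_emeasure[OF X, symmetric]) simp
  also have "X -` {x..} \<inter> space M = {\<omega> \<in> space M. x \<le> X \<omega>}" by auto
  finally have "k * \<delta> \<le> prob {\<omega> \<in> space M. x \<le> X \<omega>}" by (simp add: emeasure_eq_measure)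
  then show ?thesis by (simp add: k_def \<delta>_def)
qed

end

interpretation coin: prob_space coin_space
  unfolding coin_space_def by (intro prob_space_PiM prob_space_normal_density) simp

lemma space_coin: "space coin_space = UNIV"
  by (auto simp: coin_space_def space_PiM)

lemma coin_component [measurable]: "(\<lambda>\<omega>. \<omega> i) \<in> coin_space \<rightarrow>\<^sub>M std_normal_distribution"
  unfolding coin_space_def by simp

lemma distr_coin_component: "distr coin_space std_normal_distribution (\<lambda>\<omega>. \<omega> i) = std_normal_distribution"
  unfolding coin_space_def by (rule distr_PiM_component) (auto intro: prob_space_normal_density)

lemma coin_distributed: "distributed coin_space lborel (\<lambda>\<omega>. \<omega> i) std_normal_density"
proof -
  have "distr coin_space lborel (\<lambda>\<omega>. \<omega> i) = distr coin_space std_normal_distribution (\<lambda>\<omega>. \<omega> i)"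
    by (intro distr_cong) auto
  moreover have "(\<lambda>\<omega>. \<omega> i) \<in> coin_space \<rightarrow>\<^sub>M lborel" using coin_component[of i] by (simp add: measurable_def)
  ultimately show ?thesis by (simp add: distributed_def distr_coin_component)
qed

lemma coin_indep: "coin.indep_vars (\<lambda>_. std_normal_distribution) (\<lambda>i \<omega>. \<omega> i) UNIV"
proof -
  have "distr coin_space (\<Pi>\<^sub>M i\<in>UNIV. std_normal_distribution) (\<lambda>x. \<lambda>i\<in>UNIV. x i) = coin_space"
    by (simp add: coin_space_def restrict_def)
  then show ?thesis
    by (subst coin.indep_vars_iff_distr_eq_PiM)
      (auto simp: coin_space_def distr_coin_component[unfolded coin_space_def])
qed

lemma disjoint_family_block: "disjoint_family_on (block d) I"
proof -
  have "block d i \<inter> block d i' = {}" if "i < i'" for i i'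
    using mult_le_mono1[of "Suc i" i' d] that by (auto simp: block_def)
  then show ?thesis unfolding disjoint_family_on_def by (metis Int_commute linorder_neqE_nat)
qed

lemma block_subset_block: "i \<in> block L g \<Longrightarrow> block d i \<subseteq> block (L * d) g"
  using mult_le_mono1[of "g * L" i d] mult_le_mono1[of "Suc i" "g * L + L" d]
  by (auto simp: block_def algebra_simps)

lemma coin_prob_ball_blocks:
  assumes "finite J" "J \<noteq> {}" and meas: "\<And>i. i \<in> J \<Longrightarrow>
      Measurable.pred (PiM (block d i) (\<lambda>_. std_normal_distribution)) (P i)"
    and local: "\<And>i \<omega>. i \<in> J \<Longrightarrow> P i (restrict \<omega> (block d i)) = P i \<omega>"
  shows "coin.prob {\<omega>. \<forall>i\<in>J. P i \<omega>} = (\<Prod>i\<in>J. coin.prob {\<omega>. P i \<omega>})"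
proof -
  let ?M = "\<lambda>i. PiM (block d i) (\<lambda>_. std_normal_distribution)" and ?X = "\<lambda>i \<omega>. restrict \<omega> (block d i)"
  define A where "A i = {x \<in> space (?M i). P i x}" for i
  have "coin.indep_vars ?M ?X J"
    by (rule coin.indep_vars_restrict[OF coin_indep _ disjoint_family_block]) simp
  from coin.indep_varsD_finite[OF this assms(2,1), of A]
  have "coin.prob (\<Inter>i\<in>J. ?X i -` A i) = (\<Prod>i\<in>J. coin.prob (?X i -` A i))"
    using meas by (simp add: space_coin A_def pred_def)
  moreover have "?X i -` A i = {\<omega>. P i \<omega>}" if "i \<in> J" for i
    using local[OF that] by (auto simp: A_def space_PiM)
  moreover from this have "(\<Inter>i\<in>J. ?X i -` A i) = {\<omega>. \<forall>i\<in>J. P i \<omega>}" by auto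
  ultimately show ?thesis by simp
qed

lemma projection_restrict: "block d i \<subseteq> K \<Longrightarrow> projection d z i (restrict \<omega> K) = projection d z i \<omega>"
  unfolding projection_def by (intro sum.cong) (auto simp: block_def subset_iff)

lemma measurable_projection:
  assumes "block d i \<subseteq> K"
  shows "projection d z i \<in> borel_measurable (PiM K (\<lambda>_. std_normal_distribution))"
proof -
  have "(\<lambda>x. x (i * d + j)) \<in> borel_measurable (PiM K (\<lambda>_. std_normal_distribution))" if "j < d" for j
    using measurable_component_singleton[of "i * d + j" K "\<lambda>_. std_normal_distribution"] assms that
    by (auto simp: block_def subset_iff)
  then show ?thesis unfolding projection_def[abs_def] by measurable
qed

lemma measurable_projection_coin [measurable]: "projection d z i \<in> borel_measurable coin_space"
  unfolding coin_space_def by (rule measurable_projection) simp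

lemma projection_diff: "projection d z i \<omega> - projection d z' i \<omega> = projection d (\<lambda>j. z j - z' j) i \<omega>"
  by (simp add: projection_def right_diff_distrib sum_subtractf)

lemma projection_distributed:
  assumes "0 < L2_set z {..<d}"
  shows "distributed coin_space lborel (projection d z i) (normal_density 0 (L2_set z {..<d}))"
proof -
  define J where "J = {j. j < d \<and> z j \<noteq> 0}"
  have sumJ: "(\<Sum>j<d. g j) = (\<Sum>j\<in>J. g j)" if "\<And>j. z j = 0 \<Longrightarrow> g j = 0" for g :: "nat \<Rightarrow> real"
    using that by (intro sum.mono_neutral_right) (auto simp: J_def)
  have norm: "L2_set z {..<d} = sqrt (\<Sum>j\<in>J. \<bar>z j\<bar>\<^sup>2)" unfolding L2_set_def
    using sumJ[of "\<lambda>j. (z j)\<^sup>2"] by simp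
  then have ne: "J \<noteq> {}" using assms by auto
  let ?X = "\<lambda>j \<omega>. \<omega> (i * d + j) * z j"
  have "coin.indep_vars (\<lambda>j. PiM {i * d + j} (\<lambda>_. std_normal_distribution))
      (\<lambda>j \<omega>. restrict (\<lambda>i. \<omega> i) {i * d + j}) J"
    by (rule coin.indep_vars_restrict[OF coin_indep]) (auto simp: disjoint_family_on_def)
  then have "coin.indep_vars (\<lambda>_. borel) (\<lambda>j \<omega>. (\<lambda>x. x (i * d + j) * z j) (restrict (\<lambda>i. \<omega> i) {i * d + j})) J"
    by (rule coin.indep_vars_compose2) simp
  then have "coin.indep_vars (\<lambda>_. borel) ?X J" by simp
  moreover have "distributed coin_space lborel (?X j) (normal_density 0 \<bar>z j\<bar>)" if "j \<in> J" for j
    using coin.normal_density_affine[OF coin_distributed, of "z j" 0 "i * d + j"] that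
    by (simp add: J_def mult.commute)
  ultimately have "distributed coin_space lborel (\<lambda>\<omega>. \<Sum>j\<in>J. ?X j \<omega>)
      (normal_density (\<Sum>j\<in>J. 0) (sqrt (\<Sum>j\<in>J. \<bar>z j\<bar>\<^sup>2)))"
    using ne by (intro coin.sum_indep_normal) (auto simp: J_def)
  moreover have "projection d z i = (\<lambda>\<omega>. \<Sum>j\<in>J. ?X j \<omega>)"
    unfolding projection_def by (rule ext) (auto intro: sumJ)
  ultimately show ?thesis unfolding norm by simp
qed

lemma projection_eq_0: assumes "L2_set z {..<d} = 0" shows "projection d z i \<omega> = 0"
  using assms by (simp add: L2_set_eq_0_iff projection_def)

lemma normalized_projection_distributed:
  assumes "0 < L2_set z {..<d}"
  shows "distributed coin_space lborel (\<lambda>\<omega>. projection d z i \<omega> / L2_set z {..<d}) std_normal_density"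
  using projection_distributed[OF assms, of i] coin.normal_standard_normal_convert[OF assms, of "projection d z i" 0] by simp

lemma prob_projection_tail_le:
  assumes z: "L2_set z {..<d} \<le> \<sigma>" "0 < \<sigma>" and x: "0 \<le> x"
  shows "coin.prob {\<omega>. \<sigma> * x \<le> projection d z i \<omega>} \<le> exp (- x\<^sup>2 / 2)"
proof (cases "x = 0 \<or> L2_set z {..<d} = 0")
  case True
  moreover have "{\<omega>. \<sigma> * x \<le> projection d z i \<omega>} = {}" if "x \<noteq> 0" "L2_set z {..<d} = 0"
    using that z(2) x by (simp add: projection_eq_0 mult_le_0_iff)
  ultimately show ?thesis by (cases "x = 0") auto
next
  case False
  then have pos: "0 < L2_set z {..<d}" by (simp add: less_le)
  let ?Z = "\<lambda>\<omega>. projection d z i \<omega> / L2_set z {..<d}"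
  have "coin.prob {\<omega>. \<sigma> * x \<le> projection d z i \<omega>} \<le> coin.prob {\<omega> \<in> space coin_space. x \<le> ?Z \<omega>}"
  proof (rule coin.finite_measure_mono)
    have "x \<le> ?Z \<omega>" if "\<sigma> * x \<le> projection d z i \<omega>" for \<omega>
      using mult_right_mono[OF z(1) x] that pos by (simp add: field_simps)
    then show "{\<omega>. \<sigma> * x \<le> projection d z i \<omega>} \<subseteq> {\<omega> \<in> space coin_space. x \<le> ?Z \<omega>}"
      by (auto simp: space_coin)
  qed simp
  also have "\<dots> \<le> exp (- x\<^sup>2 / 2)"
    by (rule coin.std_normal_tail_le[OF normalized_projection_distributed[OF pos] x])
  finally show ?thesis .
qed

lemma prob_projection_tail_ge:
  assumes x: "0 \<le> x"
  shows "exp (- x\<^sup>2 / 2) / (27 / 2 * (1 + x)) \<le> coin.prob {\<omega>. L2_set z {..<d} * x \<le> projection d z i \<omega>}"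
proof (cases "L2_set z {..<d} = 0")
  case True
  have "exp (- x\<^sup>2 / 2) / (27 / 2 * (1 + x)) \<le> 1 / 1" using x by (intro frac_le) auto
  then show ?thesis using True coin.prob_space by (simp add: projection_eq_0 space_coin)
next
  case False
  then have pos: "0 < L2_set z {..<d}" by (simp add: less_le)
  from coin.std_normal_tail_ge[OF normalized_projection_distributed[OF pos] x, of i]
  show ?thesis using pos by (simp add: space_coin field_simps)
qed

lemma card_heavy_pairs:
  assumes "finite I" "finite B"
  shows "real (card (heavy_pairs I v B \<Delta>)) = (\<Sum>i\<in>I. \<Sum>w\<in>B. if \<Delta> \<le> v i w then 1 else 0)"
  unfolding heavy_pairs_def using assms by (simp add: sum.If_cases Int_def)

lemma measurable_card_heavy_pairs:
  assumes B: "finite B" and K: "block (L * d) g \<subseteq> K"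
  shows "Measurable.pred (PiM K (\<lambda>_. std_normal_distribution))
    (\<lambda>\<omega>. card (heavy_pairs (block L g) (\<lambda>i w. projection d (z w) i \<omega>) B \<Delta>) < c)"
proof -
  let ?M = "PiM K (\<lambda>_. std_normal_distribution)"
  have "projection d w i \<in> borel_measurable ?M" if "i \<in> block L g" for w i
    using measurable_projection block_subset_block[OF that, of d] K by blast
  then have "Measurable.pred ?M (\<lambda>\<omega>. (\<Sum>i\<in>block L g. \<Sum>w\<in>B. if \<Delta> \<le> projection d (z w) i \<omega> then 1 else 0) < real c)"
    by (intro borel_measurable_pred_less borel_measurable_sum measurable_If) auto
  moreover have "finite (block L g)" by (simp add: block_def)
  ultimately show ?thesis by (simp only: card_heavy_pairs[OF _ B, symmetric] of_nat_less_iff)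
qed

lemma measurable_separates:
  assumes "finite B" and K: "block (L * d) g \<subseteq> K"
  shows "Measurable.pred (PiM K (\<lambda>_. std_normal_distribution)) (\<lambda>\<omega>. separates L (\<lambda>i w. projection d (z w) i \<omega>) y B \<Delta> g)"
proof -
  have "projection d w i \<in> borel_measurable (PiM K (\<lambda>_. std_normal_distribution))"
    if "i \<in> block L g" for w i
    using measurable_projection block_subset_block[OF that, of d] K by blast
  then have "Measurable.pred (PiM K (\<lambda>_. std_normal_distribution)) (\<lambda>\<omega>. \<exists>i\<in>block L g. \<Delta> \<le>
      projection d (z y) i \<omega>)"
    by (intro pred_intros_finite) (auto simp: block_def)
  then show ?thesis unfolding separates_def by (intro pred_intros_logic measurable_card_heavy_pairs assms)
qed

lemma separates_restrict:
  "separates L (\<lambda>i w. projection d (z w) i (restrict \<omega> (block (L * d) g))) y B \<Delta> g =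
    separates L (\<lambda>i w. projection d (z w) i \<omega>) y B \<Delta> g"
proof -
  have "projection d (z w) i (restrict \<omega> (block (L * d) g)) = projection d (z w) i \<omega>"
    if "i \<in> block L g" for i w
    by (rule projection_restrict[OF block_subset_block[OF that]])
  then show ?thesis unfolding separates_def heavy_pairs_def by (simp cong: Sigma_cong)
qed

lemma prob_all_light_le:
  assumes p: "\<And>i. p \<le> coin.prob {\<omega>. \<Delta> \<le> projection d z i \<omega>}" and L: "0 < L"
  shows "coin.prob {\<omega>. \<forall>i\<in>block L g. projection d z i \<omega> < \<Delta>} \<le> exp (- (p * real L))"
proof -
  have "coin.prob {\<omega>. \<forall>i\<in>block L g. projection d z i \<omega> < \<Delta>} =
      (\<Prod>i\<in>block L g. coin.prob {\<omega>. projection d z i \<omega> < \<Delta>})"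
  proof (rule coin_prob_ball_blocks)
    have "projection d z i \<in> borel_measurable (PiM (block d i) (\<lambda>_. std_normal_distribution))" for i
      by (rule measurable_projection) simp
    then show "Measurable.pred (PiM (block d i) (\<lambda>_. std_normal_distribution)) (\<lambda>\<omega>. projection d z i \<omega> < \<Delta>)" for i
      by measurable
  qed (use L in \<open>auto simp: block_def projection_restrict\<close>)
  also have "\<dots> \<le> (\<Prod>i\<in>block L g. exp (- p))"
  proof (intro prod_mono conjI)
    fix i
    have "coin.prob {\<omega> \<in> space coin_space. \<not> \<Delta> \<le> projection d z i \<omega>} =
        1 - coin.prob {\<omega> \<in> space coin_space. \<Delta> \<le> projection d z i \<omega>}"
      by (rule coin.prob_neg) measurable
    then have "coin.prob {\<omega>. projection d z i \<omega> < \<Delta>} \<le> 1 + - p" using p[of i]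
      by (simp add: space_coin not_le)
    also have "\<dots> \<le> exp (- p)" by (rule exp_ge_add_one_self)
    finally show "coin.prob {\<omega>. projection d z i \<omega> < \<Delta>} \<le> exp (- p)" .
  qed simp
  also have "\<dots> = exp (- (p * real L))" by (simp add: block_def mult.commute flip: exp_of_nat_mult)
  finally show ?thesis .
qed

lemma prob_many_heavy_pairs_le:
  assumes B: "finite B" "card B \<le> N" and L: "0 < L"
    and heavy: "\<And>w i. w \<in> B \<Longrightarrow> coin.prob {\<omega>. \<Delta> \<le> projection d (z w) i \<omega>} \<le> 1 / real N"
  shows "coin.prob {\<omega>. 4 * L \<le> card (heavy_pairs (block L g) (\<lambda>i w. projection d (z w) i \<omega>) B \<Delta>)} \<le> 1 / 4"
proof -
  let ?ind = "\<lambda>i w \<omega>. if \<Delta> \<le> projection d (z w) i \<omega> then 1 else 0 :: real"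
  let ?count = "\<lambda>\<omega>. \<Sum>i\<in>block L g. \<Sum>w\<in>B. ?ind i w \<omega>"
  have fin: "finite (block L g)" "card (block L g) = L" by (auto simp: block_def)
  have int: "integrable coin_space (?ind i w)" for i w
    by (rule coin.integrable_const_bound[of _ 1]) auto
  have expect: "(\<integral>\<omega>. ?ind i w \<omega> \<partial>coin_space) = coin.prob {\<omega>. \<Delta> \<le> projection d (z w) i \<omega>}" for i w
  proof -
    have "?ind i w = indicator {\<omega> \<in> space coin_space. \<Delta> \<le> projection d (z w) i \<omega>}"
      by (auto simp: indicator_def space_coin)
    then show ?thesis by (simp add: space_coin)
  qed
  have "coin.prob {\<omega> \<in> space coin_space. real (4 * L) \<le> ?count \<omega>} \<le>
      (\<integral>\<omega>. ?count \<omega> \<partial>coin_space) / real (4 * L)"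
    using L int by (intro integral_Markov_inequality_measure[of _ _ "{}"])
      (auto intro!: sum_nonneg Bochner_Integration.integrable_sum)
  also have "(\<integral>\<omega>. ?count \<omega> \<partial>coin_space) = (\<Sum>i\<in>block L g. \<Sum>w\<in>B. coin.prob {\<omega>. \<Delta> \<le> projection d (z w) i \<omega>})"
    using int by (simp add: expect)
  also have "\<dots> \<le> (\<Sum>i\<in>block L g. \<Sum>w\<in>B. 1 / real N)" using heavy by (intro sum_mono) auto
  also have "\<dots> = real L * (real (card B) / real N)" using fin by simp
  also have "\<dots> \<le> real L * 1" using B(2) by (intro mult_left_mono) (auto simp: divide_le_eq_1)
  finally have "coin.prob {\<omega> \<in> space coin_space. real (4 * L) \<le> ?count \<omega>} \<le> 1 / 4"
    using L by (simp add: divide_right_mono)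
  then show ?thesis by (simp only: card_heavy_pairs[OF fin(1) B(1), symmetric] of_nat_le_iff space_coin) simp
qed

lemma exp_minus_2_le: "exp (- 2 :: real) \<le> 1 / 4"
proof -
  have "(2::real) * 2 \<le> exp 1 * exp 1" using exp_ge_add_one_self[of 1] by (intro mult_mono) auto
  then have "4 \<le> exp (2::real)" by (simp flip: exp_add)
  then show ?thesis by (simp add: exp_minus field_simps)
qed

lemma prob_not_separates_le:
  assumes B: "finite B" "card B \<le> N" and L: "0 < L"
    and far: "\<And>i. 2 / real L \<le> coin.prob {\<omega>. \<Delta> \<le> projection d (z y) i \<omega>}"
    and near: "\<And>w i. w \<in> B \<Longrightarrow> coin.prob {\<omega>. \<Delta> \<le> projection d (z w) i \<omega>} \<le> 1 / real N"
  shows "coin.prob {\<omega>. \<not> separates L (\<lambda>i w. projection d (z w) i \<omega>) y B \<Delta> g} \<le> 1 / 2"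
proof -
  let ?E1 = "{\<omega>. \<forall>i\<in>block L g. projection d (z y) i \<omega> < \<Delta>}"
  let ?E2 = "{\<omega>. 4 * L \<le> card (heavy_pairs (block L g) (\<lambda>i w. projection d (z w) i \<omega>) B \<Delta>)}"
  have "coin.prob ?E1 \<le> exp (- 2)"
    using prob_all_light_le[OF far L, of g] L by simp
  then have "coin.prob ?E1 \<le> 1 / 4" using exp_minus_2_le by linarith
  moreover have "coin.prob ?E2 \<le> 1 / 4" by (rule prob_many_heavy_pairs_le[OF B L near])
  moreover have "{\<omega>. \<not> separates L (\<lambda>i w. projection d (z w) i \<omega>) y B \<Delta> g} = ?E1 \<union> ?E2"
    by (auto simp: separates_def not_le not_less)
  moreover have "coin.prob (?E1 \<union> ?E2) \<le> coin.prob ?E1 + coin.prob ?E2"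
  proof (rule measure_Un_le)
    have "{\<omega> \<in> space coin_space. \<forall>i\<in>block L g. projection d (z y) i \<omega> < \<Delta>} \<in> sets coin_space"
      by (rule sets.sets_Collect_finite_All) (auto simp: block_def)
    then show "?E1 \<in> sets coin_space" by (simp add: space_coin)
    have "{\<omega> \<in> space coin_space. \<not> card (heavy_pairs (block L g) (\<lambda>i w. projection d (z w) i \<omega>) B \<Delta>) < 4 * L} \<in> sets coin_space"
      using measurable_card_heavy_pairs[OF B(1), of L d g UNIV z \<Delta> "4 * L"]
      by (intro sets.sets_Collect_neg) (simp add: coin_space_def pred_def)
    then show "?E2 \<in> sets coin_space" by (simp add: space_coin not_less)
  qed
  ultimately show ?thesis by simp
qed

lemma prob_never_separates_le:
  assumes B: "finite B" and G: "0 < G"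
    and half: "\<And>g. coin.prob {\<omega>. \<not> separates L (\<lambda>i w. projection d (z w) i \<omega>) y B \<Delta> g} \<le> 1 / 2"
  shows "coin.prob {\<omega>. \<forall>g<G. \<not> separates L (\<lambda>i w. projection d (z w) i \<omega>) y B \<Delta> g} \<le> (1 / 2) ^ G"
proof -
  let ?fail = "\<lambda>g \<omega>. \<not> separates L (\<lambda>i w. projection d (z w) i \<omega>) y B \<Delta> g"
  have "coin.prob {\<omega>. \<forall>g\<in>{..<G}. ?fail g \<omega>} = (\<Prod>g<G. coin.prob {\<omega>. ?fail g \<omega>})"
  proof (rule coin_prob_ball_blocks)
    show "Measurable.pred (PiM (block (L * d) g) (\<lambda>_. std_normal_distribution)) (?fail g)" for g
      by (intro pred_intros_logic measurable_separates[OF B]) simp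
  qed (use G in \<open>auto simp: separates_restrict\<close>)
  also have "\<dots> \<le> (\<Prod>g<G. 1 / 2)" using half by (intro prod_mono) auto
  finally show ?thesis by (simp add: Ball_def)
qed


section \<open>Failure probability\<close>

context afn_input
begin

definition offset :: "point \<Rightarrow> nat \<Rightarrow> nat \<Rightarrow> real" where
  "offset q x j = xs ! x ! j - q ! j"

lemma L2_set_offset: "q \<in> set xs \<Longrightarrow> L2_set (offset q x) {..<d} = l2 q (xs ! x)"
  by (simp add: l2_def L2_set_def offset_def dims power2_commute)

lemma separated_iff:
  assumes "q \<in> set xs"
  shows "separated S q \<omega> \<longleftrightarrow> (\<exists>g<3 * b. \<exists>\<Delta>. \<exists>y\<in>positions S - near S q.
    separates group_dirs (\<lambda>i x. projection d (offset q x) i \<omega>) y (near S q) \<Delta> g)"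
  using assms by (simp add: separated_def point_proj_def projection_diff nth_position offset_def[abs_def])

text \<open>
  With this threshold a fixed near point is heavy with probability at most \<open>1 / 2 ^ b < 1 / n\<close>, and the
  farthest point with probability about \<open>2 powr (- b / \<alpha>\<^sup>2)\<close>, which is at least \<open>1 / W\<close>.
\<close>

definition threshold :: real where
  "threshold = sqrt (2 * real b * ln 2)"

lemma threshold_pos: "0 < threshold"
  using b_pos by (simp add: threshold_def)

lemma threshold_power2: "threshold\<^sup>2 = 2 * real b * ln 2"
  by (simp add: threshold_def)

lemma threshold_le: "1 + threshold \<le> 23 / 10 * real b"
proof -
  have b1: "1 \<le> real b" using b_pos by simp
  have "2 * real b * ln 2 \<le> 2 * real b * (25 / 36)" using ln2_le_25_over_36 by (intro mult_left_mono) auto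
  also have "\<dots> \<le> 169 / 100 * (real b * 1)" by simp
  also have "\<dots> \<le> 169 / 100 * (real b * real b)" using b1 by (intro mult_left_mono) auto
  also have "\<dots> = (13 / 10 * real b)\<^sup>2" by (simp add: power2_eq_square)
  finally have "threshold \<le> 13 / 10 * real b" unfolding threshold_def by (intro real_le_lsqrt) auto
  then show ?thesis using b1 by linarith
qed

lemma near_heavy_probability:
  assumes "L2_set z {..<d} \<le> \<sigma>" "0 < \<sigma>"
  shows "coin.prob {\<omega>. \<sigma> * threshold \<le> projection d z i \<omega>} \<le> 1 / real (2 ^ b)"
proof -
  have "coin.prob {\<omega>. \<sigma> * threshold \<le> projection d z i \<omega>} \<le> exp (- threshold\<^sup>2 / 2)"
    using prob_projection_tail_le[OF assms, of threshold] threshold_pos by simp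
  also have "\<dots> = exp (- (real b * ln 2))" by (simp add: threshold_power2)
  also have "\<dots> = 1 / exp (ln 2) ^ b" by (simp add: exp_minus exp_of_nat_mult inverse_eq_divide)
  finally show ?thesis by simp
qed

lemma far_heavy_probability:
  "2 / real group_dirs \<le> coin.prob {\<omega>. L2_set z {..<d} * (threshold / \<alpha>) \<le> projection d z i \<omega>}"
proof -
  let ?x = "threshold / \<alpha>"
  have x_nonneg: "0 \<le> ?x" using threshold_pos \<alpha> by simp
  have "?x \<le> threshold" using threshold_pos \<alpha> by (simp add: field_simps)
  then have x_le: "1 + ?x \<le> 23 / 10 * real b" using threshold_le by linarith
  have "?x\<^sup>2 / 2 = real b / \<alpha>\<^sup>2 * ln 2" by (simp add: threshold_power2 power_divide)
  also have "\<dots> \<le> real e * ln 2" using e_lower \<alpha> by (intro mult_right_mono) (auto simp: field_simps)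
  finally have "exp (?x\<^sup>2 / 2) \<le> exp (real e * ln 2)" by simp
  also have "\<dots> = real W" using W_eq by (simp add: exp_of_nat_mult)
  finally have "27 / 2 * (1 + ?x) * exp (?x\<^sup>2 / 2) \<le> 27 / 2 * (23 / 10 * real b) * real W"
    using x_le x_nonneg by (intro mult_mono) auto
  also have "\<dots> \<le> 32 * real b * real W" using b_pos W_pos by simp
  finally have "27 / 2 * (1 + ?x) * exp (?x\<^sup>2 / 2) \<le> real group_dirs / 2"
    by (simp add: group_dirs_def mult.commute mult.left_commute)
  then have "1 / (real group_dirs / 2) \<le> 1 / (27 / 2 * (1 + ?x) * exp (?x\<^sup>2 / 2))"
    using x_nonneg by (intro frac_le mult_pos_pos) auto
  also have "\<dots> = exp (- ?x\<^sup>2 / 2) / (27 / 2 * (1 + ?x))" by (simp add: exp_minus field_simps)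
  also have "\<dots> \<le> coin.prob {\<omega>. L2_set z {..<d} * ?x \<le> projection d z i \<omega>}"
    by (rule prob_projection_tail_ge[OF x_nonneg])
  finally show ?thesis by simp
qed

lemma farthest_position:
  assumes "S \<subseteq> set xs" "S \<noteq> {}"
  obtains y where "y \<in> positions S - near S q" "l2 q (xs ! y) = Max (l2 q ` S)"
proof -
  have "finite S" using assms(1) by (rule finite_subset) simp
  then have "Max (l2 q ` S) \<in> l2 q ` S" using assms(2) by (intro Max_in) auto
  then obtain p where p: "p \<in> S" "l2 q p = Max (l2 q ` S)" by auto
  have "0 \<le> l2 q p" by (simp add: l2_def)
  then have "l2 q p / \<alpha> \<le> l2 q p" using \<alpha> mult_right_mono[of 1 \<alpha> "l2 q p"] by (simp add: field_simps)
  moreover have "p \<in> set xs" using p(1) assms(1) by auto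
  ultimately show thesis
    using that[of "position xs p"] p position_in_positions[of p S] by (simp add: near_def nth_position)
qed

lemma half_power_3b_le: "(1 / 2) ^ (3 * b) \<le> 1 / real n ^ 3"
proof -
  have "real n < real (2 ^ b)" using n_upper by (simp only: of_nat_less_iff)
  then have "real n ^ 3 \<le> (2 ^ b) ^ 3" by (intro power_mono) auto
  then have "1 / (2 ^ b) ^ 3 \<le> 1 / real n ^ 3" using n_pos by (intro divide_left_mono) auto
  then show ?thesis by (simp add: power_divide mult.commute flip: power_mult)
qed

lemma failure_probability:
  assumes S: "S \<subseteq> set xs" "S \<noteq> {}" and q: "q \<in> set xs"
  obtains E where "E \<in> sets coin_space" "{\<omega>. \<not> separated S q \<omega>} \<subseteq> E" "measure coin_space E \<le> 1 / real n ^ 3"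
proof -
  obtain y where y: "y \<in> positions S - near S q" "l2 q (xs ! y) = Max (l2 q ` S)"
    by (rule farthest_position[OF S])
  let ?B = "near S q" and ?\<sigma> = "l2 q (xs ! y) / \<alpha>"
  let ?sep = "\<lambda>g \<omega>. separates group_dirs (\<lambda>i x. projection d (offset q x) i \<omega>) y ?B (?\<sigma> * threshold) g"
  define E where "E = {\<omega>. \<forall>g<3 * b. \<not> ?sep g \<omega>}"
  have sub: "?B \<subseteq> {..<n}" by (auto simp: near_def positions_def)
  then have B: "finite ?B" "card ?B \<le> 2 ^ b"
    using finite_subset card_mono[OF _ sub] n_upper by fastforce+
  have "Measurable.pred coin_space (?sep g)" for g
    unfolding coin_space_def by (rule measurable_separates[OF B(1)]) simp
  then have "{\<omega> \<in> space coin_space. \<forall>g\<in>{..<3 * b}. \<not> ?sep g \<omega>} \<in> sets coin_space"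
    by (intro sets.sets_Collect_finite_All sets.sets_Collect_neg) (auto simp: pred_def)
  then have "E \<in> sets coin_space" by (simp add: E_def space_coin Ball_def)
  moreover have "{\<omega>. \<not> separated S q \<omega>} \<subseteq> E" using y(1) by (auto simp: E_def separated_iff[OF q])
  moreover have "coin.prob {\<omega>. \<not> ?sep g \<omega>} \<le> 1 / 2" for g
  proof (rule prob_not_separates_le[OF B group_dirs_pos])
    show "2 / real group_dirs \<le> coin.prob {\<omega>. ?\<sigma> * threshold \<le> projection d (offset q y) i \<omega>}" for i
      using far_heavy_probability[of "offset q y" i] by (simp add: L2_set_offset[OF q] mult.commute)
    show "coin.prob {\<omega>. ?\<sigma> * threshold \<le> projection d (offset q w) i \<omega>} \<le> 1 / real (2 ^ b)"
      if "w \<in> ?B" for w i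
    proof (rule near_heavy_probability)
      show "L2_set (offset q w) {..<d} \<le> ?\<sigma>" using that y(2) by (simp add: near_def L2_set_offset[OF q])
      have "0 \<le> l2 q (xs ! w)" by (simp add: l2_def)
      then show "0 < ?\<sigma>" using that y(2) by (simp add: near_def)
    qed
  qed
  then have "measure coin_space E \<le> (1 / 2) ^ (3 * b)"
    unfolding E_def using b_pos by (intro prob_never_separates_le B(1)) auto
  then have "measure coin_space E \<le> 1 / real n ^ 3" using half_power_3b_le by (rule order_trans)
  ultimately show thesis using that by blast
qed

end


section \<open>Asymptotics\<close>

context layout
begin

definition budget :: nat where "budget = 200000 * ((b + d) ^ 4 * W)"

lemma power_W_mono: "k \<le> l \<Longrightarrow> (b + d) ^ k * W \<le> (b + d) ^ l * W"
  using b_pos by (intro mult_le_mono1 power_increasing) auto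

lemma one_le_power_W: "1 \<le> (b + d) ^ k * W"
  using b_pos W_pos by (simp add: Suc_le_eq)

lemma sum_le_power_W: "b + d \<le> (b + d) ^ 4 * W"
proof -
  have "b + d \<le> (b + d) * W" using W_pos by simp
  also have "\<dots> \<le> (b + d) ^ 4 * W" using power_W_mono[of 1 4] by simp
  finally show ?thesis .
qed

lemma size_bounds:
  "dirs \<le> 192 * ((b + d) ^ 2 * W)" "slots \<le> 320 * ((b + d) ^ 2 * W)" "pops \<le> 256 * ((b + d) ^ 2 * W)"
proof -
  have "b * b * W \<le> (b + d) ^ 2 * W" unfolding power2_eq_square by (intro mult_le_mono) auto
  moreover have "dirs = 192 * (b * b * W)" "slots = 320 * (b * b * W)" "pops = 256 * (b * b * W)"
    by (simp_all add: dirs_def slots_def pops_def group_dirs_def)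
  ultimately show "dirs \<le> 192 * ((b + d) ^ 2 * W)" "slots \<le> 320 * ((b + d) ^ 2 * W)"
    "pops \<le> 256 * ((b + d) ^ 2 * W)"
    by linarith+
qed

lemma space_le_budget: "queue + 2 * slots + 2 ^ b < budget * n"
proof -
  let ?s = "b + d"
  define U where "U = ?s ^ 4 * W * n"
  have n: "1 \<le> n" using n_pos by simp
  have s: "?s * n \<le> U" unfolding U_def by (intro mult_le_mono1 sum_le_power_W)
  have "trees \<le> ?s * n" "n * d \<le> ?s * n" by (simp_all add: trees_def algebra_simps)
  moreover have "dirs * trees \<le> 192 * U"
  proof -
    have "dirs * trees \<le> 192 * (?s ^ 2 * W) * (?s * n)"
      using size_bounds(1) \<open>trees \<le> ?s * n\<close> by (intro mult_le_mono)
    also have "\<dots> = 192 * (?s ^ 3 * W * n)" by (simp add: power2_eq_square power3_eq_cube)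
    also have "\<dots> \<le> 192 * U" unfolding U_def by (intro mult_le_mono2 mult_le_mono1 power_W_mono) simp
    finally show ?thesis .
  qed
  moreover have "slots \<le> 320 * U"
  proof -
    have "slots \<le> 320 * (?s ^ 4 * W)" using size_bounds(2) power_W_mono[of 2 4] by linarith
    also have "?s ^ 4 * W \<le> U" using n by (simp add: U_def)
    finally show ?thesis by simp
  qed
  moreover have "2 ^ b \<le> 2 * n" using n_lower b_pos by (cases b) auto
  moreover have "1 \<le> ?s" using b_pos by simp
  then have "n \<le> ?s * n" by simp
  moreover have "budget * n = 200000 * U" by (simp add: budget_def U_def)
  ultimately show ?thesis using s n unfolding queue_def winners_def by linarith
qed

end

lemma (in projected) query_time_le_budget: "query_time \<le> budget"
proof -
  let ?s = "b + d"
  have "pop_time + 2 \<le> 218 * ?s" using b_pos by (simp add: pop_time_def depth_def)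
  then have "pops * (pop_time + 2) \<le> 256 * (?s ^ 2 * W) * (218 * ?s)" using size_bounds(3)
    by (intro mult_le_mono)
  also have "\<dots> = 55808 * (?s ^ 3 * W)" by (simp add: power2_eq_square power3_eq_cube)
  finally have "group_time + 2 \<le> 59337 * (?s ^ 3 * W)"
    using size_bounds(2) power_W_mono[of 2 3] one_le_power_W[of 3] unfolding group_time_def by linarith
  then have "3 * b * (group_time + 2) \<le> 3 * ?s * (59337 * (?s ^ 3 * W))" by (intro mult_le_mono) auto
  also have "\<dots> = 178011 * (?s ^ 4 * W)" by (simp add: power_numeral_reduce)
  finally show ?thesis using one_le_power_W[of 4] unfolding query_time_def budget_def by linarith
qed

lemma (in projected) merge_time_le_budget: "merge_time \<le> budget"
proof -
  let ?s = "b + d"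
  have "16 + dirs * 8 \<le> 1552 * (?s ^ 2 * W)" using size_bounds(1) one_le_power_W[of 2] by linarith
  then have "b * (16 + dirs * 8) \<le> ?s * (1552 * (?s ^ 2 * W))" by (intro mult_le_mono) auto
  also have "\<dots> = 1552 * (?s ^ 3 * W)" by (simp add: power2_eq_square power3_eq_cube)
  finally show ?thesis using one_le_power_W[of 4] power_W_mono[of 3 4]
    unfolding merge_time_def budget_def by linarith
qed

lemma (in afn) init_time_le_budget: "init_time \<le> budget * n"
proof -
  let ?s = "b + d"
  define U where "U = ?s ^ 4 * W * n"
  have n: "1 \<le> n" using n_pos by simp
  have s: "1 \<le> ?s" "?s \<le> ?s * n" "n \<le> ?s * n" "d * n \<le> ?s * n" using b_pos n by simp_all
  have "row_time + 2 = 7 + n * 3 + d * 5 + d * n * 3" by (simp add: row_time_def algebra_simps)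
  then have "row_time + 2 \<le> 18 * (?s * n)" using s by linarith
  then have "dirs * (row_time + 2) \<le> 192 * (?s ^ 2 * W) * (18 * (?s * n))" using size_bounds(1)
    by (intro mult_le_mono)
  also have "\<dots> = 3456 * (?s ^ 3 * W * n)" by (simp add: power2_eq_square power3_eq_cube)
  also have "\<dots> \<le> 3456 * U" unfolding U_def by (intro mult_le_mono2 mult_le_mono1 power_W_mono) simp
  finally have "dirs * (row_time + 2) \<le> 3456 * U" .
  moreover have "?s * n \<le> U" unfolding U_def by (intro mult_le_mono1 sum_le_power_W)
  moreover have "budget * n = 200000 * U" by (simp add: budget_def U_def)
  ultimately show ?thesis using s unfolding init_time_def by linarith
qed

lemma bit_length_le:
  assumes "1 \<le> n" shows "real (floorlog 2 n) \<le> 2 * log 2 (real n + 1)"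
proof -
  have "real (floorlog 2 n) \<le> log 2 (real n) + 1" using assms by (simp add: floorlog_def)
  moreover have "log 2 (real n) \<le> log 2 (real n + 1)" "1 \<le> log 2 (real n + 1)" using assms by simp_all
  ultimately show ?thesis by linarith
qed

lemma two_power_scale_le:
  fixes \<alpha> :: real
  assumes \<alpha>: "1 < \<alpha>" and b: "2 ^ b \<le> 2 * real n"
  shows "2 ^ nat \<lceil>real b / \<alpha>\<^sup>2\<rceil> \<le> 4 * real n powr (1 / \<alpha>\<^sup>2)"
proof -
  define e where "e = nat \<lceil>real b / \<alpha>\<^sup>2\<rceil>"
  have "real e \<le> 1 + real b * (1 / \<alpha>\<^sup>2)" unfolding e_def by simp linarith
  then have "(2::real) powr real e \<le> 2 powr (1 + real b * (1 / \<alpha>\<^sup>2))" by (intro powr_mono) auto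
  also have "\<dots> = 2 * (2 ^ b) powr (1 / \<alpha>\<^sup>2)" by (simp add: powr_add powr_powr flip: powr_realpow)
  also have "\<dots> \<le> 2 * (2 * real n) powr (1 / \<alpha>\<^sup>2)" using b by (intro mult_left_mono powr_mono2) auto
  also have "\<dots> = 2 * (2 powr (1 / \<alpha>\<^sup>2) * real n powr (1 / \<alpha>\<^sup>2))" by (simp add: powr_mult)
  also have "\<dots> \<le> 2 * (2 powr 1 * real n powr (1 / \<alpha>\<^sup>2))"
    using \<alpha> by (intro mult_left_mono mult_right_mono powr_mono) (auto simp: divide_le_eq_1 one_le_power)
  finally show ?thesis by (simp add: powr_realpow flip: e_def)
qed

lemma exists_layout:
  fixes \<alpha> C :: real
  assumes \<alpha>: "1 < \<alpha>" and n: "1 \<le> n" and d: "real d \<le> C * log 2 (real n + 1)"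
  obtains b e where "layout n b (2 ^ e)" "real b \<le> real e * \<alpha>\<^sup>2" "\<forall>k<e. real k * \<alpha>\<^sup>2 < real b"
    "real (layout.budget d b (2 ^ e)) \<le> polylog (800000 * (2 + C) ^ 4) 4 n * real n powr (1 / \<alpha>\<^sup>2)"
proof -
  define b where "b = floorlog 2 n"
  define e where "e = nat \<lceil>real b / \<alpha>\<^sup>2\<rceil>"
  have \<alpha>2: "1 < \<alpha>\<^sup>2" using \<alpha> by (simp add: one_less_power)
  have bits: "2 ^ (b - 1) \<le> n" "n < 2 ^ b" using floorlog_bounds[of n 2] n by (simp_all add: b_def)
  have b0: "0 < b" using bits(2) n by (cases b) auto
  have two: "2 ^ b \<le> 2 * real n"
  proof -
    have "2 ^ b \<le> 2 * n" using bits(1) b0 by (cases b) auto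
    then have "real (2 ^ b) \<le> real (2 * n)" by (simp only: of_nat_le_iff)
    then show ?thesis by simp
  qed
  have "real b / \<alpha>\<^sup>2 \<le> real b" using \<alpha>2 by (simp add: divide_le_eq mult_le_cancel_left1)
  then have "e \<le> b" by (simp add: e_def ceiling_le_iff nat_le_iff)
  then have "layout n b (2 ^ e)" by unfold_locales (use b0 bits in \<open>auto intro: power_increasing\<close>)
  moreover have "real b \<le> real e * \<alpha>\<^sup>2"
  proof -
    have "real b / \<alpha>\<^sup>2 \<le> real e" by (simp add: e_def real_nat_ceiling_ge)
    then show ?thesis using \<alpha> \<alpha>2 by (simp add: pos_divide_le_eq)
  qed
  moreover have "real k * \<alpha>\<^sup>2 < real b" if "k < e" for k
  proof -
    have "real k < real b / \<alpha>\<^sup>2" using that by (simp add: e_def less_ceiling_iff zless_nat_eq_int_zless)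
    then show ?thesis using \<alpha> \<alpha>2 by (simp add: pos_less_divide_eq)
  qed
  moreover have "real (layout.budget d b (2 ^ e)) \<le> polylog (800000 * (2 + C) ^ 4) 4 n *
      real n powr (1 / \<alpha>\<^sup>2)"
  proof -
    have "real (b + d) \<le> (2 + C) * log 2 (real n + 1)" using bit_length_le[OF n] d
      by (simp add: b_def algebra_simps)
    then have "real (b + d) ^ 4 \<le> ((2 + C) * log 2 (real n + 1)) ^ 4" by (intro power_mono) auto
    moreover have "real (2 ^ e) \<le> 4 * real n powr (1 / \<alpha>\<^sup>2)" using two_power_scale_le[OF \<alpha> two]
      by (simp add: e_def)
    ultimately have "real (b + d) ^ 4 * real (2 ^ e) \<le> ((2 + C) * log 2 (real n + 1)) ^ 4 *
        (4 * real n powr (1 / \<alpha>\<^sup>2))"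
      by (intro mult_mono) auto
    then show ?thesis by (simp add: layout.budget_def[OF \<open>layout n b (2 ^ e)\<close>] polylog_def power_mult_distrib mult_ac)
  qed
  ultimately show thesis using that by blast
qed

lemma exists_afn_input:
  fixes \<alpha> C :: real
  assumes \<alpha>: "1 < \<alpha>" and n: "1 \<le> n" and d: "real d \<le> C * log 2 (real n + 1)"
    and xs: "length xs = n" "distinct xs" "\<forall>p\<in>set xs. length p = d"
    and m: "m = nat \<lfloor>polylog (800000 * (2 + C) ^ 4) 4 n * real n powr (1 + 1 / \<alpha>\<^sup>2)\<rfloor>"
  obtains b W e where "afn_input n d b W m \<alpha> e xs"
    "real (layout.budget d b W) \<le> polylog (800000 * (2 + C) ^ 4) 4 n * real n powr (1 / \<alpha>\<^sup>2)"
    "real (layout.budget d b W * n) \<le> polylog (800000 * (2 + C) ^ 4) 4 n * real n powr (1 + 1 / \<alpha>\<^sup>2)"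
proof -
  let ?K = "polylog (800000 * (2 + C) ^ 4) 4 n"
  obtain b e where layout: "layout n b (2 ^ e)" and e: "real b \<le> real e * \<alpha>\<^sup>2" "\<forall>k<e. real k * \<alpha>\<^sup>2 < real b"
    and budget: "real (layout.budget d b (2 ^ e)) \<le> ?K * real n powr (1 / \<alpha>\<^sup>2)"
    by (rule exists_layout[OF \<alpha> n d])
  interpret layout n d b "2 ^ e" by (rule layout)
  have init: "real (budget * n) \<le> ?K * real n powr (1 + 1 / \<alpha>\<^sup>2)"
    using mult_right_mono[OF budget, of "real n"] n by (simp add: powr_add mult_ac)
  then have "budget * n \<le> m" unfolding m by linarith
  then have "queue + 2 * slots + 2 ^ b < m" by (rule less_le_trans[OF space_le_budget])
  then have "afn_input n d b (2 ^ e) m \<alpha> e xs" by unfold_locales (use xs \<alpha> e in auto)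
  then show thesis using budget init by (rule that)
qed

context afn
begin

lemma initialize_within_budget:
  "\<exists>t s. big_step m (initialize afn_structure) (start xs d \<alpha> \<omega>) t s \<and> t \<le> budget * n"
proof -
  obtain t s where "big_step m init_prog (start xs d \<alpha> \<omega>) t s" "t \<le> init_time" by (rule initialize_step)
  then show ?thesis using order_trans[OF _ init_time_le_budget] by (auto simp: afn_structure_def)
qed

lemma query_within_budget:
  assumes "admissible (set xs) (singletons (set xs)) (ops @ [Query S q])"
    "run m afn_structure xs d \<alpha> \<omega> ops c"
  shows "\<exists>t c'. op_step m afn_structure xs c (Query S q) t c' \<and> t \<le> budget"
  by (rule query_after_run[OF assms]) (blast intro: order_trans[OF _ query_time_le_budget])

lemma merge_within_budget:
  assumes "admissible (set xs) (singletons (set xs)) (ops @ [Merge S S'])"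
    "run m afn_structure xs d \<alpha> \<omega> ops c"
  shows "\<exists>t c'. op_step m afn_structure xs c (Merge S S') t c' \<and> t \<le> budget"
  by (rule merge_after_run[OF assms]) (blast intro: order_trans[OF _ merge_time_le_budget])

lemma query_failure_probability:
  assumes adm: "admissible (set xs) (singletons (set xs)) (ops @ [Query S q])"
  shows "\<exists>E\<in>sets coin_space. {\<omega>. \<not> query_succeeds m afn_structure xs d \<alpha> \<omega> ops S q} \<subseteq> E \<and>
    measure coin_space E \<le> 1 / real n ^ 3"
proof -
  obtain E where "E \<in> sets coin_space" "{\<omega>. \<not> separated S q \<omega>} \<subseteq> E" "measure coin_space E \<le> 1 / real n ^ 3"
    by (rule failure_probability[OF admissible_query(3-5)[OF adm]])
  moreover have "query_succeeds m afn_structure xs d \<alpha> \<omega>' ops S q" if "separated S q \<omega>'" for \<omega>'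
  proof -
    interpret drawn: afn n d b W m \<alpha> e xs \<omega>' ..
    show ?thesis using adm that by (rule drawn.separated_query_succeeds)
  qed
  ultimately show ?thesis by blast
qed

end

lemma le_mult_Min:
  fixes x c :: real
  assumes "real t \<le> c * x" "1 \<le> x" "0 < i" "0 < j"
  shows "real t \<le> c * (x * Min {real i, real j, x})"
proof -
  have "1 \<le> Min {real i, real j, x}" using assms(2-4) by simp
  moreover have "0 \<le> c * x" using assms(1) by (rule order_trans[rotated]) simp
  ultimately have "c * x * 1 \<le> c * x * Min {real i, real j, x}" by (rule mult_left_mono)
  then show ?thesis using assms(1) by (simp only: mult.assoc mult_1_right)
qed

theorem theorem5:
  shows "\<exists>D. sample_free (query D) \<and> sample_free (merge D) \<and>
    (\<forall>\<alpha>>1. \<forall>C>0. \<exists>K k. \<forall>n d m xs.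
       n \<ge> 1 \<and> real d \<le> C * log 2 (real n + 1) \<and>
       length xs = n \<and> distinct xs \<and> (\<forall>p\<in>set xs. length p = d) \<and>
       m = nat \<lfloor>polylog K k n * real n powr (1 + 1 / \<alpha>\<^sup>2)\<rfloor> \<longrightarrow>
       (\<forall>\<omega>. \<exists>t s. big_step m (initialize D) (start xs d \<alpha> \<omega>) t s \<and>
          real t \<le> polylog K k n * real n powr (1 + 1 / \<alpha>\<^sup>2)) \<and>
       (\<forall>\<omega> ops S q c.
          admissible (set xs) (singletons (set xs)) (ops @ [Query S q]) \<and>
          run m D xs d \<alpha> \<omega> ops c \<longrightarrow>
          (\<exists>t c'. op_step m D xs c (Query S q) t c' \<and>
             real t \<le> polylog K k n * real n powr (1 / \<alpha>\<^sup>2))) \<and>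
       (\<forall>\<omega> ops S S' c.
          admissible (set xs) (singletons (set xs)) (ops @ [Merge S S']) \<and>
          run m D xs d \<alpha> \<omega> ops c \<longrightarrow>
          (\<exists>t c'. op_step m D xs c (Merge S S') t c' \<and>
             real t \<le> polylog K k n * (real n powr (1 / \<alpha>\<^sup>2) *
               Min {real (card S), real (card S'), real n powr (1 / \<alpha>\<^sup>2)}))) \<and>
       (\<forall>ops S q.
          admissible (set xs) (singletons (set xs)) (ops @ [Query S q]) \<longrightarrow>
          (\<exists>A\<in>sets coin_space. {\<omega>. \<not> query_succeeds m D xs d \<alpha> \<omega> ops S q} \<subseteq> A \<and>
             measure coin_space A \<le> 1 / real n ^ 3)))"
proof (intro exI[of _ afn_structure] conjI sample_free_afn_structure allI impI, goal_cases)
  case (1 \<alpha> C)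
  show ?case
  proof (rule exI[of _ "800000 * (2 + C) ^ 4"], rule exI[of _ 4], intro allI impI, elim conjE, goal_cases)
    case (1 n d m xs)
    obtain b W e where input: "afn_input n d b W m \<alpha> e xs"
      and query: "real (layout.budget d b W) \<le> polylog (800000 * (2 + C) ^ 4) 4 n * real n powr (1 / \<alpha>\<^sup>2)"
      and init: "real (layout.budget d b W * n) \<le> polylog (800000 * (2 + C) ^ 4) 4 n *
          real n powr (1 + 1 / \<alpha>\<^sup>2)"
      by (rule exists_afn_input[OF \<open>1 < \<alpha>\<close> 1])
    interpret afn_input n d b W m \<alpha> e xs by (rule input)
    interpret afn n d b W m \<alpha> e xs \<omega> for \<omega> ..
    have N: "1 \<le> real n powr (1 / \<alpha>\<^sup>2)" using 1(1) by (simp add: ge_one_powr_ge_zero)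
    note within = order_trans[OF of_nat_mono]
    show ?case
    proof (intro conjI allI impI, goal_cases)
      case (1 \<omega>)
      show ?case using initialize_within_budget[of \<omega>] within[OF _ init] by blast
    next
      case 2
      then show ?case using query_within_budget within[OF _ query] by blast
    next
      case 3
      then show ?case
        using merge_within_budget le_mult_Min[OF within[OF _ query] N merged_clusters_nonempty] by blast
    next
      case 4
      then show ?case using query_failure_probability by blast
    qed
  qed
qed

end
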